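(* Let $k$ be a field, $\lambda\in k$, $X$ a well-ordered set, and $\Omega=\{P\}$ with $P$ a unary operator. Let $S\subseteq Lie(\{P\};X)$ be the set of all Lie $\{P\}$-polynomials $$f_{u,v}=(P([u])P([v]))-P((P([u])[v]))-P(([u]P([v])))-\lambda P(([u][v])),$$ where $u,v\in ALSW(\{P\};X)$ and $u>_{Dl}v$. Then, with the order $>_{Dl}$ on $\langle\{P\};X\rangle$, the set $S$ is a Gröbner-Shirshov basis in $Lie(\{P\};X)$. It follows that the set $$Irr(S)=\left\{[w]\in NLSW(\{P\};X) : w\neq\pi|_{P(u)P(v)}\ \text{for all}\ \pi\in\langle\{P\};X\rangle^\star,\ u,v\in ALSW(\{P\};X)\ \text{with}\ u>_{Dl}v\right\}$$ is a linear basis of the free $\lambda$-Rota-Baxter Lie algebra $RBL(X)=Lie(\{P\};X|S)=Lie(\{P\};X)/Id_{Lie}(S)$ on $X$.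
   Context: A $\lambda$-Rota-Baxter Lie algebra is a Lie algebra $L$ over $k$ with a linear map $P:L\to L$ satisfying $[P(x)P(y)]=P([P(x)y])+P([xP(y)])+\lambda P([xy])$ for all $x,y\in L$; free objects on $X$ are in the usual sense (homomorphisms commute with $P$). The definitions below are for a general operator set $\Omega$; in the claim $\Omega=\{P\}$ with $P$ unary. **Words.** $k$ is a field, $X$ a set, $\Omega=\bigcup_{m\ge1}\Omega_m$ where $\Omega_m$ is a set of $m$-ary operator symbols; $X$ and $\Omega$ carry well orders. For a set $Y$: $S(Y)$ is the set of nonempty associative words on $Y$, $Y^*=S(Y)\cup\{1\}$ ($1$ the empty word), and $\Omega(Y)=\bigcup_m\{\omega(y_1,\dots,y_m): y_i\in Y,\ \omega\in\Omega_m\}$ (formal expressions). Put $\langle\Omega;X\rangle_0=S(X)$, $\langle\Omega;X\rangle_n=S(X\cup\Omega(\langle\Omega;X\rangle_{n-1}))$, $\langle\Omega;X\rangle=\bigcup_n\langle\Omega;X\rangle_n$ (associative $\Omega$-words). **Order.** Elements of $X\cup\Omega(\langle\Omega;X\rangle)$ are called prime; each $u\in\langle\Omega;X\rangle$ is uniquely $u=u_1\cdots u_n$ with $u_i$ prime, and $bre(u)=n$; $deg(u)$ is the total number of occurrences of elements of $X$ and $\Omega$ in $u$. Put $wt(u)=(deg(u),bre(u),u_1,\dots,u_n)$. The order $>_{Dl}$ on $\langle\Omega;X\rangle$: $u>_{Dl}v$ iff $wt(u)>wt(v)$ lexicographically, where primes are compared first by degree; primes of degree $1$ are elements of $X$,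 compared by the order of $X$; primes $\omega(a_1,\dots,a_t)$, $\theta(b_1,\dots,b_l)$ of equal degree are compared by comparing $(\omega,a_1,\dots,a_t)$ and $(\theta,b_1,\dots,b_l)$ lexicographically (operators by the order of $\Omega$, arguments recursively by $>_{Dl}$). Let $\succ$ be the restriction of $>_{Dl}$ to prime elements. **Lyndon-Shirshov words.** For an ordered set $Z$, the lex order on $Z^*$: $1>_{lex}u$ for every nonempty $u$, and $zu'>_{lex}z'v'$ ($z,z'\in Z$) iff $z>z'$, or $z=z'$ and $u'>_{lex}v'$. $ALSW(Z)$ is the set of nonempty words $w$ with $uv>_{lex}vu$ for every factorization $w=uv$ with $u,v\ne1$. $NLSW(Z)$ is the set of non-associative (fully bracketed) words $(u)$ such that: the underlying associative word $u$ is in $ALSW(Z)$; if $(u)=((v)(w))$ then $(v),(w)\in NLSW(Z)$; and if moreover $(v)=((v_1)(v_2))$ then $v_2\le_{lex}w$. Each $u\in ALSW(Z)$ has exactly one bracketing $[u]\in NLSW(Z)$ (the Shirshov standard bracketing). **Lyndon-Shirshov $\Omega$-words.** $ALSW(\Omega;X)_0=ALSW(X)$, $ALSW(\Omega;X)_n=ALSW(X\cup\Omega(ALSW(\Omega;X)_{n-1}))$ with respect to $\succ_{lex}$, and $ALSW(\Omega;X)=\bigcup_nALSW(\Omega;X)_n$. The bracketing $[u]$ of $u\in ALSW(\Omega;X)$: $[x]=x$ for $x\in X$; $[\omega(u_1,\dots,u_m)]=\omega([u_1],\dots,[u_m])$; for $u=u_1\cdots u_m$ with $u_i$ prime, $[u]$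 is the Shirshov standard bracketing of the word $[u_1][u_2]\cdots[u_m]$ in the letters $[u_1],\dots,[u_m]$, ordered by $[p]\succ[q]$ iff $p\succ q$. $NLSW(\Omega;X)=\{[u]:u\in ALSW(\Omega;X)\}$. **Algebras.** A Lie $\Omega$-algebra is a Lie $k$-algebra with, for each $\omega\in\Omega_m$, an $m$-ary multilinear operation; an ideal of it is a Lie ideal $I$ such that $\omega(a_1,\dots,a_m)\in I$ whenever some $a_i\in I$. $Id_{Lie}(S)$ is the ideal of $Lie(\Omega;X)$ generated by $S$. $k\langle\Omega;X\rangle$ is the $k$-space with basis $\langle\Omega;X\rangle$, with concatenation as product and operators extended multilinearly. $Lie(\Omega;X)$ is the Lie $\Omega$-subalgebra of $k\langle\Omega;X\rangle$ generated by $X$ under $(uv)=uv-vu$ (and all operators); the elements $[u]$ are regarded as elements of $Lie(\Omega;X)$ by reading brackets as commutators. For $0\ne f\in k\langle\Omega;X\rangle$, $\bar f$ is the leading (largest) $\Omega$-word of $f$ with respect to $>_{Dl}$; $f$ is monic if the coefficient of $\bar f$ is $1$; a set is monic if all its elements are. (For $0\neq f\in Lie(\Omega;X)$ one has $\bar f\in ALSW(\Omega;X)$.) **Special normal words.** $\langle\Omega;X\rangle^\star$ is the set of $\star$-$\Omega$-words: associative $\Omega$-words on $X\cup\{\star\}$ with exactly one occurrence of $\star\notin X$; $\pi|_s$ is the result of substituting $s$ for $\star$ in $\pi$ (expanded multilinearly). If $v,\pi|_v\in ALSW(\Omega;X)$, there are $\pi_1\in\langle\Omega;X\rangle^\star$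 and a possibly empty $\Omega$-word $c$ with $[\pi|_v]=[\pi_1|_{[vc]}]$, i.e. $\pi=\pi_1|_{\star c}$, $vc\in ALSW(\Omega;X)$, and the bracketed word $[\pi|_v]$ has $[vc]$ as a bracketed subword at the place of $\star$ in $\pi_1$. Write (uniquely) $c=c_1\cdots c_m$ with $c_i\in ALSW(\Omega;X)$, $c_t\preceq_{lex}c_{t+1}$, and let $[\pi|_v]_v$ be obtained from $[\pi|_v]$ by replacing this subword $[vc]$ by $[\cdots[[[v][c_1]][c_2]]\cdots[c_m]]$; a choice of $(\pi_1,c)$ is fixed for each $(\pi,v)$. For monic $f\in Lie(\Omega;X)$ with $\pi|_{\bar f}\in ALSW(\Omega;X)$, the special normal $f$-word $[\pi|_f]_{\bar f}\in Lie(\Omega;X)$ is obtained from $[\pi|_{\bar f}]_{\bar f}$ by replacing the distinguished factor $[\bar f]$ by $f$. **Compositions.** Let $f,g\in Lie(\Omega;X)$ be monic. (a) If $w=\bar fa=b\bar g$ with $a,b\in\langle\Omega;X\rangle$ and $bre(w)<bre(\bar f)+bre(\bar g)$, then $\langle f,g\rangle_w=[fa]_{\bar f}-[bg]_{\bar g}$ (intersection composition; $\pi=\star a$ and $\pi=b\star$ respectively). (b) If $w=\bar f=\pi|_{\bar g}$ with $\pi\in\langle\Omega;X\rangle^\star$, then $\langle f,g\rangle_w=f-[\pi|_g]_{\bar g}$ (inclusion composition). A composition is trivial modulo $(S,w)$ if it equals a finite sum $\sum\alpha_i[\pi_i|_{s_i}]_{\overline{s_i}}$ with $\alpha_i\in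 k$, $s_i\in S$, $[\pi_i|_{s_i}]_{\overline{s_i}}$ special normal $s_i$-words and $\pi_i|_{\overline{s_i}}<_{Dl}w$. A monic set $S\subseteq Lie(\Omega;X)$ is a Gröbner-Shirshov basis in $Lie(\Omega;X)$ if every composition $\langle f,g\rangle_w$ of $f,g\in S$ is trivial modulo $(S,w)$. *)

theory Defs
  imports "Jordan_Normal_Form.VS_Connect" "HOL-Algebra.QuotRing" "HOL-Library.Poly_Mapping"
begin

section \<open>Associative words with one unary operator\<close>

text \<open>The operator set is \<open>{P}\<close> throughout, and \<open>Op\<close> is the symbol \<open>P\<close>.
  The datatype also contains operators applied to the empty word; \<open>words\<close> excludes them.
  The length of a list of letters is the breadth \<open>bre\<close>.\<close>

datatype 'a letter = Var 'a | Op "'a letter list"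

type_synonym 'a word = "'a letter list"

definition neWords :: "'b set \<Rightarrow> 'b list set" where
  "neWords Y = {w. w \<noteq> [] \<and> set w \<subseteq> Y}"

primrec words_upto :: "'a set \<Rightarrow> nat \<Rightarrow> 'a word set" where
  "words_upto X 0 = neWords (Var ` X)"
| "words_upto X (Suc n) = neWords (Var ` X \<union> Op ` words_upto X n)"

definition words :: "'a set \<Rightarrow> 'a word set" where
  "words X = (\<Union>n. words_upto X n)"

primrec ldeg :: "'a letter \<Rightarrow> nat" where
  "ldeg (Var a) = 1"
| "ldeg (Op w) = Suc (sum_list (map ldeg w))"

definition deg :: "'a word \<Rightarrow> nat" where
  "deg w = sum_list (map ldeg w)"

text \<open>\<open>dl_less v u\<close> is \<open>u >\<^bsub>Dl\<^esub> v\<close>. On well-formed words a prime of degree 1 is a variable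
  and a prime of larger degree is an operator word, so \<open>prime_less\<close> covers all cases.\<close>

inductive prime_less :: "'a::linorder letter \<Rightarrow> 'a letter \<Rightarrow> bool"
  and dl_less :: "'a word \<Rightarrow> 'a word \<Rightarrow> bool"
where
  prime_deg: "ldeg p < ldeg q \<Longrightarrow> prime_less p q"
| prime_Var: "x < y \<Longrightarrow> prime_less (Var x) (Var y)"
| prime_Op: "\<lbrakk>deg u = deg v; dl_less u v\<rbrakk> \<Longrightarrow> prime_less (Op u) (Op v)"
| dl_deg: "deg u < deg v \<Longrightarrow> dl_less u v"
| dl_bre: "\<lbrakk>deg u = deg v; length u < length v\<rbrakk> \<Longrightarrow> dl_less u v"
| dl_lex: "\<lbrakk>deg (w @ p # u) = deg (w @ q # v); length u = length v; prime_less p q\<rbrakk>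
    \<Longrightarrow> dl_less (w @ p # u) (w @ q # v)"

definition prime_gt :: "'a::linorder letter \<Rightarrow> 'a letter \<Rightarrow> bool" where
  "prime_gt p q \<longleftrightarrow> dl_less [q] [p]"


section \<open>Lyndon-Shirshov words\<close>

text \<open>\<open>lex_gt gt u v\<close> is \<open>u >\<^bsub>lex\<^esub> v\<close>; a proper prefix is larger than the word it
  is a prefix of.\<close>

fun lex_gt :: "('b \<Rightarrow> 'b \<Rightarrow> bool) \<Rightarrow> 'b list \<Rightarrow> 'b list \<Rightarrow> bool" where
  "lex_gt gt [] v \<longleftrightarrow> v \<noteq> []"
| "lex_gt gt (z # u) [] \<longleftrightarrow> False"
| "lex_gt gt (z # u) (z' # v) \<longleftrightarrow> gt z z' \<or> z = z' \<and> lex_gt gt u v"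

definition ALSW :: "('b \<Rightarrow> 'b \<Rightarrow> bool) \<Rightarrow> 'b set \<Rightarrow> 'b list set" where
  "ALSW gt Z = {w \<in> neWords Z. \<forall>u v. w = u @ v \<and> u \<noteq> [] \<and> v \<noteq> [] \<longrightarrow> lex_gt gt (u @ v) (v @ u)}"

datatype 'b bracketing = Leaf 'b | Node "'b bracketing" "'b bracketing"

primrec leaves :: "'b bracketing \<Rightarrow> 'b list" where
  "leaves (Leaf z) = [z]"
| "leaves (Node s t) = leaves s @ leaves t"

primrec NLSW :: "('b \<Rightarrow> 'b \<Rightarrow> bool) \<Rightarrow> 'b set \<Rightarrow> 'b bracketing \<Rightarrow> bool" where
  "NLSW gt Z (Leaf z) \<longleftrightarrow> leaves (Leaf z) \<in> ALSW gt Z"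
| "NLSW gt Z (Node s t) \<longleftrightarrow> leaves (Node s t) \<in> ALSW gt Z \<and> NLSW gt Z s \<and> NLSW gt Z t \<and>
     (\<forall>s1 s2. s = Node s1 s2 \<longrightarrow> leaves s2 = leaves t \<or> lex_gt gt (leaves t) (leaves s2))"

definition standard_bracketing :: "('b \<Rightarrow> 'b \<Rightarrow> bool) \<Rightarrow> 'b list \<Rightarrow> 'b bracketing" where
  "standard_bracketing gt u = (THE t. NLSW gt (set u) t \<and> leaves t = u)"


section \<open>Lyndon-Shirshov words with an operator\<close>

primrec ALSW_op_upto :: "'a::linorder set \<Rightarrow> nat \<Rightarrow> 'a word set" where
  "ALSW_op_upto X 0 = ALSW prime_gt (Var ` X)"
| "ALSW_op_upto X (Suc n) = ALSW prime_gt (Var ` X \<union> Op ` ALSW_op_upto X n)"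

definition ALSW_op :: "'a::linorder set \<Rightarrow> 'a word set" where
  "ALSW_op X = (\<Union>n. ALSW_op_upto X n)"

datatype 'a nword = NVar 'a | NOp "'a nword" | NBr "'a nword" "'a nword"

primrec foliage :: "'a nword \<Rightarrow> 'a word" where
  "foliage (NVar a) = [Var a]"
| "foliage (NOp t) = [Op (foliage t)]"
| "foliage (NBr s t) = foliage s @ foliage t"

primrec flatten :: "'a nword bracketing \<Rightarrow> 'a nword" where
  "flatten (Leaf z) = z"
| "flatten (Node s t) = NBr (flatten s) (flatten t)"

text \<open>A bracketed letter \<open>[p]\<close> has the prime \<open>p\<close> as its foliage, so the letters
  \<open>[p]\<close> are compared through their foliage.\<close>

definition bracket_letters :: "'a::linorder nword list \<Rightarrow> 'a nword" where
  "bracket_letters zs = flatten (standard_bracketing (\<lambda>s t. dl_less (foliage t) (foliage s)) zs)"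

primrec bracket_letter :: "'a::linorder letter \<Rightarrow> 'a nword" where
  "bracket_letter (Var x) = NVar x"
| "bracket_letter (Op u) = NOp (bracket_letters (map bracket_letter u))"

definition bracket :: "'a::linorder word \<Rightarrow> 'a nword" where
  "bracket u = bracket_letters (map bracket_letter u)"

definition NLSW_op :: "'a::linorder set \<Rightarrow> 'a nword set" where
  "NLSW_op X = bracket ` ALSW_op X"


section \<open>Words with one star\<close>

text \<open>Words on \<open>X \<union> {\<star>}\<close> are words over \<open>'a option\<close>, where \<open>None\<close> is the star.\<close>

primrec lcount :: "'b \<Rightarrow> 'b letter \<Rightarrow> nat" where
  "lcount b (Var a) = (if a = b then 1 else 0)"
| "lcount b (Op w) = sum_list (map (lcount b) w)"

definition star_words :: "'a set \<Rightarrow> 'a option word set" where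
  "star_words X = {\<pi> \<in> words (insert None (Some ` X)). sum_list (map (lcount None) \<pi>) = 1}"

primrec lsubst :: "('b \<Rightarrow> 'c word) \<Rightarrow> 'b letter \<Rightarrow> 'c word" where
  "lsubst \<sigma> (Var b) = \<sigma> b"
| "lsubst \<sigma> (Op w) = [Op (concat (map (lsubst \<sigma>) w))]"

definition wsubst :: "('b \<Rightarrow> 'c word) \<Rightarrow> 'b word \<Rightarrow> 'c word" where
  "wsubst \<sigma> w = concat (map (lsubst \<sigma>) w)"

definition plug :: "'a option word \<Rightarrow> 'a word \<Rightarrow> 'a word" where
  "plug \<pi> v = wsubst (case_option v (\<lambda>x. [Var x])) \<pi>"

definition plug_star :: "'a option word \<Rightarrow> 'a option word \<Rightarrow> 'a option word" where
  "plug_star \<pi> \<rho> = wsubst (case_option \<rho> (\<lambda>x. [Var (Some x)])) \<pi>"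

abbreviation emb :: "'a word \<Rightarrow> 'a option word" where
  "emb w \<equiv> map (map_letter Some) w"

primrec nsubst :: "('b \<Rightarrow> 'c nword) \<Rightarrow> 'b nword \<Rightarrow> 'c nword" where
  "nsubst \<sigma> (NVar b) = \<sigma> b"
| "nsubst \<sigma> (NOp t) = NOp (nsubst \<sigma> t)"
| "nsubst \<sigma> (NBr s t) = NBr (nsubst \<sigma> s) (nsubst \<sigma> t)"

definition nplug :: "'a option nword \<Rightarrow> 'a nword \<Rightarrow> 'a nword" where
  "nplug T t = nsubst (case_option t NVar) T"

definition nplug_star :: "'a option nword \<Rightarrow> 'a option nword \<Rightarrow> 'a option nword" where
  "nplug_star T t = nsubst (case_option t (\<lambda>x. NVar (Some x))) T"


section \<open>Lie algebras with one linear operator\<close>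

text \<open>The fields \<open>mult\<close> and \<open>one\<close> inherited from \<^typ>\<open>('k, 'a) module\<close> play no role.\<close>

record ('k, 'a) lie_op = "('k, 'a) module" +
  lbr :: "'a \<Rightarrow> 'a \<Rightarrow> 'a"
  oper :: "'a \<Rightarrow> 'a"

locale lie_op_algebra = vectorspace class_ring L
  for L :: "('k::field, 'a, 'm) lie_op_scheme" (structure) +
  assumes lbr_closed: "\<lbrakk>x \<in> carrier L; y \<in> carrier L\<rbrakk> \<Longrightarrow> lbr L x y \<in> carrier L"
    and lbr_add_left: "\<lbrakk>x \<in> carrier L; y \<in> carrier L; z \<in> carrier L\<rbrakk>
      \<Longrightarrow> lbr L (x \<oplus> y) z = lbr L x z \<oplus> lbr L y z"
    and lbr_add_right: "\<lbrakk>x \<in> carrier L; y \<in> carrier L; z \<in> carrier L\<rbrakk>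
      \<Longrightarrow> lbr L x (y \<oplus> z) = lbr L x y \<oplus> lbr L x z"
    and lbr_smult_left: "\<lbrakk>x \<in> carrier L; y \<in> carrier L\<rbrakk> \<Longrightarrow> lbr L (c \<odot>\<^bsub>L\<^esub> x) y = c \<odot>\<^bsub>L\<^esub> lbr L x y"
    and lbr_smult_right: "\<lbrakk>x \<in> carrier L; y \<in> carrier L\<rbrakk> \<Longrightarrow> lbr L x (c \<odot>\<^bsub>L\<^esub> y) = c \<odot>\<^bsub>L\<^esub> lbr L x y"
    and lbr_alternating: "x \<in> carrier L \<Longrightarrow> lbr L x x = \<zero>"
    and jacobi: "\<lbrakk>x \<in> carrier L; y \<in> carrier L; z \<in> carrier L\<rbrakk>
      \<Longrightarrow> lbr L x (lbr L y z) \<oplus> lbr L y (lbr L z x) \<oplus> lbr L z (lbr L x y) = \<zero>"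
    and oper_closed: "x \<in> carrier L \<Longrightarrow> oper L x \<in> carrier L"
    and oper_add: "\<lbrakk>x \<in> carrier L; y \<in> carrier L\<rbrakk> \<Longrightarrow> oper L (x \<oplus> y) = oper L x \<oplus> oper L y"
    and oper_smult: "x \<in> carrier L \<Longrightarrow> oper L (c \<odot>\<^bsub>L\<^esub> x) = c \<odot>\<^bsub>L\<^esub> oper L x"

locale rota_baxter_lie_algebra = lie_op_algebra L
  for lam :: "'k::field" and L :: "('k::field, 'a, 'm) lie_op_scheme" (structure) +
  assumes rota_baxter: "\<lbrakk>x \<in> carrier L; y \<in> carrier L\<rbrakk>
      \<Longrightarrow> lbr L (oper L x) (oper L y) =
        oper L (lbr L (oper L x) y) \<oplus> oper L (lbr L x (oper L y)) \<oplus> lam \<odot>\<^bsub>L\<^esub> oper L (lbr L x y)"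

definition lie_op_subalgebra :: "'a set \<Rightarrow> ('k::field, 'a, 'm) lie_op_scheme \<Rightarrow> bool" where
  "lie_op_subalgebra A L \<longleftrightarrow> LinearCombinations.submodule class_ring A L \<and>
     (\<forall>x\<in>A. \<forall>y\<in>A. lbr L x y \<in> A) \<and> (\<forall>x\<in>A. oper L x \<in> A)"

definition lie_op_ideal :: "'a set \<Rightarrow> ('k::field, 'a, 'm) lie_op_scheme \<Rightarrow> bool" where
  "lie_op_ideal I L \<longleftrightarrow> LinearCombinations.submodule class_ring I L \<and>
     (\<forall>x\<in>carrier L. \<forall>a\<in>I. lbr L x a \<in> I \<and> lbr L a x \<in> I) \<and> (\<forall>a\<in>I. oper L a \<in> I)"

definition generated_ideal :: "('k::field, 'a, 'm) lie_op_scheme \<Rightarrow> 'a set \<Rightarrow> 'a set" where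
  "generated_ideal L S = (\<lambda>I. lie_op_ideal I L) hull S"

text \<open>Same pattern as \<^const>\<open>FactRing\<close>.\<close>

definition quotient_lie :: "('k, 'a, 'm) lie_op_scheme \<Rightarrow> 'a set \<Rightarrow> ('k, 'a set) lie_op" where
  "quotient_lie L I =
    \<lparr>carrier = a_rcosets\<^bsub>L\<^esub> I, mult = undefined, one = undefined, zero = I, add = set_add L,
     smult = (\<lambda>c A. \<Union>a\<in>A. I +>\<^bsub>L\<^esub> (c \<odot>\<^bsub>L\<^esub> a)),
     lbr = (\<lambda>A B. \<Union>a\<in>A. \<Union>b\<in>B. I +>\<^bsub>L\<^esub> lbr L a b),
     oper = (\<lambda>A. \<Union>a\<in>A. I +>\<^bsub>L\<^esub> oper L a)\<rparr>"

definition lie_op_hom ::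
  "('k::field, 'a, 'm) lie_op_scheme \<Rightarrow> ('k, 'b, 'n) lie_op_scheme \<Rightarrow> ('a \<Rightarrow> 'b) set" where
  "lie_op_hom L M = {h \<in> LinearCombinations.module_hom class_ring L M.
     (\<forall>x\<in>carrier L. \<forall>y\<in>carrier L. h (lbr L x y) = lbr M (h x) (h y)) \<and>
     (\<forall>x\<in>carrier L. h (oper L x) = oper M (h x))}"

text \<open>The universal property is tested against algebras with carrier in the type \<open>'l\<close>; a
  theorem that leaves \<open>'l\<close> as a type variable asserts it for all of them. Homomorphisms are
  functions on the carrier only, hence the restriction to extensional functions in the
  uniqueness part.\<close>

definition is_free_rota_baxter_lie ::
  "'l itself \<Rightarrow> 'k::field \<Rightarrow> 'x set \<Rightarrow> ('x \<Rightarrow> 'a) \<Rightarrow> ('k, 'a) lie_op \<Rightarrow> bool" where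
  "is_free_rota_baxter_lie _ lam X \<iota> F \<longleftrightarrow>
     rota_baxter_lie_algebra lam F \<and> \<iota> \<in> X \<rightarrow> carrier F \<and>
     (\<forall>(M :: ('k, 'l) lie_op) \<phi>. rota_baxter_lie_algebra lam M \<and> \<phi> \<in> X \<rightarrow> carrier M \<longrightarrow>
        (\<exists>!h. h \<in> lie_op_hom F M \<inter> extensional (carrier F) \<and> (\<forall>x\<in>X. h (\<iota> x) = \<phi> x)))"


section \<open>The free associative algebra and the free Lie algebra with an operator\<close>

text \<open>With concatenation as the addition on lists, the convolution product that
  \<^typ>\<open>'b \<Rightarrow>\<^sub>0 'k\<close> carries becomes the bilinear extension of concatenation.\<close>

instantiation list :: (type) monoid_add
begin

definition zero_list :: "'a list" where "0 = []"

definition plus_list :: "'a list \<Rightarrow> 'a list \<Rightarrow> 'a list" where "u + v = u @ v"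

instance
  by standard (simp_all add: zero_list_def plus_list_def)

end

type_synonym ('x, 'k) opoly = "'x word \<Rightarrow>\<^sub>0 'k"

abbreviation wd :: "'x word \<Rightarrow> ('x, 'k::field) opoly" where
  "wd w \<equiv> Poly_Mapping.single w 1"

definition scale :: "'k::field \<Rightarrow> ('x, 'k) opoly \<Rightarrow> ('x, 'k) opoly" where
  "scale c f = Poly_Mapping.map ((*) c) f"

definition commutator :: "('x, 'k::field) opoly \<Rightarrow> ('x, 'k) opoly \<Rightarrow> ('x, 'k) opoly" where
  "commutator f g = f * g - g * f"

definition opP :: "('x, 'k::field) opoly \<Rightarrow> ('x, 'k) opoly" where
  "opP f = (\<Sum>w\<in>Poly_Mapping.keys f. Poly_Mapping.single [Op w] (Poly_Mapping.lookup f w))"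

definition assoc_op :: "'x set \<Rightarrow> ('k::field, ('x, 'k) opoly) lie_op" where
  "assoc_op X = \<lparr>carrier = {f. Poly_Mapping.keys f \<subseteq> words X}, mult = (*), one = undefined,
     zero = 0, add = (+), smult = scale, lbr = commutator, oper = opP\<rparr>"

definition free_lie_op :: "'x set \<Rightarrow> ('k::field, ('x, 'k) opoly) lie_op" where
  "free_lie_op X = (assoc_op X)\<lparr>carrier :=
     (\<lambda>A. lie_op_subalgebra A (assoc_op X :: ('k, ('x, 'k) opoly) lie_op)) hull ((\<lambda>x. wd [Var x]) ` X)\<rparr>"

primrec neval :: "('b \<Rightarrow> ('x, 'k::field) opoly) \<Rightarrow> 'b nword \<Rightarrow> ('x, 'k) opoly" where
  "neval \<sigma> (NVar b) = \<sigma> b"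
| "neval \<sigma> (NOp t) = opP (neval \<sigma> t)"
| "neval \<sigma> (NBr s t) = commutator (neval \<sigma> s) (neval \<sigma> t)"

abbreviation lie_elem :: "'x nword \<Rightarrow> ('x, 'k::field) opoly" where
  "lie_elem t \<equiv> neval (\<lambda>x. wd [Var x]) t"

definition lead_word :: "('x::linorder, 'k::field) opoly \<Rightarrow> 'x word" where
  "lead_word f = (THE w. w \<in> Poly_Mapping.keys f \<and>
     (\<forall>v\<in>Poly_Mapping.keys f. v = w \<or> dl_less v w))"

definition monic_opoly :: "('x::linorder, 'k::field) opoly \<Rightarrow> bool" where
  "monic_opoly f \<longleftrightarrow> f \<noteq> 0 \<and> Poly_Mapping.lookup f (lead_word f) = 1"


section \<open>Special normal words\<close>

text \<open>The pair \<open>(\<pi>\<^sub>1, c)\<close> is represented by \<open>(T, c)\<close>, where \<open>T\<close> is the bracketed star word with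
  foliage \<open>\<pi>\<^sub>1\<close> obtained from \<open>[\<pi>|\<^sub>v]\<close> by putting the star in place of the subword \<open>[vc]\<close>.\<close>

definition admissible ::
  "'x::linorder set \<Rightarrow> 'x option word \<Rightarrow> 'x word \<Rightarrow> 'x option nword \<times> 'x word \<Rightarrow> bool" where
  "admissible X \<pi> v = (\<lambda>(T, c). foliage T \<in> star_words X \<and> c \<in> insert [] (words X) \<and>
     \<pi> = plug_star (foliage T) (Var None # emb c) \<and> v @ c \<in> ALSW_op X \<and>
     bracket (plug \<pi> v) = nplug T (bracket (v @ c)))"

type_synonym 'x choice = "'x option word \<Rightarrow> 'x word \<Rightarrow> 'x option nword \<times> 'x word"

definition valid_choice ::
  "'x::linorder set \<Rightarrow> 'x choice \<Rightarrow> bool" where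
  "valid_choice X ch \<longleftrightarrow> (\<forall>\<pi>\<in>star_words X. \<forall>v\<in>ALSW_op X.
     plug \<pi> v \<in> ALSW_op X \<longrightarrow> admissible X \<pi> v (ch \<pi> v))"

definition lyndon_factors :: "'x::linorder set \<Rightarrow> 'x word \<Rightarrow> 'x word list" where
  "lyndon_factors X c = (THE cs. concat cs = c \<and> set cs \<subseteq> ALSW_op X \<and>
     (\<forall>t. Suc t < length cs \<longrightarrow> cs ! t = cs ! Suc t \<or> lex_gt prime_gt (cs ! Suc t) (cs ! t)))"

text \<open>The bracketed star word obtained from \<open>[\<pi>|\<^sub>v]\<^sub>v\<close> by putting the star in place of
  the distinguished factor \<open>[v]\<close>.\<close>

definition special_context ::
  "'x::linorder set \<Rightarrow> 'x choice \<Rightarrow>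
   'x option word \<Rightarrow> 'x word \<Rightarrow> 'x option nword" where
  "special_context X ch \<pi> v = (case ch \<pi> v of (T, c) \<Rightarrow>
     nplug_star T (foldl (\<lambda>t ci. NBr t (map_nword Some (bracket ci))) (NVar None) (lyndon_factors X c)))"

definition special_normal ::
  "'x::linorder set \<Rightarrow> 'x choice \<Rightarrow>
   'x option word \<Rightarrow> ('x, 'k::field) opoly \<Rightarrow> ('x, 'k) opoly" where
  "special_normal X ch \<pi> f =
     neval (case_option f (\<lambda>x. wd [Var x])) (special_context X ch \<pi> (lead_word f))"


section \<open>Compositions and Groebner-Shirshov bases\<close>

inductive composition ::
  "'x::linorder set \<Rightarrow> 'x choice \<Rightarrow>
   ('x, 'k::field) opoly \<Rightarrow> ('x, 'k) opoly \<Rightarrow> 'x word \<Rightarrow> ('x, 'k) opoly \<Rightarrow> bool"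
  for X ch f g
where
  intersection: "\<lbrakk>a \<in> words X; b \<in> words X; w = lead_word f @ a; w = b @ lead_word g;
      length w < length (lead_word f) + length (lead_word g)\<rbrakk>
    \<Longrightarrow> composition X ch f g w
          (special_normal X ch (Var None # emb a) f - special_normal X ch (emb b @ [Var None]) g)"
| inclusion: "\<lbrakk>\<pi> \<in> star_words X; w = lead_word f; w = plug \<pi> (lead_word g)\<rbrakk>
    \<Longrightarrow> composition X ch f g w (f - special_normal X ch \<pi> g)"

definition trivial_mod ::
  "'x::linorder set \<Rightarrow> 'x choice \<Rightarrow>
   ('x, 'k::field) opoly set \<Rightarrow> 'x word \<Rightarrow> ('x, 'k) opoly \<Rightarrow> bool" where
  "trivial_mod X ch S w h \<longleftrightarrow> (\<exists>(n::nat) \<alpha> \<pi> s.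
     (\<forall>i<n. s i \<in> S \<and> \<pi> i \<in> star_words X \<and> plug (\<pi> i) (lead_word (s i)) \<in> ALSW_op X \<and>
        dl_less (plug (\<pi> i) (lead_word (s i))) w) \<and>
     h = (\<Sum>i<n. scale (\<alpha> i) (special_normal X ch (\<pi> i) (s i))))"

definition GS_basis ::
  "'x::linorder set \<Rightarrow> 'x choice \<Rightarrow>
   ('x, 'k::field) opoly set \<Rightarrow> bool" where
  "GS_basis X ch S \<longleftrightarrow> S \<subseteq> carrier (free_lie_op X) \<and> (\<forall>f\<in>S. monic_opoly f) \<and>
     (\<forall>f\<in>S. \<forall>g\<in>S. \<forall>w h. composition X ch f g w h \<longrightarrow> trivial_mod X ch S w h)"


section \<open>Free Rota-Baxter Lie algebras\<close>

definition rb_poly :: "'k::field \<Rightarrow> 'x::linorder word \<Rightarrow> 'x word \<Rightarrow> ('x, 'k) opoly" where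
  "rb_poly lam u v =
     (let U = lie_elem (bracket u); V = lie_elem (bracket v) in
      commutator (opP U) (opP V) - opP (commutator (opP U) V) - opP (commutator U (opP V))
        - scale lam (opP (commutator U V)))"

definition rb_relations :: "'k::field \<Rightarrow> 'x::linorder set \<Rightarrow> ('x, 'k) opoly set" where
  "rb_relations lam X = {rb_poly lam u v | u v. u \<in> ALSW_op X \<and> v \<in> ALSW_op X \<and> dl_less v u}"

definition RBL_ideal :: "'k::field \<Rightarrow> 'x::linorder set \<Rightarrow> ('x, 'k) opoly set" where
  "RBL_ideal lam X = generated_ideal (free_lie_op X) (rb_relations lam X)"

definition RBL :: "'k::field \<Rightarrow> 'x::linorder set \<Rightarrow> ('k, ('x, 'k) opoly set) lie_op" where
  "RBL lam X = quotient_lie (free_lie_op X) (RBL_ideal lam X)"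

definition RBL_class :: "'k::field \<Rightarrow> 'x::linorder set \<Rightarrow> ('x, 'k) opoly \<Rightarrow> ('x, 'k) opoly set" where
  "RBL_class lam X f = RBL_ideal lam X +>\<^bsub>free_lie_op X :: ('k, ('x, 'k) opoly) lie_op\<^esub> f"

definition Irr_RB :: "'x::linorder set \<Rightarrow> 'x nword set" where
  "Irr_RB X = {bracket w | w. w \<in> ALSW_op X \<and>
     (\<forall>\<pi>\<in>star_words X. \<forall>u\<in>ALSW_op X. \<forall>v\<in>ALSW_op X. dl_less v u \<longrightarrow> w \<noteq> plug \<pi> [Op u, Op v])}"

end

theory Submission
  imports Defs
begin

text \<open>
  Every special normal word \<open>[\<pi>|\<^sub>s]\<close> has the leading word \<open>\<pi>|\<^bsub>s'\<^esub>\<close>, where \<open>s'\<close> is the leading word of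
  \<open>s\<close>, and lies in the ideal. Hence everything follows once every nonzero element of the ideal is
  known to have a reducible leading word: the irreducible brackets are then independent modulo the
  ideal, they span by rewriting with special normal words, and a composition, being an element of the ideal
  with leading word below \<open>w\<close>, rewrites to zero with special normal words below \<open>w\<close>.

  The statement on leading words is proved in the larger associative ideal, where the only critical
  ambiguity is \<open>P(u)P(v)P(z)\<close>. Put \<open>a \<circ> b = [P(a), b] + [a, P(b)] + \<lambda>[a, b]\<close> and
  \<open>F(a, b) = [P(a), P(b)] - P(a \<circ> b)\<close>. The Jacobi identity gives
  \<open>\<Sum> [F(a, b), P(c)] = \<Sum> P([F(a, b), c]) - \<Sum> F(a \<circ> b, c)\<close>, with cyclic sums over \<open>a, b, c\<close>.
  For \<open>a = [u]\<close>, \<open>b = [v]\<close>, \<open>c = [z]\<close> the left-hand side is the ambiguity up to smaller terms, and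
  the right-hand side has breadth at most two and no larger degree, hence is smaller as well.

  Freeness rests on the theorem that the Lyndon-Shirshov brackets span every Lie algebra with an operator that is
  generated by \<open>X\<close>, while in the associative algebra their leading words are distinct.\<close>

section \<open>The degree-lexicographic order\<close>

text \<open>The order compares degree first and breadth second, and this makes the cyclic identity
  usable: \<open>P(u)P(v)P(z)\<close> has breadth three, so any combination of rewriting steps of at
  most the same degree and of breadth at most two is smaller, whatever its leading words are. What
  has to be shown is therefore a membership with bounds: for Lie polynomials \<open>f\<close>,
  \<open>g\<close> of degrees at most \<open>m\<close>, \<open>n\<close>, the element
  \<open>F(f, g)\<close> is a combination of steps of degree at most \<open>m + n + 2\<close>, the
  two operators counted, and breadth at most two. The obstacle is that \<open>f\<close> and
  \<open>g\<close>, such as \<open>a \<circ> b\<close>, need not be irreducible brackets. They are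
  first expanded, without raising the degree bound, into irreducible brackets and rewriting steps;
  this rests on leading words alone, not on confluence, so nothing is circular. By bilinearity
  \<open>F\<close> is then needed on generators only: on two irreducible brackets it is zero or a
  relation up to sign, and on a rewriting step it is again a combination of steps. In the
  associative setting two steps at disjoint places visibly commute up to smaller terms, which
  bracketed Lie words do not show.\<close>

lemma ldeg_neq_0 [simp]: "ldeg p \<noteq> 0"
  by (cases p) auto

lemma deg_simps [simp]:
  "deg [] = 0" "deg (p # w) = ldeg p + deg w" "deg (u @ v) = deg u + deg v"
  by (auto simp: deg_def)

lemma ldeg_Op [simp]: "ldeg (Op w) = Suc (deg w)"
  by (simp add: deg_def)

declare ldeg.simps(2) [simp del]

lemma length_le_deg: "length w \<le> deg w"
proof (induction w)
  case (Cons p w)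
  then show ?case using ldeg_neq_0[of p] by (simp del: ldeg_neq_0)
qed simp

lemma ldeg_le_deg: "p \<in> set w \<Longrightarrow> ldeg p \<le> deg w"
  by (induction w) auto

abbreviation prime_rel :: "('a::linorder letter \<times> 'a letter) set" where
  "prime_rel \<equiv> {(p, q). prime_less p q}"

text \<open>At equal degree, comparing breadth and then the first differing letter is the library
  order \<open>lenlex\<close> over the order of letters, which inherits transitivity and
  well-foundedness from the letter relation.\<close>

lemma dl_less_iff:
  "dl_less u v \<longleftrightarrow> deg u < deg v \<or> deg u = deg v \<and> (u, v) \<in> lenlex prime_rel"
proof
  assume "dl_less u v"
  then show "deg u < deg v \<or> deg u = deg v \<and> (u, v) \<in> lenlex prime_rel"
    by cases (auto simp: lenlex_conv lex_conv)
next
  assume "deg u < deg v \<or> deg u = deg v \<and> (u, v) \<in> lenlex prime_rel"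
  then show "dl_less u v"
    by (fastforce simp: lenlex_conv lex_conv intro: prime_less_dl_less.intros)
qed

lemma prime_less_iff:
  "prime_less p q \<longleftrightarrow> ldeg p < ldeg q \<or> (\<exists>x y. p = Var x \<and> q = Var y \<and> x < y)
     \<or> (\<exists>u v. p = Op u \<and> q = Op v \<and> deg u = deg v \<and> (u, v) \<in> lenlex prime_rel)"
proof
  assume "prime_less p q"
  then show "ldeg p < ldeg q \<or> (\<exists>x y. p = Var x \<and> q = Var y \<and> x < y)
     \<or> (\<exists>u v. p = Op u \<and> q = Op v \<and> deg u = deg v \<and> (u, v) \<in> lenlex prime_rel)"
    by cases (auto simp: dl_less_iff)
next
  assume "ldeg p < ldeg q \<or> (\<exists>x y. p = Var x \<and> q = Var y \<and> x < y)
     \<or> (\<exists>u v. p = Op u \<and> q = Op v \<and> deg u = deg v \<and> (u, v) \<in> lenlex prime_rel)"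
  then show "prime_less p q"
    by (metis dl_less_iff prime_deg prime_Op prime_Var)
qed

lemma prime_less_ldeg: "prime_less p q \<Longrightarrow> ldeg p \<le> ldeg q"
  by (auto simp: prime_less_iff[of p q])

text \<open>The orders on letters and on words refer to each other, so neither can be shown
  well-founded or transitive first. The cut-off breaks the circle: the argument of an operator
  letter of degree at most \<open>Suc n\<close> has degree at most \<open>n\<close>, so its letters
  are compared within \<open>prime_rel_upto n\<close>, and induction on \<open>n\<close>
  applies.\<close>

definition prime_rel_upto :: "nat \<Rightarrow> ('a::linorder letter \<times> 'a letter) set" where
  "prime_rel_upto n = {(p, q). prime_less p q \<and> ldeg q \<le> n}"

lemma lenlex_upto:
  assumes "deg v \<le> n"
  shows "(u, v) \<in> lenlex prime_rel \<longleftrightarrow> (u, v) \<in> lenlex (prime_rel_upto n)"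
  using assms ldeg_le_deg[of _ v]
  by (fastforce simp: lenlex_conv lex_conv prime_rel_upto_def)

lemma prime_rel_upto_Suc:
  "(p, q) \<in> prime_rel_upto (Suc n) \<longleftrightarrow> ldeg q \<le> Suc n \<and> (ldeg p < ldeg q \<or>
     (\<exists>x y. p = Var x \<and> q = Var y \<and> x < y) \<or>
     (\<exists>u v. p = Op u \<and> q = Op v \<and> deg u = deg v \<and> (u, v) \<in> lenlex (prime_rel_upto n)))"
proof -
  have "(u, v) \<in> lenlex prime_rel \<longleftrightarrow> (u, v) \<in> lenlex (prime_rel_upto n)" if "q = Op v" "ldeg q \<le> Suc n"
    for u v using that by (intro lenlex_upto) simp
  then show ?thesis
    unfolding prime_rel_upto_def[of "Suc n"] mem_Collect_eq case_prod_conv prime_less_iff[of p q] by blast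
qed

lemma prime_rel_upto_0: "prime_rel_upto 0 = {}"
  by (auto simp: prime_rel_upto_def)

lemma trans_prime_rel_upto: "trans (prime_rel_upto n)"
proof (induction n)
  case (Suc n)
  then have tr: "trans (lenlex (prime_rel_upto n :: ('a letter \<times> 'a letter) set))" by blast
  show ?case
  proof (rule transI)
    fix p q r :: "'a letter"
    assume pq: "(p, q) \<in> prime_rel_upto (Suc n)" and qr: "(q, r) \<in> prime_rel_upto (Suc n)"
    then have le: "ldeg p \<le> ldeg q" "ldeg q \<le> ldeg r" "ldeg r \<le> Suc n"
      by (auto simp: prime_rel_upto_def prime_less_ldeg)
    show "(p, r) \<in> prime_rel_upto (Suc n)"
    proof (cases "ldeg p < ldeg r")
      case False
      with le have eq: "ldeg p = ldeg q" "ldeg q = ldeg r" by auto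
      show ?thesis
      proof (cases p)
        case (Var x)
        then show ?thesis using pq qr eq unfolding prime_rel_upto_Suc by auto
      next
        case (Op u)
        then obtain v where q: "q = Op v" "deg u = deg v" "(u, v) \<in> lenlex (prime_rel_upto n)"
          using pq eq unfolding prime_rel_upto_Suc by auto
        then obtain w where "r = Op w" "deg v = deg w" "(v, w) \<in> lenlex (prime_rel_upto n)"
          using qr eq unfolding prime_rel_upto_Suc by auto
        with q Op le transD[OF tr] show ?thesis unfolding prime_rel_upto_Suc by auto
      qed
    qed (use le in \<open>auto simp: prime_rel_upto_Suc\<close>)
  qed
qed (simp add: prime_rel_upto_0)

lemma wf_prime_rel_upto: "wf (prime_rel_upto n :: ('a::wellorder letter \<times> 'a letter) set)"
proof (induction n)
  case (Suc n)
  \<comment> \<open>The dummy \<open>undefined\<close> is the same for all operator letters, so two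
    of them of equal degree are compared through their arguments alone.\<close>
  define h :: "'a letter \<Rightarrow> nat \<times> 'a \<times> 'a word" where
    "h p = (ldeg p, (case p of Var x \<Rightarrow> (x, []) | Op u \<Rightarrow> (undefined, u)))" for p
  let ?r = "less_than <*lex*> {(x, y :: 'a). x < y} <*lex*> lenlex (prime_rel_upto n :: ('a letter \<times> 'a letter) set)"
  have "wf ?r" using Suc wf by (intro wf_lex_prod wf_lenlex) auto
  moreover have "prime_rel_upto (Suc n) \<subseteq> inv_image ?r h"
    by (auto simp: prime_rel_upto_Suc h_def)
  ultimately show ?case by (meson wf_inv_image wf_subset)
qed (simp add: prime_rel_upto_0)

lemma prime_less_trans: "prime_less p q \<Longrightarrow> prime_less q r \<Longrightarrow> prime_less p r"
  using transD[OF trans_prime_rel_upto[of "ldeg r"], of p q r] prime_less_ldeg[of q r]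
  by (auto simp: prime_rel_upto_def)

text \<open>A smaller letter never has larger degree. Hence a minimum among the members of
  \<open>Q\<close> of degree at most \<open>ldeg p\<close>, taken for the truncated relation, is a
  minimum of \<open>Q\<close>.\<close>

lemma wf_prime_rel: "wf (prime_rel :: ('a::wellorder letter \<times> 'a letter) set)"
proof (rule wfI_min)
  fix p :: "'a letter" and Q assume "p \<in> Q"
  then obtain q where q: "q \<in> {q \<in> Q. ldeg q \<le> ldeg p}"
    "\<And>r. (r, q) \<in> prime_rel_upto (ldeg p) \<Longrightarrow> r \<notin> {q \<in> Q. ldeg q \<le> ldeg p}"
    using wfE_min[OF wf_prime_rel_upto[of "ldeg p"], of p "{q \<in> Q. ldeg q \<le> ldeg p}"] by blast
  then show "\<exists>z\<in>Q. \<forall>y. (y, z) \<in> prime_rel \<longrightarrow> y \<notin> Q"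
    using prime_less_ldeg by (intro bexI[of _ q]) (fastforce simp: prime_rel_upto_def)+
qed

lemma dl_less_trans: "dl_less u v \<Longrightarrow> dl_less v w \<Longrightarrow> dl_less u w"
  using lenlex_trans[of u v prime_rel w] prime_less_trans
  by (fastforce simp: dl_less_iff trans_def)

lemma wf_dl_less: "wf {(u, v :: 'a::wellorder word). dl_less u v}"
proof -
  have "wf (inv_image (less_than <*lex*> lenlex prime_rel) (\<lambda>w :: 'a word. (deg w, w)))"
    using wf_prime_rel by (intro wf_inv_image wf_lex_prod wf_lenlex) auto
  then show ?thesis by (rule wf_subset) (auto simp: dl_less_iff)
qed

lemma dl_less_irrefl [simp]: "\<not> dl_less u (u :: 'a::wellorder word)"
  using wf_irrefl[OF wf_dl_less] by auto

lemma prime_less_irrefl [simp]: "\<not> prime_less p (p :: 'a::wellorder letter)"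
  using wf_irrefl[OF wf_prime_rel] by auto

lemma dl_less_asym: "dl_less u v \<Longrightarrow> \<not> dl_less v (u :: 'a::wellorder word)"
  using dl_less_trans dl_less_irrefl by blast

lemma dl_less_deg: "dl_less u v \<Longrightarrow> deg u \<le> deg v"
  by (auto simp: dl_less_iff)

lemma dl_less_append_left:
  "dl_less u v \<Longrightarrow> dl_less (a @ u) (a @ v :: 'a::wellorder word)"
  by (auto simp: dl_less_iff irrefl_def)

lemma dl_less_append_right:
  "dl_less u v \<Longrightarrow> dl_less (u @ b) (v @ b :: 'a::wellorder word)"
  by (auto simp: dl_less_iff lenlex_append1)

lemma dl_less_single: "dl_less [p] [q] \<longleftrightarrow> prime_less p (q :: 'a::wellorder letter)"
  using prime_less_ldeg[of p q] by (auto simp: dl_less_iff Cons_lenlex_iff prime_less_iff[of p q])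

lemma prime_gt_iff: "prime_gt p q \<longleftrightarrow> prime_less q (p :: 'a::wellorder letter)"
  by (simp add: prime_gt_def dl_less_single)

lemma prime_less_Op: "prime_less (Op u) (Op v) \<longleftrightarrow> dl_less u (v :: 'a::wellorder word)"
  by (auto simp: prime_less_iff[of "Op u" "Op v"] dl_less_iff)

definition dl_le :: "'a::linorder word \<Rightarrow> 'a word \<Rightarrow> bool" where
  "dl_le u v \<longleftrightarrow> u = v \<or> dl_less u v"

lemma dl_le_refl [simp]: "dl_le u u"
  by (simp add: dl_le_def)

lemma dl_le_less_trans: "dl_le u v \<Longrightarrow> dl_less v w \<Longrightarrow> dl_less u w"
  and dl_le_trans: "dl_le u v \<Longrightarrow> dl_le v w \<Longrightarrow> dl_le u w"
  by (auto simp: dl_le_def intro: dl_less_trans)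

lemma dl_le_deg: "dl_le u v \<Longrightarrow> deg u \<le> deg v"
  by (auto simp: dl_le_def dl_less_deg)

text \<open>A strict decrease in one factor survives a weak decrease in the other, which is what
  makes leading words multiplicative.\<close>

lemma dl_less_append_mono:
  fixes u :: "'a::wellorder word"
  shows "dl_less u u' \<Longrightarrow> dl_le v v' \<Longrightarrow> dl_less (u @ v) (u' @ v')"
    and "dl_le u u' \<Longrightarrow> dl_less v v' \<Longrightarrow> dl_less (u @ v) (u' @ v')"
  by (metis dl_le_def dl_less_append_left dl_less_append_right dl_less_trans)+

section \<open>Well-formed words and totality of the order\<close>

definition letters :: "'a set \<Rightarrow> 'a letter set" where
  "letters X = Var ` X \<union> Op ` words X"

lemma words_upto_mono: "words_upto X n \<subseteq> words_upto X (Suc n)"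
proof (induction n)
  case (Suc n)
  then show ?case unfolding words_upto.simps(2)[of X "Suc n"] words_upto.simps(2)[of X n] neWords_def
    by blast
qed (auto simp: neWords_def)

text \<open>A word has finitely many letters, so they occur together at one stage of the
  construction; this turns the stagewise definitions of words into closed descriptions by
  letters.\<close>

lemma finite_subset_chain_UN:
  fixes f :: "nat \<Rightarrow> 'b set"
  assumes "finite A" "A \<subseteq> (\<Union>n. f n)" "\<And>n. f n \<subseteq> f (Suc n)"
  shows "\<exists>n. A \<subseteq> f n"
  using assms(1,2)
proof (induction A)
  case (insert a A)
  then obtain n m where "A \<subseteq> f n" "a \<in> f m" by auto
  then have "insert a A \<subseteq> f (max n m)"
    using lift_Suc_mono_le[of f, OF assms(3), of n "max n m"] lift_Suc_mono_le[of f, OF assms(3), of m "max n m"]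
    by auto
  then show ?case ..
qed simp

lemma words_eq: "words X = neWords (letters X)"
proof
  show "words X \<subseteq> neWords (letters X)"
  proof
    fix w assume "w \<in> words X"
    then obtain n where "w \<in> words_upto X n" by (auto simp: words_def)
    moreover have "words_upto X n \<subseteq> words X" for n
      unfolding words_def by blast
    ultimately show "w \<in> neWords (letters X)"
      by (cases n) (fastforce simp: neWords_def letters_def)+
  qed
  show "neWords (letters X) \<subseteq> words X"
  proof
    fix w assume w: "w \<in> neWords (letters X)"
    have "letters X \<subseteq> (\<Union>n. Var ` X \<union> Op ` words_upto X n)"
      by (auto simp: letters_def words_def)
    moreover have "Var ` X \<union> Op ` words_upto X n \<subseteq> Var ` X \<union> Op ` words_upto X (Suc n)" for n
      using words_upto_mono[of X n] by blast
    moreover have "set w \<subseteq> letters X" using w by (simp add: neWords_def)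
    ultimately have "\<exists>n. set w \<subseteq> Var ` X \<union> Op ` words_upto X n"
      by (intro finite_subset_chain_UN[of "set w" "\<lambda>n. Var ` X \<union> Op ` words_upto X n"])
        (simp, rule subset_trans, assumption+)
    then obtain n where "w \<in> words_upto X (Suc n)" using w by (auto simp: neWords_def)
    then show "w \<in> words X" unfolding words_def by blast
  qed
qed

lemma words_iff: "w \<in> words X \<longleftrightarrow> w \<noteq> [] \<and> set w \<subseteq> letters X"
  by (auto simp: words_eq neWords_def)

lemma letters_simps [simp]: "Var x \<in> letters X \<longleftrightarrow> x \<in> X" "Op w \<in> letters X \<longleftrightarrow> w \<in> words X"
  by (auto simp: letters_def)

lemma words_append: "u \<in> words X \<Longrightarrow> v \<in> words X \<Longrightarrow> u @ v \<in> words X"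
  by (simp add: words_iff)

text \<open>Well-formedness enters through the empty argument: \<open>Op []\<close> has degree 1 and
  is comparable with no variable, whereas the operator letters in \<open>letters X\<close> have
  degree at least 2 and exceed every variable.\<close>

lemma prime_less_total:
  assumes "p \<in> letters X" "q \<in> letters X"
  shows "p = q \<or> prime_less p q \<or> prime_less q p"
  using assms
proof (induction p arbitrary: q)
  case (Var x)
  then show ?case
  proof (cases q)
    case (Op v)
    with Var have "v \<noteq> []" by (auto simp: words_iff)
    then have "ldeg (Var x) < ldeg q" using length_le_deg[of v] Op by (cases v) auto
    then show ?thesis by (simp add: prime_deg)
    next
    case (Var y)
    then show ?thesis using prime_Var linorder_less_linear by blast
  qed
next
  case (Op u)
  show ?case
  proof (cases q)
    case (Var x)
    have "u \<noteq> []" using Op by (auto simp: words_iff)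
    then have "ldeg q < ldeg (Op u)" using length_le_deg[of u] Var by (cases u) auto
    then show ?thesis by (simp add: prime_deg)
  next
    case q: (Op v)
    have "u = v \<or> (u, v) \<in> lenlex prime_rel \<or> (v, u) \<in> lenlex prime_rel"
      using Op.prems Op.IH unfolding q letters_simps words_iff
    proof (induction u arbitrary: v)
      case Nil
      then show ?case by simp
    next
      case (Cons p u)
      from Cons.prems obtain q v' where v: "v = q # v'" by (cases v) auto
      have pq: "p = q \<or> prime_less p q \<or> prime_less q p"
        using Cons.prems v by auto
      show ?case
      proof (cases "length u = length v'")
        case False
        then show ?thesis unfolding v Cons_lenlex_iff by linarith
      next
        case len: True
        have "u = v' \<or> (u, v') \<in> lenlex prime_rel \<or> (v', u) \<in> lenlex prime_rel"
        proof (cases "u = []")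
          case False
          with len have "v' \<noteq> []" by auto
          with False show ?thesis using Cons.prems v by (intro Cons.IH) auto
        qed (use len in auto)
        with pq len show ?thesis unfolding v Cons_lenlex_iff by auto
      qed
    qed
    then show ?thesis unfolding q prime_less_iff[of "Op u" "Op v"] prime_less_iff[of "Op v" "Op u"]
      by (metis ldeg_Op linorder_cases letter.inject(2) not_less_eq)
  qed
qed

lemma dl_less_total:
  fixes u v :: "'a::wellorder word"
  assumes "u \<in> words X" "v \<in> words X"
  shows "u = v \<or> dl_less u v \<or> dl_less v u"
  using prime_less_total[of "Op u" X "Op v"] assms by (auto simp: prime_less_Op)

lemma finite_words_max:
  fixes F :: "'a::wellorder word set"
  assumes "finite F" "F \<noteq> {}" "F \<subseteq> words X"
  shows "\<exists>w\<in>F. \<forall>v\<in>F. dl_le v w"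
  using assms
proof (induction F rule: finite_ne_induct)
  case (insert u F)
  then obtain w where "w \<in> F" "\<forall>v\<in>F. dl_le v w" by auto
  with insert.prems dl_less_total[of u X w] show ?case
    by (metis dl_le_def dl_le_trans insert_iff insert_subset subsetD)
qed simp

text \<open>For words of equal length the convention on prefixes never comes into play, and both
  orders look at the first differing letter. Applied to the rotations \<open>u @ v\<close> and
  \<open>v @ u\<close>, this turns the Lyndon condition into a statement on leading words of
  commutators.\<close>

lemma lex_gt_imp_dl_less:
  fixes u v :: "'a::wellorder word"
  assumes "lex_gt prime_gt u v" "length u = length v" "deg u = deg v"
  shows "dl_less v u"
proof -
  have "(v, u) \<in> lenlex prime_rel"
    using assms(1,2) by (induction u v rule: list_induct2')
      (auto simp: Cons_lenlex_iff prime_gt_iff)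
  then show ?thesis using assms by (simp add: dl_less_iff)
qed

section \<open>Lyndon-Shirshov words over an ordered alphabet\<close>

lemma append_eq_cases:
  assumes "a @ b = c @ d"
  obtains (left) x where "a = c @ x" "d = x @ b" | (right) x where "c = a @ x" "b = x @ d"
  using assms by (metis append_eq_append_conv2)

locale ordered_alphabet =
  fixes gt :: "'b \<Rightarrow> 'b \<Rightarrow> bool" and Z :: "'b set"
  assumes gt_irrefl: "\<not> gt z z"
    and gt_trans: "gt x y \<Longrightarrow> gt y z \<Longrightarrow> gt x z"
    and gt_total: "x \<in> Z \<Longrightarrow> y \<in> Z \<Longrightarrow> x = y \<or> gt x y \<or> gt y x"
begin

text \<open>With \<open>u \<prec> v\<close> for \<open>u >\<^bsub>lex\<^esub> v\<close> prefixes are smaller, and Lyndon-Shirshov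
  words become classical Lyndon words, which are smaller than their proper suffixes.\<close>

abbreviation lex_less (infix "\<prec>" 50) where "u \<prec> v \<equiv> lex_gt gt u v"

abbreviation lex_le (infix "\<preceq>" 50) where "u \<preceq> v \<equiv> u = v \<or> u \<prec> v"

lemma lex_irrefl [simp]: "\<not> u \<prec> u"
  by (induction u) (auto simp: gt_irrefl)

lemma lex_trans: "u \<prec> v \<Longrightarrow> v \<prec> w \<Longrightarrow> u \<prec> w"
proof (induction u arbitrary: v w)
  case (Nil v w)
  then show ?case by (cases v; cases w) auto
next
  case (Cons z u v w)
  then show ?case by (cases v; cases w) (auto intro: gt_trans)
qed

lemma lex_total: "set u \<subseteq> Z \<Longrightarrow> set v \<subseteq> Z \<Longrightarrow> u = v \<or> u \<prec> v \<or> v \<prec> u"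
proof (induction u arbitrary: v)
  case (Nil v)
  then show ?case by (cases v) auto
next
  case (Cons z u v)
  then show ?case using gt_total[of z "hd v"] by (cases v) auto
qed

lemma lex_append_cancel [simp]: "x @ u \<prec> x @ v \<longleftrightarrow> u \<prec> v"
  by (induction x) (auto simp: gt_irrefl)

lemma lex_append_self [simp]: "u \<prec> u @ v \<longleftrightarrow> v \<noteq> []"
  by (induction u) (auto simp: gt_irrefl)

lemma lex_mismatch: "gt a b \<Longrightarrow> x @ a # u \<prec> x @ b # v"
  by simp

lemma lex_cases:
  assumes "u \<prec> v"
  obtains (prefix) x where "x \<noteq> []" "v = u @ x"
    | (mismatch) x a b u' v' where "u = x @ a # u'" "v = x @ b # v'" "gt a b"
  using assms
proof (induction u arbitrary: v thesis)
  case Nil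
  then show ?case by auto
next
  case (Cons z u)
  from Cons.prems obtain z' w where v: "v = z' # w" by (cases v) auto
  show ?case
  proof (cases "gt z z'")
    case True
    then show ?thesis using Cons.prems(2)[of "[]" z u z' w] v by auto
  next
    case False
    with Cons.prems v have "z = z'" "u \<prec> w" by auto
    with Cons.IH[OF _ _ \<open>u \<prec> w\<close>] show ?thesis
      using Cons.prems(1,2) v by (metis append_Cons)
  qed
qed

text \<open>As \<open>v\<close> is no longer than \<open>u\<close>, the word \<open>u\<close> is not
  a proper prefix of it; the comparison is decided by a letter and survives any
  continuation.\<close>

lemma lex_extend:
  assumes "u \<prec> v" "length v \<le> length u"
  shows "u @ x \<prec> v @ y"
  using assms(1) by (cases rule: lex_cases) (use assms(2) in auto)

lemma lex_le_trans: "u \<preceq> v \<Longrightarrow> v \<preceq> w \<Longrightarrow> u \<preceq> w"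
  using lex_trans by blast

lemma lex_finite_min:
  assumes "finite A" "A \<noteq> {}" "\<And>u. u \<in> A \<Longrightarrow> set u \<subseteq> Z"
  shows "\<exists>v\<in>A. \<forall>u\<in>A. v \<preceq> u"
  using assms
proof (induction A rule: finite_ne_induct)
  case (insert u A)
  then obtain v where v: "v \<in> A" "\<forall>w\<in>A. v \<preceq> w" by auto
  then show ?case using insert.prems lex_total[of u v] by (metis insert_iff lex_trans)
qed simp

lemma Lyndon_iff:
  "w \<in> ALSW gt Z \<longleftrightarrow> w \<noteq> [] \<and> set w \<subseteq> Z \<and> (\<forall>u v. w = u @ v \<and> u \<noteq> [] \<and> v \<noteq> [] \<longrightarrow> w \<prec> v)"
proof
  assume w: "w \<in> ALSW gt Z"
  then have Z: "w \<noteq> []" "set w \<subseteq> Z" by (auto simp: ALSW_def neWords_def)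
  have rot: "u @ v \<prec> v @ u" if "w = u @ v" "u \<noteq> []" "v \<noteq> []" for u v
    using w that by (auto simp: ALSW_def)
  have "w \<prec> v" if uv: "w = u @ v" "u \<noteq> []" "v \<noteq> []" for u v
  proof (rule ccontr)
    assume "\<not> w \<prec> v"
    then have "v \<prec> w" using lex_total[of v w] Z uv by auto
    then show False
    proof (cases rule: lex_cases)
      \<comment> \<open>Here \<open>v\<close> is both a suffix and a prefix:
        \<open>w = u @ v = v @ x\<close> with \<open>x\<close> as long as \<open>u\<close>. Rotating
        at \<open>u\<close> gives \<open>x \<prec> u\<close>, hence
        \<open>x @ v \<prec> u @ v\<close>, and rotating at \<open>v\<close> gives the
        opposite.\<close>
      case (prefix x)
      then have len: "length x = length u" using uv by (metis add_left_cancel length_append add.commute)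
      from rot[OF uv] prefix uv have "x \<prec> u" by auto
      then have "x @ v \<prec> u @ v" using len by (intro lex_extend) auto
      moreover have "u @ v \<prec> x @ v" using rot[of v x] prefix uv by auto
      ultimately show False using lex_trans lex_irrefl by blast
    next
      case (mismatch x a b v' w')
      then have "v @ u \<prec> w" by (simp add: lex_mismatch)
      then show False using rot[OF uv] uv lex_trans lex_irrefl by blast
    qed
  qed
  then show "w \<noteq> [] \<and> set w \<subseteq> Z \<and> (\<forall>u v. w = u @ v \<and> u \<noteq> [] \<and> v \<noteq> [] \<longrightarrow> w \<prec> v)"
    using Z by blast
next
  assume w: "w \<noteq> [] \<and> set w \<subseteq> Z \<and> (\<forall>u v. w = u @ v \<and> u \<noteq> [] \<and> v \<noteq> [] \<longrightarrow> w \<prec> v)"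
  have "u @ v \<prec> v @ u" if "w = u @ v" "u \<noteq> []" "v \<noteq> []" for u v
    using lex_extend[of w v "[]" u] w that by auto
  then show "w \<in> ALSW gt Z" using w by (auto simp: ALSW_def neWords_def)
qed

lemma Lyndon_nonempty: "w \<in> ALSW gt Z \<Longrightarrow> w \<noteq> []"
  and Lyndon_set: "w \<in> ALSW gt Z \<Longrightarrow> set w \<subseteq> Z"
  and Lyndon_suffix: "u @ v \<in> ALSW gt Z \<Longrightarrow> u \<noteq> [] \<Longrightarrow> v \<noteq> [] \<Longrightarrow> u @ v \<prec> v"
  by (auto simp: Lyndon_iff)

lemma Lyndon_suffix_le: "u @ v \<in> ALSW gt Z \<Longrightarrow> v \<noteq> [] \<Longrightarrow> u @ v \<preceq> v"
  using Lyndon_suffix by (cases "u = []") auto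

lemma Lyndon_singleton: "z \<in> Z \<Longrightarrow> [z] \<in> ALSW gt Z"
  by (auto simp: Lyndon_iff Cons_eq_append_conv)

lemma Lyndon_append_less:
  assumes "u \<in> ALSW gt Z" "v \<in> ALSW gt Z" "u \<prec> v"
  shows "u @ v \<prec> v"
  using assms(3)
proof (cases rule: lex_cases)
  case (prefix x)
  then show ?thesis using Lyndon_suffix[of u x] Lyndon_nonempty[OF assms(1)] assms(2) by auto
qed (simp add: lex_mismatch)

lemma Lyndon_append:
  assumes u: "u \<in> ALSW gt Z" and v: "v \<in> ALSW gt Z" and "u \<prec> v"
  shows "u @ v \<in> ALSW gt Z"
proof -
  have less: "u @ v \<prec> v" using assms by (rule Lyndon_append_less)
  have "u @ v \<prec> s" if ps: "u @ v = p @ s" "p \<noteq> []" "s \<noteq> []" for p s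
  proof -
    from ps(1) consider x where "p = u @ x" "v = x @ s" | x where "u = p @ x" "s = x @ v"
      by (elim append_eq_cases)
    then show ?thesis
    proof cases
      case 1
      then have "v \<preceq> s" using Lyndon_suffix_le[of x s] v ps(3) by simp
      then show ?thesis using less lex_trans by blast
    next
      case 2
      show ?thesis
      proof (cases "x = []")
        case False
        then have "u \<prec> x" using 2 u ps Lyndon_suffix by blast
        then show ?thesis using 2 lex_extend[of u x v v] by auto
      qed (use less 2 in auto)
    qed
  qed
  then show ?thesis using u v unfolding Lyndon_iff by auto
qed

text \<open>The standard factorization. Suffixes of the least proper suffix \<open>v\<close> are
  suffixes of \<open>w\<close>, so \<open>v\<close> is Lyndon. A proper suffix \<open>x\<close> of
  \<open>u\<close> below \<open>u\<close> would make a proper suffix of \<open>w\<close> smaller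
  than \<open>v\<close>, or \<open>x @ v\<close> smaller than \<open>w\<close>.\<close>

lemma Lyndon_min_suffix:
  assumes w: "w \<in> ALSW gt Z" and len: "2 \<le> length w"
  obtains u v where "w = u @ v" "u \<in> ALSW gt Z" "v \<in> ALSW gt Z"
    "\<And>p s. w = p @ s \<Longrightarrow> p \<noteq> [] \<Longrightarrow> s \<noteq> [] \<Longrightarrow> v \<preceq> s"
proof -
  define A where "A = {s. \<exists>p. w = p @ s \<and> p \<noteq> [] \<and> s \<noteq> []}"
  have "A \<subseteq> (\<lambda>i. drop i w) ` {..length w}"
  proof
    fix s assume "s \<in> A"
    then obtain p where "w = p @ s" by (auto simp: A_def)
    then have "s = drop (length p) w" "length p \<le> length w" by auto
    then show "s \<in> (\<lambda>i. drop i w) ` {..length w}" by blast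
  qed
  then have "finite A" by (rule finite_subset) simp
  moreover have "tl w \<in> A" using len unfolding A_def
    by (cases w) (auto intro!: exI[of _ "[hd w]"])
  moreover have "set s \<subseteq> Z" if "s \<in> A" for s using that Lyndon_set[OF w] by (auto simp: A_def)
  ultimately obtain v where v: "v \<in> A" "\<forall>s\<in>A. v \<preceq> s" using lex_finite_min[of A] by blast
  then obtain u where uv: "w = u @ v" "u \<noteq> []" "v \<noteq> []" by (auto simp: A_def)
  have min: "v \<preceq> s" if "w = p @ s" "p \<noteq> []" "s \<noteq> []" for p s
    using v that by (auto simp: A_def)
  have "v \<in> ALSW gt Z"
    unfolding Lyndon_iff
  proof (intro conjI allI impI)
    fix p s assume "v = p @ s \<and> p \<noteq> [] \<and> s \<noteq> []"
    then show "v \<prec> s" using min[of "u @ p" s] uv by auto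
  qed (use uv Lyndon_set[OF w] in auto)
  moreover have "u \<in> ALSW gt Z"
    unfolding Lyndon_iff
  proof (intro conjI allI impI)
    fix p x assume px: "u = p @ x \<and> p \<noteq> [] \<and> x \<noteq> []"
    show "u \<prec> x"
    proof (rule ccontr)
      assume "\<not> u \<prec> x"
      then have "x \<prec> u" using px lex_total[of u x] Lyndon_set[OF w] uv by auto
      then show False
      proof (cases rule: lex_cases)
        case (prefix y)
        have "w \<prec> x @ v" using Lyndon_suffix[of p "x @ v"] px uv w by auto
        then have "y @ v \<prec> v" using prefix uv by simp
        moreover have "v \<preceq> y @ v" using min[of x "y @ v"] prefix uv px by auto
        ultimately show False using lex_trans lex_irrefl by metis
      next
        case (mismatch y a b x' u')
        then have "x @ v \<prec> w" using uv by (simp add: lex_mismatch)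
        moreover have "w \<prec> x @ v" using Lyndon_suffix[of p "x @ v"] px uv w by auto
        ultimately show False using lex_trans lex_irrefl by metis
      qed
    qed
  qed (use uv Lyndon_set[OF w] in auto)
  ultimately show thesis using that uv min by blast
qed

lemma leaves_nonempty [simp]: "leaves t \<noteq> []"
  by (induction t) auto

lemma NLSW_leaves: "NLSW gt Z t \<Longrightarrow> leaves t \<in> ALSW gt Z"
  by (cases t) auto

lemma NLSW_cong: "set (leaves t) \<subseteq> Z \<Longrightarrow> set (leaves t) \<subseteq> Z' \<Longrightarrow> NLSW gt Z t \<longleftrightarrow> NLSW gt Z' t"
  by (induction t) (auto simp: ALSW_def neWords_def)

text \<open>The node condition concerns only the right child of the left factor; by induction it
  passes to all proper suffixes of that factor. The right factor of the tree is thus the least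
  proper suffix of its word, which forces uniqueness.\<close>

lemma NLSW_left_suffix:
  assumes "NLSW gt Z (Node s t)" "leaves s = p @ x" "p \<noteq> []" "x \<noteq> []"
  shows "leaves t \<preceq> x"
  using assms
proof (induction s arbitrary: t p x)
  case (Leaf z)
  then show ?case by (auto simp: Cons_eq_append_conv)
next
  case (Node s1 s2)
  have le: "leaves t \<preceq> leaves s2" and N: "NLSW gt Z (Node s1 s2)" using Node.prems(1) by auto
  from Node.prems(2) consider q where "p = leaves s1 @ q" "leaves s2 = q @ x"
    | y where "leaves s1 = p @ y" "x = y @ leaves s2"
    by (auto elim: append_eq_cases)
  then show ?case
  proof cases
    case 1
    then have "leaves s2 \<preceq> x"
      using N NLSW_leaves[of s2] Lyndon_suffix_le[of q x] Node.prems(4) by auto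
    with le show ?thesis by (rule lex_le_trans)
  next
    case 2
    show ?thesis
    proof (cases "y = []")
      case False
      then have "leaves s2 \<preceq> y" using Node.IH(1)[OF N 2(1)] Node.prems by blast
      moreover have "y \<preceq> x" using 2 by simp
      ultimately show ?thesis using le lex_le_trans by metis
    qed (use le 2 in auto)
  qed
qed

text \<open>A second tree cannot cut the same word further to the left: a nonempty \<open>x\<close>
  would give \<open>leaves t' \<prec> leaves t\<close>, \<open>leaves t \<preceq> x\<close> and
  \<open>x \<prec> leaves t'\<close>.\<close>

lemma NLSW_unique_aux:
  assumes "NLSW gt Z (Node s t)" "NLSW gt Z t'" "leaves s = p @ x" "leaves t' = x @ leaves t" "p \<noteq> []"
  shows "x = []"
proof (rule ccontr)
  assume x: "x \<noteq> []"
  then have "leaves t \<preceq> x" using assms NLSW_left_suffix by blast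
  moreover have "leaves t' \<prec> leaves t" using assms(4) x NLSW_leaves[OF assms(2)] Lyndon_suffix by auto
  moreover have "x \<prec> leaves t'" using assms(4) by simp
  ultimately show False using lex_trans lex_irrefl by metis
qed

lemma NLSW_unique:
  "NLSW gt Z t \<Longrightarrow> NLSW gt Z t' \<Longrightarrow> leaves t = leaves t' \<Longrightarrow> t = t'"
proof (induction t arbitrary: t')
  case (Leaf z)
  then show ?case by (cases t') (auto simp: Cons_eq_append_conv)
next
  case (Node s t)
  then obtain s' t1 where t': "t' = Node s' t1"
    by (cases t') (auto simp: append_eq_Cons_conv)
  have eq: "leaves s @ leaves t = leaves s' @ leaves t1" using Node.prems t' by simp
  then consider x where "leaves s = leaves s' @ x" "leaves t1 = x @ leaves t"
    | x where "leaves s' = leaves s @ x" "leaves t = x @ leaves t1"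
    by (elim append_eq_cases)
  then have "leaves s = leaves s' \<and> leaves t = leaves t1"
  proof cases
    case 1
    then show ?thesis using NLSW_unique_aux[of s t t1 "leaves s'" x] Node.prems t' by auto
  next
    case 2
    then show ?thesis using NLSW_unique_aux[of s' t1 t "leaves s" x] Node.prems t' by auto
  qed
  then show ?case using Node.IH[of s'] Node.IH(2)[of t1] Node.prems t' by auto
qed

text \<open>The root splits off the least proper suffix \<open>v\<close>. The node condition then
  holds because a right grandchild \<open>s2\<close> below \<open>v\<close> would make the proper
  suffix \<open>leaves s2 @ v\<close> smaller than \<open>v\<close>.\<close>

lemma NLSW_exists: "w \<in> ALSW gt Z \<Longrightarrow> \<exists>t. NLSW gt Z t \<and> leaves t = w"
proof (induction w rule: length_induct)
  case (1 w)
  show ?case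
  proof (cases "2 \<le> length w")
    case False
    then obtain z where "w = [z]" using Lyndon_nonempty[OF 1(2)]
      by (cases w rule: remdups_adj.cases) auto
    then show ?thesis using 1 by (intro exI[of _ "Leaf z"]) auto
  next
    case True
    with 1(2) obtain u v where uv: "w = u @ v" "u \<in> ALSW gt Z" "v \<in> ALSW gt Z"
      and min: "\<And>p s. w = p @ s \<Longrightarrow> p \<noteq> [] \<Longrightarrow> s \<noteq> [] \<Longrightarrow> v \<preceq> s"
      by (rule Lyndon_min_suffix) blast
    note ne = Lyndon_nonempty[OF uv(2)] Lyndon_nonempty[OF uv(3)]
    then have "length u < length w" "length v < length w" using uv by auto
    with 1 uv obtain s t where s: "NLSW gt Z s" "leaves s = u" and t: "NLSW gt Z t" "leaves t = v"
      by metis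
    have "v \<preceq> leaves s2" if s12: "s = Node s1 s2" for s1 s2
    proof (rule ccontr)
      assume "\<not> v \<preceq> leaves s2"
      moreover have Z: "set (leaves s2) \<subseteq> Z" "set v \<subseteq> Z"
        using s s12 uv Lyndon_set[of u] Lyndon_set[of v] by auto
      ultimately have "leaves s2 \<prec> v" using lex_total by blast
      moreover have "v \<preceq> leaves s2 @ v"
        using min[of "leaves s1" "leaves s2 @ v"] uv s s12 by auto
      ultimately show False
      proof (cases rule: lex_cases)
        case (prefix x)
        then have "v \<prec> x" using uv Lyndon_suffix[of "leaves s2" x] by auto
        moreover have "leaves s2 @ x \<preceq> leaves s2 @ v" using \<open>v \<preceq> leaves s2 @ v\<close> prefix by auto
        then have "x \<preceq> v" by auto
        ultimately show False using lex_trans lex_irrefl by metis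
      next
        case (mismatch x a b s' v')
        then have "leaves s2 @ v \<prec> v" by (simp add: lex_mismatch)
        then show False using \<open>v \<preceq> leaves s2 @ v\<close> lex_trans lex_irrefl by metis
      qed
    qed
    then have "NLSW gt Z (Node s t)" using s t 1(2) uv by auto
    then show ?thesis using s t uv by (intro exI[of _ "Node s t"]) auto
  qed
qed

lemma standard_bracketing_leaves:
  assumes "NLSW gt Z t"
  shows "standard_bracketing gt (leaves t) = t"
proof -
  have Z: "set (leaves t) \<subseteq> Z" using NLSW_leaves[OF assms] Lyndon_set by blast
  show ?thesis unfolding standard_bracketing_def
  proof (rule the_equality)
    show "NLSW gt (set (leaves t)) t \<and> leaves t = leaves t"
      using assms NLSW_cong[OF Z, of "set (leaves t)"] by auto
    fix t' assume "NLSW gt (set (leaves t)) t' \<and> leaves t' = leaves t"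
    then have "NLSW gt Z t' \<and> leaves t' = leaves t" using NLSW_cong[of t' "set (leaves t)"] Z by auto
    then show "t' = t" using NLSW_unique[OF _ assms] by blast
  qed
qed

lemma standard_bracketing:
  assumes "w \<in> ALSW gt Z"
  shows "NLSW gt Z (standard_bracketing gt w)" "leaves (standard_bracketing gt w) = w"
  using NLSW_exists[OF assms] standard_bracketing_leaves by auto

lemma NLSW_Node_less:
  assumes "NLSW gt Z (Node s t)"
  shows "leaves s \<prec> leaves t"
proof -
  have "leaves s @ leaves t \<prec> leaves t"
    using NLSW_leaves[OF assms] Lyndon_suffix[of "leaves s" "leaves t"] by simp
  moreover have "leaves s \<prec> leaves s @ leaves t" by simp
  ultimately show ?thesis using lex_trans by blast
qed

section \<open>Factorization of words into Lyndon words (Chen-Fox-Lyndon)\<close>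

abbreviation lyndon_decreasing :: "'b list list \<Rightarrow> bool" where
  "lyndon_decreasing cs \<equiv> set cs \<subseteq> ALSW gt Z \<and> sorted_wrt (\<lambda>a b. b \<preceq> a) cs"

text \<open>As long as \<open>a\<close> is smaller than the next factor, the product of the two is
  again Lyndon and absorbs that factor; once it is not, the list is in order.\<close>

lemma lyndon_decreasing_insert:
  assumes "a \<in> ALSW gt Z" "lyndon_decreasing cs"
  shows "\<exists>ds. lyndon_decreasing ds \<and> concat ds = a @ concat cs"
  using assms
proof (induction cs arbitrary: a)
  case Nil
  then show ?case by (intro exI[of _ "[a]"]) auto
next
  case (Cons b cs)
  show ?case
  proof (cases "a \<prec> b")
    case True
    then have "a @ b \<in> ALSW gt Z" using Cons.prems Lyndon_append by auto
    moreover have "lyndon_decreasing cs" using Cons.prems(2) by simp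
    ultimately show ?thesis using Cons.IH[of "a @ b"] by simp
  next
    case False
    then have ba: "b \<preceq> a" using lex_total[of a b] Cons.prems Lyndon_set by auto
    moreover have "\<forall>c\<in>set cs. c \<preceq> b" using Cons.prems(2) by simp
    ultimately have "\<forall>c\<in>set (b # cs). c \<preceq> a" using lex_le_trans[of _ b a] by (metis set_ConsD)
    then show ?thesis using Cons.prems by (intro exI[of _ "a # b # cs"]) simp
  qed
qed

lemma lyndon_factorization_exists:
  "set c \<subseteq> Z \<Longrightarrow> \<exists>cs. lyndon_decreasing cs \<and> concat cs = c"
proof (induction c)
  case Nil
  then show ?case by (intro exI[of _ "[]"]) auto
next
  case (Cons z c)
  then show ?case using lyndon_decreasing_insert[OF Lyndon_singleton[of z]] by fastforce
qed

text \<open>A nonempty suffix \<open>x\<close> begins with a nonempty suffix \<open>s\<close> of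
  some factor \<open>a\<close>, and \<open>c \<preceq> a \<preceq> s \<preceq> x\<close>. So the
  last factor is minimal among suffixes, and two factorizations can be compared from the
  right.\<close>

lemma lyndon_concat_suffix:
  assumes "set cs \<subseteq> ALSW gt Z" "\<And>a. a \<in> set cs \<Longrightarrow> c \<preceq> a" "concat cs = y @ x" "x \<noteq> []"
  shows "c \<preceq> x"
  using assms
proof (induction cs arbitrary: y)
  case (Cons a cs)
  have IH: "c \<preceq> x" if "concat cs = z @ x" for z
    using Cons.prems(1,2,4) that by (intro Cons.IH) auto
  from Cons.prems(3) have "a @ concat cs = y @ x" by simp
  then show ?case
  proof (cases rule: append_eq_cases)
    case (left s)
    show ?thesis
    proof (cases "s = []")
      case False
      have "c \<preceq> a" using Cons.prems(2) by simp
      moreover have "a \<preceq> s" using left False Cons.prems(1) Lyndon_suffix_le[of y s] by simp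
      moreover have "s \<preceq> x" using left by auto
      ultimately show ?thesis by (metis lex_le_trans)
    qed (use IH[of "[]"] left in simp)
  qed (rule IH)
qed simp

lemma lyndon_factorization_unique_aux:
  assumes "lyndon_decreasing (cs @ [c])" "d \<in> ALSW gt Z" "concat cs = y @ x" "d = x @ c"
  shows "x = []"
proof (rule ccontr)
  assume "x \<noteq> []"
  then have "c \<preceq> x" using assms by (intro lyndon_concat_suffix[of cs c y x]) (auto simp: sorted_wrt_append)
  moreover have "d \<prec> c" using assms \<open>x \<noteq> []\<close> Lyndon_nonempty[of c] Lyndon_suffix[of x c] by auto
  moreover have "x \<prec> d" using assms Lyndon_nonempty[of c] by auto
  ultimately show False using lex_trans lex_irrefl by metis
qed

lemma lyndon_factorization_unique:
  "lyndon_decreasing cs \<Longrightarrow> lyndon_decreasing ds \<Longrightarrow> concat cs = concat ds \<Longrightarrow> cs = ds"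
proof (induction cs arbitrary: ds rule: rev_induct)
  case Nil
  then show ?case using Lyndon_nonempty by (cases ds) auto
next
  case (snoc c cs)
  have "ds \<noteq> []" using snoc.prems Lyndon_nonempty[of c] by auto
  then obtain d es where ds: "ds = es @ [d]" by (cases ds rule: rev_cases) auto
  from snoc.prems(3) ds consider x where "concat cs = concat es @ x" "d = x @ c"
    | x where "concat es = concat cs @ x" "c = x @ d"
    by (auto elim: append_eq_cases)
  then have "c = d \<and> concat cs = concat es"
  proof cases
    case 1
    then show ?thesis using lyndon_factorization_unique_aux[of cs c d _ x] snoc.prems ds by auto
  next
    case 2
    then show ?thesis using lyndon_factorization_unique_aux[of es d c _ x] snoc.prems ds by auto
  qed
  then show ?case using snoc.IH[of es] snoc.prems ds by (auto simp: sorted_wrt_append)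
qed

lemma lyndon_decreasing_iff:
  "lyndon_decreasing cs \<longleftrightarrow> set cs \<subseteq> ALSW gt Z \<and>
     (\<forall>t. Suc t < length cs \<longrightarrow> cs ! t = cs ! Suc t \<or> lex_gt gt (cs ! Suc t) (cs ! t))"
proof -
  have "transp (\<lambda>a b. b \<preceq> a)" unfolding transp_def using lex_le_trans by blast
  then show ?thesis by (simp add: sorted_wrt_iff_nth_Suc_transp) (blast dest: sym)
qed

text \<open>The whole word is smaller than its last factor, hence than every factor, and its
  prefixes are smaller still. Thus each partial product \<open>v @ concat ds\<close> lies below the
  next factor \<open>d\<close> and stays Lyndon when \<open>d\<close> is appended; this keeps
  leading words under control in left-normed commutators.\<close>

lemma Lyndon_append_factors:
  assumes v: "v \<in> ALSW gt Z" and cs: "lyndon_decreasing (ds @ es)" and vc: "v @ concat (ds @ es) \<in> ALSW gt Z"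
  shows "v @ concat ds \<in> ALSW gt Z"
proof -
  have below: "v @ concat (ds @ es) \<prec> c" if "c \<in> set (ds @ es)" for c
  proof -
    from that obtain bs b where b: "ds @ es = bs @ [b]" by (cases "ds @ es" rule: rev_cases) auto
    then have "b \<noteq> []" using cs Lyndon_nonempty[of b] by auto
    then have "v @ concat (ds @ es) \<prec> b"
      using vc Lyndon_suffix[of "v @ concat bs" b] Lyndon_nonempty[OF v] b by auto
    moreover have "b \<preceq> c"
    proof (cases "c = b")
      case False
      with that have "c \<in> set bs" unfolding b by simp
      moreover have "sorted_wrt (\<lambda>a b. b \<preceq> a) (bs @ [b])" using cs by (simp only: b)
      then have "\<forall>x\<in>set bs. b \<preceq> x" by (simp add: sorted_wrt_append)
      ultimately show ?thesis by blast
    qed simp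
    ultimately show ?thesis using lex_trans by blast
  qed
  from cs vc below show ?thesis
  proof (induction ds arbitrary: es rule: rev_induct)
    case (snoc d ds)
    have "v @ concat ds \<in> ALSW gt Z" using snoc.prems by (intro snoc.IH[of "d # es"]) auto
    moreover have "v @ concat ds \<prec> d"
    proof -
      have "d \<noteq> []" using snoc.prems(1) Lyndon_nonempty[of d] by auto
      then have "v @ concat ds \<prec> (v @ concat ds) @ d @ concat es" by simp
      moreover have "(v @ concat ds) @ d @ concat es \<prec> d" using snoc.prems(3)[of d] by simp
      ultimately show ?thesis by (rule lex_trans)
    qed
    ultimately show ?case using snoc.prems(1) Lyndon_append[of "v @ concat ds" d] by auto
  qed (use v in simp)
qed

end

section \<open>Lyndon-Shirshov brackets span a Lie algebra with an operator\<close>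

text \<open>An inductive span without side conditions on the carrier, so that closure under the
  bracket and the operator reduces to generators by rule induction.\<close>

inductive_set lspan :: "('k::field, 'a, 'm) lie_op_scheme \<Rightarrow> 'a set \<Rightarrow> 'a set" for L B where
  lspan_base: "x \<in> B \<Longrightarrow> x \<in> lspan L B"
| lspan_zero: "\<zero>\<^bsub>L\<^esub> \<in> lspan L B"
| lspan_add: "x \<in> lspan L B \<Longrightarrow> y \<in> lspan L B \<Longrightarrow> x \<oplus>\<^bsub>L\<^esub> y \<in> lspan L B"
| lspan_smult: "x \<in> lspan L B \<Longrightarrow> c \<odot>\<^bsub>L\<^esub> x \<in> lspan L B"

lemma lspan_subset: "B \<subseteq> lspan L C \<Longrightarrow> lspan L B \<subseteq> lspan L C"
proof
  fix x assume "x \<in> lspan L B" "B \<subseteq> lspan L C"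
  then show "x \<in> lspan L C" by induction (auto intro: lspan.intros)
qed

lemma lspan_mono: "B \<subseteq> C \<Longrightarrow> lspan L B \<subseteq> lspan L C"
  by (rule lspan_subset) (auto intro: lspan_base)

context lie_op_algebra
begin

lemma vsmult_closed: "x \<in> carrier L \<Longrightarrow> c \<odot>\<^bsub>L\<^esub> x \<in> carrier L"
  by (rule smult_closed) auto

lemma lspan_closed:
  assumes "B \<subseteq> carrier L" "x \<in> lspan L B" shows "x \<in> carrier L"
  using assms(2,1) by induction (auto intro: vsmult_closed)

lemma zero_smult: "x \<in> carrier L \<Longrightarrow> 0 \<odot>\<^bsub>L\<^esub> x = \<zero>"
  using smult_l_null[of x] by simp

lemma lbr_zero_left: "y \<in> carrier L \<Longrightarrow> lbr L \<zero> y = \<zero>"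
  using lbr_smult_left[of \<zero> y 0] zero_smult lbr_closed by simp

lemma lbr_zero_right: "y \<in> carrier L \<Longrightarrow> lbr L y \<zero> = \<zero>"
  using lbr_smult_right[of y \<zero> 0] zero_smult lbr_closed by simp

lemma oper_zero: "oper L \<zero> = \<zero>"
  using oper_smult[of \<zero> 0] zero_smult oper_closed by simp

lemma minus_one_smult: "x \<in> carrier L \<Longrightarrow> (-1) \<odot>\<^bsub>L\<^esub> x = \<ominus> x"
proof -
  assume x: "x \<in> carrier L"
  have "x \<oplus> (-1) \<odot>\<^bsub>L\<^esub> x = \<zero>"
    using smult_l_distr[of 1 "-1" x] x zero_smult smult_one[of x] by simp
  then show ?thesis using x by (metis M.add.inv_comm M.minus_equality vsmult_closed)
qed

lemma lbr_antisym:
  assumes x: "x \<in> carrier L" and y: "y \<in> carrier L"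
  shows "lbr L x y = (-1) \<odot>\<^bsub>L\<^esub> lbr L y x"
proof -
  have "lbr L x (x \<oplus> y) = lbr L x y" "lbr L y (x \<oplus> y) = lbr L y x"
    using x y lbr_closed lbr_alternating by (simp_all add: lbr_add_right)
  then have "lbr L x y \<oplus> lbr L y x = \<zero>"
    using lbr_alternating[of "x \<oplus> y"] lbr_add_left[of x y "x \<oplus> y"] x y by simp
  then show ?thesis using x y lbr_closed minus_one_smult M.minus_equality by simp
qed

lemma jacobi_left:
  assumes "a \<in> carrier L" "b \<in> carrier L" "c \<in> carrier L"
  shows "lbr L (lbr L a b) c = lbr L (lbr L a c) b \<oplus> lbr L a (lbr L b c)"
proof -
  let ?A = "lbr L a (lbr L b c)" and ?B = "lbr L b (lbr L c a)" and ?C = "lbr L c (lbr L a b)"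
  note cl = lbr_closed assms
  have "?C = \<ominus> (?A \<oplus> ?B)"
    using jacobi[of a b c] cl M.minus_equality[of ?C "?A \<oplus> ?B"] by (simp add: M.a_comm)
  moreover have "lbr L (lbr L a b) c = \<ominus> ?C"
    using lbr_antisym[of "lbr L a b" c] cl minus_one_smult by simp
  ultimately have "lbr L (lbr L a b) c = ?B \<oplus> ?A" using cl by (simp add: M.a_comm)
  moreover have "?B = lbr L (lbr L a c) b"
    using lbr_antisym[of b "lbr L c a"] lbr_antisym[of c a] lbr_smult_left[of "lbr L a c" b "-1"] cl
      minus_one_smult by simp
  ultimately show ?thesis by simp
qed

lemma lspan_lbr_left:
  assumes "x \<in> lspan L B" "B \<subseteq> carrier L" "y \<in> carrier L" "\<And>b. b \<in> B \<Longrightarrow> lbr L b y \<in> lspan L D"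
  shows "lbr L x y \<in> lspan L D"
  using assms(1)
proof induction
  case (lspan_add x x')
  then show ?case using lspan_closed[OF assms(2)] assms(3) by (simp add: lbr_add_left lspan.lspan_add)
next
  case (lspan_smult x c)
  then show ?case using lspan_closed[OF assms(2)] assms(3) by (simp add: lbr_smult_left lspan.lspan_smult)
qed (use assms in \<open>auto simp: lbr_zero_left intro: lspan.lspan_zero\<close>)

lemma lspan_lbr_right:
  assumes "x \<in> lspan L B" "B \<subseteq> carrier L" "y \<in> carrier L" "\<And>b. b \<in> B \<Longrightarrow> lbr L y b \<in> lspan L D"
  shows "lbr L y x \<in> lspan L D"
  using assms(1)
proof induction
  case (lspan_add x x')
  then show ?case using lspan_closed[OF assms(2)] assms(3) by (simp add: lbr_add_right lspan.lspan_add)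
next
  case (lspan_smult x c)
  then show ?case using lspan_closed[OF assms(2)] assms(3) by (simp add: lbr_smult_right lspan.lspan_smult)
qed (use assms in \<open>auto simp: lbr_zero_right intro: lspan.lspan_zero\<close>)

lemma lspan_lbr:
  assumes "x \<in> lspan L B" "y \<in> lspan L C" "B \<subseteq> carrier L" "C \<subseteq> carrier L"
    "\<And>b c. b \<in> B \<Longrightarrow> c \<in> C \<Longrightarrow> lbr L b c \<in> lspan L D"
  shows "lbr L x y \<in> lspan L D"
  using assms(1,3) lspan_closed[OF assms(4,2)]
  by (rule lspan_lbr_left) (use assms in \<open>auto intro: lspan_lbr_right\<close>)

lemma lspan_oper:
  assumes "x \<in> lspan L B" "B \<subseteq> carrier L" "\<And>b. b \<in> B \<Longrightarrow> oper L b \<in> lspan L D"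
  shows "oper L x \<in> lspan L D"
  using assms(1)
proof induction
  case (lspan_add x x')
  then show ?case using lspan_closed[OF assms(2)] by (simp add: oper_add lspan.lspan_add)
next
  case (lspan_smult x c)
  then show ?case using lspan_closed[OF assms(2)] by (simp add: oper_smult lspan.lspan_smult)
qed (use assms in \<open>auto simp: oper_zero intro: lspan.lspan_zero\<close>)

end

text \<open>The evaluation \<open>e\<close> of trees is left abstract, so that the letters may be
  operator words with values of their own and the classical argument for free Lie algebras applies
  unchanged.\<close>

locale lie_brackets = lie_op_algebra L + ordered_alphabet gt Z
  for L :: "('k::field, 'a, 'm) lie_op_scheme" (structure) and gt :: "'b \<Rightarrow> 'b \<Rightarrow> bool" and Z +
  fixes e :: "'b bracketing \<Rightarrow> 'a"
  assumes e_Leaf: "z \<in> Z \<Longrightarrow> e (Leaf z) \<in> carrier L"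
    and e_Node: "e (Node s t) = lbr L (e s) (e t)"
begin

lemma e_closed: "set (leaves t) \<subseteq> Z \<Longrightarrow> e t \<in> carrier L"
  by (induction t) (auto simp: e_Leaf e_Node lbr_closed)

text \<open>The multiset is carried along because pairs formed from the results of Jacobi rewriting
  must have the same letters and total length as the original pair; only then are the measures of
  the two pairs comparable.\<close>

definition brackets :: "'b multiset \<Rightarrow> 'b list \<Rightarrow> 'a set" where
  "brackets M m = {e r | r. NLSW gt Z r \<and> mset (leaves r) = M \<and> leaves r \<prec> m}"

lemma brackets_closed: "brackets M m \<subseteq> carrier L"
  unfolding brackets_def using e_closed Lyndon_set NLSW_leaves by blast

text \<open>The induction is on the number of letters and then on the larger factor: rewriting
  \<open>[[a, b], c] = [[a, c], b] + [a, [b, c]]\<close> for \<open>b \<prec> c\<close> yields only brackets of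
  factors below \<open>c\<close>.\<close>

lemma lbr_NLSW:
  assumes "NLSW gt Z s" "NLSW gt Z t" "leaves s \<prec> leaves t"
  shows "lbr L (e s) (e t) \<in> lspan L (brackets (mset (leaves s) + mset (leaves t)) (leaves t))"
proof -
  \<comment> \<open>The lexicographic order has infinite descending chains even on two letters, such
    as \<open>b\<close>, \<open>ab\<close>, \<open>aab\<close>, and so on. With letters and length
    bounded, only finitely many words lie below \<open>leaves t\<close>, and their number serves as
    the measure.\<close>
  define below where "below = (\<lambda>(s, t). {w. set w \<subseteq> set (leaves s) \<union> set (leaves t) \<and>
    length w \<le> length (leaves s) + length (leaves t) \<and> w \<prec> leaves t})"
  have fin: "finite (below p)" for p
  proof (cases p)
    case (Pair s t)
    have "finite {w. set w \<subseteq> set (leaves s) \<union> set (leaves t) \<and>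
       length w \<le> length (leaves s) + length (leaves t)}"
      by (rule finite_lists_length_le) simp
    then show ?thesis unfolding below_def Pair by (rule rev_finite_subset) auto
  qed
  define R where "R = measures [\<lambda>(s, t). length (leaves s) + length (leaves t), \<lambda>p. card (below p)]"
  have wfR: "wf R" by (simp add: R_def)
  define P where "P = (\<lambda>(s, t). NLSW gt Z s \<longrightarrow> NLSW gt Z t \<longrightarrow> leaves s \<prec> leaves t \<longrightarrow>
    lbr L (e s) (e t) \<in> lspan L (brackets (mset (leaves s) + mset (leaves t)) (leaves t)))"
  have "P (s, t)" for s t
    using wfR
  proof (induction "(s, t)" arbitrary: s t rule: wf_induct_rule)
    case less
    have ?case if s: "NLSW gt Z s" and t: "NLSW gt Z t" and st: "leaves s \<prec> leaves t"
    proof -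
      let ?M = "mset (leaves s) + mset (leaves t)" and ?m = "leaves t"
      have Ly: "leaves s \<in> ALSW gt Z" "leaves t \<in> ALSW gt Z" using s t NLSW_leaves by auto
      have smaller: "lbr L (e a) (e b) \<in> lspan L (brackets ?M ?m)"
        if a: "NLSW gt Z a" and b: "NLSW gt Z b" and M: "mset (leaves a) + mset (leaves b) = ?M"
          and b_m: "leaves b \<prec> ?m" and ab: "leaves a \<prec> leaves b" for a b
      proof -
        have len: "length (leaves a) + length (leaves b) = length (leaves s) + length (leaves t)"
          using arg_cong[OF M, of size] by simp
        have st_set: "set (leaves a) \<union> set (leaves b) = set (leaves s) \<union> set (leaves t)"
          using arg_cong[OF M, of set_mset] by simp
        have "below (a, b) \<subseteq> below (s, t)"
          using b_m len st_set lex_trans unfolding below_def by auto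
        moreover have "leaves b \<in> below (s, t)" "leaves b \<notin> below (a, b)"
          using b_m st_set len unfolding below_def by auto
        ultimately have "card (below (a, b)) < card (below (s, t))"
          by (intro psubset_card_mono fin) blast
        then have "((a, b), (s, t)) \<in> R" using len by (simp add: R_def)
        then have "P (a, b)" by (rule less)
        then have "lbr L (e a) (e b) \<in> lspan L (brackets ?M (leaves b))"
          using a b ab M by (simp add: P_def)
        moreover have "brackets ?M (leaves b) \<subseteq> brackets ?M ?m"
          using b_m lex_trans unfolding brackets_def by blast
        ultimately show ?thesis using lspan_mono by blast
      qed
      have pair: "lbr L (e a) (e b) \<in> lspan L (brackets ?M ?m)"
        if a: "NLSW gt Z a" and b: "NLSW gt Z b" and M: "mset (leaves a) + mset (leaves b) = ?M"
          and m: "leaves a \<prec> ?m" "leaves b \<prec> ?m" for a b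
      proof -
        have Z: "set (leaves a) \<subseteq> Z" "set (leaves b) \<subseteq> Z"
          using Lyndon_set NLSW_leaves a b by blast+
        then consider "leaves a = leaves b" | "leaves a \<prec> leaves b" | "leaves b \<prec> leaves a"
          using lex_total by blast
        then show ?thesis
        proof cases
          case 1
          then have "a = b" using NLSW_unique a b by blast
          then show ?thesis using lbr_alternating e_closed[OF Z(1)] by (simp add: lspan_zero)
        next
          case 2
          then show ?thesis using smaller a b M m by blast
        next
          case 3
          then have "lbr L (e b) (e a) \<in> lspan L (brackets ?M ?m)"
            using smaller[of b a] a b M m by (simp add: add.commute)
          then show ?thesis using lbr_antisym[of "e a" "e b"] e_closed Z by (simp add: lspan_smult)
        qed
      qed
      show "P (s, t)"
      proof (cases "\<exists>s1 s2. s = Node s1 s2 \<and> leaves s2 \<prec> ?m")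
        case False
        have "?m \<preceq> leaves s2" if "s = Node s1 s2" for s1 s2
        proof -
          have "set (leaves s2) \<subseteq> Z" "set ?m \<subseteq> Z"
            using Lyndon_set[OF Ly(1)] Lyndon_set[OF Ly(2)] that by auto
          then show ?thesis using lex_total False that by blast
        qed
        then have "NLSW gt Z (Node s t)"
          using s t st Ly Lyndon_append[of "leaves s" "leaves t"] by auto
        moreover have "leaves (Node s t) \<prec> ?m" using Lyndon_append_less Ly st by simp
        ultimately have "e (Node s t) \<in> brackets ?M ?m" unfolding brackets_def
          by (auto intro!: exI[of _ "Node s t"])
        then show ?thesis by (simp add: P_def e_Node lspan_base)
      next
        case True
        then obtain s1 s2 where s12: "s = Node s1 s2" "leaves s2 \<prec> ?m" by blast
        then have N: "NLSW gt Z s1" "NLSW gt Z s2" using s by auto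
        then have cl: "e s1 \<in> carrier L" "e s2 \<in> carrier L" "e t \<in> carrier L"
          using e_closed Lyndon_set NLSW_leaves t by blast+
        have s_eq: "e s = lbr L (e s1) (e s2)" using s12(1) e_Node by simp
        have s1m: "leaves s1 \<prec> ?m" using NLSW_Node_less s s12 lex_trans by blast
        have "((s1, t), (s, t)) \<in> R" "((s2, t), (s, t)) \<in> R" using s12 by (auto simp: R_def)
        then have "P (s1, t)" "P (s2, t)" by (blast intro: less)+
        then have IH: "lbr L (e s1) (e t) \<in> lspan L (brackets (mset (leaves s1) + mset ?m) ?m)"
          "lbr L (e s2) (e t) \<in> lspan L (brackets (mset (leaves s2) + mset ?m) ?m)"
          using N t s1m s12 by (auto simp: P_def)
        have "lbr L (lbr L (e s1) (e t)) (e s2) \<in> lspan L (brackets ?M ?m)"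
          using IH(1) brackets_closed cl(2)
        proof (rule lspan_lbr_left)
          fix b assume "b \<in> brackets (mset (leaves s1) + mset ?m) ?m"
          then obtain r where "b = e r" "NLSW gt Z r" "mset (leaves r) = mset (leaves s1) + mset ?m"
            "leaves r \<prec> ?m" by (auto simp: brackets_def)
          then show "lbr L b (e s2) \<in> lspan L (brackets ?M ?m)"
            using pair[of r s2] N s12 by (simp add: ac_simps)
        qed
        moreover have "lbr L (e s1) (lbr L (e s2) (e t)) \<in> lspan L (brackets ?M ?m)"
          using IH(2) brackets_closed cl(1)
        proof (rule lspan_lbr_right)
          fix b assume "b \<in> brackets (mset (leaves s2) + mset ?m) ?m"
          then obtain r where "b = e r" "NLSW gt Z r" "mset (leaves r) = mset (leaves s2) + mset ?m"
            "leaves r \<prec> ?m" by (auto simp: brackets_def)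
          then show "lbr L (e s1) b \<in> lspan L (brackets ?M ?m)"
            using pair[of s1 r] N s12 s1m by (simp add: ac_simps)
        qed
        ultimately have "lbr L (e s) (e t) \<in> lspan L (brackets ?M ?m)"
          unfolding s_eq jacobi_left[OF cl] by (rule lspan_add)
        then show ?thesis by (simp add: P_def)
      qed
    qed
    then show ?case by (auto simp: P_def)
  qed
  then show ?thesis using assms by (auto simp: P_def)
qed

lemma lbr_NLSW_span:
  assumes "NLSW gt Z s" "NLSW gt Z t"
  shows "lbr L (e s) (e t) \<in> lspan L {e r | r. NLSW gt Z r}"
proof -
  have sub: "brackets M m \<subseteq> {e r | r. NLSW gt Z r}" for M m by (auto simp: brackets_def)
  have Z: "set (leaves s) \<subseteq> Z" "set (leaves t) \<subseteq> Z"
    using Lyndon_set NLSW_leaves assms by blast+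
  then consider "leaves s = leaves t" | "leaves s \<prec> leaves t" | "leaves t \<prec> leaves s"
    using lex_total by blast
  then show ?thesis
  proof cases
    case 1
    then have "s = t" using NLSW_unique assms by blast
    then show ?thesis using lbr_alternating e_closed[OF Z(1)] by (simp add: lspan_zero)
  next
    case 2
    then show ?thesis using lbr_NLSW assms lspan_mono[OF sub] by blast
  next
    case 3
    then have "lbr L (e t) (e s) \<in> lspan L {e r | r. NLSW gt Z r}"
      using lbr_NLSW assms lspan_mono[OF sub] by blast
    then show ?thesis using lbr_antisym[of "e s" "e t"] e_closed Z by (simp add: lspan_smult)
  qed
qed

end

subsection \<open>Lyndon-Shirshov words with an operator\<close>

definition lyndon_letters :: "'a::linorder set \<Rightarrow> 'a letter set" where
  "lyndon_letters X = Var ` X \<union> Op ` ALSW_op X"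

lemma ordered_alphabet_letters:
  "Z \<subseteq> letters X \<Longrightarrow> ordered_alphabet prime_gt (Z :: 'a::wellorder letter set)"
  by unfold_locales (auto simp: prime_gt_iff dest: prime_less_trans prime_less_total[of _ X])

lemma ALSW_mono: "Z \<subseteq> Z' \<Longrightarrow> ALSW gt Z \<subseteq> ALSW gt Z'"
  by (auto simp: ALSW_def neWords_def)

lemma ALSW_op_upto_mono: "ALSW_op_upto X n \<subseteq> ALSW_op_upto X (Suc n)"
proof (induction n)
  case 0
  show ?case using ALSW_mono[of "Var ` X"] by simp
next
  case (Suc n)
  then show ?case unfolding ALSW_op_upto.simps(2)[of X "Suc n"] ALSW_op_upto.simps(2)[of X n]
    by (intro ALSW_mono) blast
qed

lemma ALSW_op_eq: "ALSW_op X = ALSW prime_gt (lyndon_letters X)"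
proof
  show "ALSW_op X \<subseteq> ALSW prime_gt (lyndon_letters X)"
  proof
    fix w assume "w \<in> ALSW_op X"
    then obtain n where n: "w \<in> ALSW_op_upto X n" by (auto simp: ALSW_op_def)
    have sub: "ALSW_op_upto X n \<subseteq> ALSW_op X" for n unfolding ALSW_op_def by blast
    have "ALSW_op_upto X n \<subseteq> ALSW prime_gt (lyndon_letters X)"
    proof (cases n)
      case 0
      have "Var ` X \<subseteq> lyndon_letters X" unfolding lyndon_letters_def by blast
      from ALSW_mono[OF this] show ?thesis unfolding 0 by simp
    next
      case (Suc m)
      have "Var ` X \<union> Op ` ALSW_op_upto X m \<subseteq> lyndon_letters X"
        using sub[of m] unfolding lyndon_letters_def by blast
      from ALSW_mono[OF this] show ?thesis unfolding Suc by simp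
    qed
    with n show "w \<in> ALSW prime_gt (lyndon_letters X)" by blast
  qed
  show "ALSW prime_gt (lyndon_letters X) \<subseteq> ALSW_op X"
  proof
    fix w assume w: "w \<in> ALSW prime_gt (lyndon_letters X)"
    let ?f = "\<lambda>n. Var ` X \<union> Op ` ALSW_op_upto X n"
    have "set w \<subseteq> lyndon_letters X" using w by (simp add: ALSW_def neWords_def)
    also have "\<dots> \<subseteq> (\<Union>n. ?f n)" unfolding lyndon_letters_def ALSW_op_def by blast
    finally have "set w \<subseteq> (\<Union>n. ?f n)" .
    moreover have "?f n \<subseteq> ?f (Suc n)" for n using ALSW_op_upto_mono[of X n] by blast
    ultimately obtain n where "set w \<subseteq> ?f n" using finite_subset_chain_UN[of "set w" ?f] by auto
    then have "w \<in> ALSW_op_upto X (Suc n)" using w by (auto simp: ALSW_def neWords_def)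
    then show "w \<in> ALSW_op X" unfolding ALSW_op_def by blast
  qed
qed

lemma ALSW_op_subset_words: "ALSW_op X \<subseteq> words X"
proof -
  have *: "ALSW prime_gt Y \<subseteq> words X" if "Y \<subseteq> letters X" for Y
    using that by (auto simp: ALSW_def neWords_def words_iff)
  have "ALSW_op_upto X n \<subseteq> words X" for n
  proof (induction n)
    case 0
    have "Var ` X \<subseteq> letters X" by auto
    from *[OF this] show ?case by simp
  next
    case (Suc n)
    then have "Var ` X \<union> Op ` ALSW_op_upto X n \<subseteq> letters X" by auto
    from *[OF this] show ?case by simp
  qed
  then show ?thesis by (auto simp: ALSW_op_def)
qed

lemma lyndon_letters_subset: "lyndon_letters X \<subseteq> letters X"
  using ALSW_op_subset_words[of X] by (auto simp: lyndon_letters_def letters_def)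

lemma lyndon_letters_simps [simp]:
  "Var x \<in> lyndon_letters X \<longleftrightarrow> x \<in> X" "Op w \<in> lyndon_letters X \<longleftrightarrow> w \<in> ALSW_op X"
  by (auto simp: lyndon_letters_def)

interpretation lyndon: ordered_alphabet prime_gt "lyndon_letters X" for X :: "'a::wellorder set"
  by (rule ordered_alphabet_letters[OF lyndon_letters_subset])

lemma ALSW_op_set: "w \<in> ALSW_op X \<Longrightarrow> set w \<subseteq> lyndon_letters (X :: 'a::wellorder set)"
  by (simp add: ALSW_op_eq lyndon.Lyndon_set)

lemma leaves_map_bracketing: "leaves (map_bracketing f t) = map f (leaves t)"
  by (induction t) auto

section \<open>Standard bracketing of words in bracketed letters\<close>

abbreviation nword_gt :: "'a::linorder nword \<Rightarrow> 'a nword \<Rightarrow> bool" where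
  "nword_gt s t \<equiv> dl_less (foliage t) (foliage s)"

text \<open>The assumption on foliages is confined to an alphabet \<open>Z\<close> because it is
  proved by induction on letters: for \<open>Op u\<close> it is known only on
  \<open>Z = set u\<close>, which is enough to carry the bracketing of \<open>u\<close> over to the
  bracketed letters.\<close>

context
  fixes X :: "'a::wellorder set" and Z :: "'a letter set"
  assumes Z: "Z \<subseteq> letters X" and fol: "\<And>p. p \<in> Z \<Longrightarrow> foliage (bracket_letter p) = [p]"
begin

lemma ordered_alphabet_bracket_letters: "ordered_alphabet nword_gt (bracket_letter ` Z)"
proof
  fix x y assume "x \<in> bracket_letter ` Z" "y \<in> bracket_letter ` Z"
  then obtain p q where pq: "p \<in> Z" "q \<in> Z" "x = bracket_letter p" "y = bracket_letter q" by blast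
  then have "p = q \<or> prime_less p q \<or> prime_less q p" using Z prime_less_total[of p X q] by blast
  then show "x = y \<or> nword_gt x y \<or> nword_gt y x"
    using fol pq by (auto simp: dl_less_single)
qed (auto intro: dl_less_trans)

lemma nword_gt_bracket_letter:
  "p \<in> Z \<Longrightarrow> q \<in> Z \<Longrightarrow> nword_gt (bracket_letter p) (bracket_letter q) \<longleftrightarrow> prime_gt p q"
  by (simp add: fol prime_gt_def)

lemma lex_gt_map_bracket_letter:
  "set u \<subseteq> Z \<Longrightarrow> set v \<subseteq> Z \<Longrightarrow>
    lex_gt nword_gt (map bracket_letter u) (map bracket_letter v) \<longleftrightarrow> lex_gt prime_gt u v"
proof (induction u arbitrary: v)
  case Nil
  then show ?case by (cases v) auto
next
  case (Cons p u)
  show ?case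
  proof (cases v)
    case v: (Cons q v')
    have pq: "p \<in> Z" "q \<in> Z" using Cons.prems v by auto
    then have "bracket_letter p = bracket_letter q \<longleftrightarrow> p = q" using fol by (metis list.inject)
    moreover have "lex_gt nword_gt (map bracket_letter u) (map bracket_letter v') \<longleftrightarrow> lex_gt prime_gt u v'"
      using Cons.prems v by (intro Cons.IH) auto
    ultimately show ?thesis unfolding v list.map lex_gt.simps nword_gt_bracket_letter[OF pq] by simp
  qed auto
qed

lemma ALSW_map_bracket_letter:
  assumes w: "w \<in> ALSW prime_gt Z"
  shows "map bracket_letter w \<in> ALSW nword_gt (bracket_letter ` Z)"
proof -
  have "lex_gt nword_gt (u @ v) (v @ u)"
    if uv: "map bracket_letter w = u @ v" "u \<noteq> []" "v \<noteq> []" for u v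
  proof -
    from uv(1) obtain u' v' where w': "w = u' @ v'" "u = map bracket_letter u'" "v = map bracket_letter v'"
      by (auto simp: map_eq_append_conv)
    have "set w \<subseteq> Z" using w by (auto simp: ALSW_def neWords_def)
    moreover have "lex_gt prime_gt (u' @ v') (v' @ u')" using w w' uv by (auto simp: ALSW_def)
    ultimately show ?thesis using lex_gt_map_bracket_letter[of "u' @ v'" "v' @ u'"] w' by simp
  qed
  then show ?thesis using w by (auto simp: ALSW_def neWords_def)
qed

lemma NLSW_map_bracketing:
  "NLSW prime_gt Z t \<Longrightarrow> NLSW nword_gt (bracket_letter ` Z) (map_bracketing bracket_letter t)"
proof (induction t)
  case (Leaf z)
  then show ?case using ALSW_map_bracket_letter[of "[z]"] by auto
next
  case (Node s t)
  have "leaves (map_bracketing bracket_letter s2) = leaves (map_bracketing bracket_letter t) \<or>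
      lex_gt nword_gt (leaves (map_bracketing bracket_letter t)) (leaves (map_bracketing bracket_letter s2))"
    if "s = Node s1 s2" for s1 s2
  proof -
    have "leaves s2 = leaves t \<or> lex_gt prime_gt (leaves t) (leaves s2)"
      using Node.prems that by auto
    moreover have "set (leaves s @ leaves t) \<subseteq> Z" using Node.prems by (auto simp: ALSW_def neWords_def)
    ultimately show ?thesis
      using lex_gt_map_bracket_letter[of "leaves t" "leaves s2"] that by (auto simp: leaves_map_bracketing)
  qed
  then have "\<forall>s1 s2. map_bracketing bracket_letter s = Node s1 s2 \<longrightarrow>
      leaves s2 = leaves (map_bracketing bracket_letter t) \<or>
      lex_gt nword_gt (leaves (map_bracketing bracket_letter t)) (leaves s2)"
    by (cases s) auto
  moreover have "leaves (map_bracketing bracket_letter (Node s t)) \<in> ALSW nword_gt (bracket_letter ` Z)"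
    using Node.prems ALSW_map_bracket_letter[of "leaves s @ leaves t"] by (simp add: leaves_map_bracketing)
  ultimately show ?case using Node by simp
qed

lemma bracket_eq:
  assumes w: "w \<in> ALSW prime_gt Z"
  shows "bracket w = flatten (map_bracketing bracket_letter (standard_bracketing prime_gt w))"
proof -
  interpret Z: ordered_alphabet prime_gt Z by (rule ordered_alphabet_letters[OF Z])
  interpret N: ordered_alphabet nword_gt "bracket_letter ` Z" by (rule ordered_alphabet_bracket_letters)
  note sb = Z.standard_bracketing[OF w]
  have "standard_bracketing nword_gt (map bracket_letter w)
      = map_bracketing bracket_letter (standard_bracketing prime_gt w)"
    using N.standard_bracketing_leaves[OF NLSW_map_bracketing[OF sb(1)]] sb(2)
    by (simp add: leaves_map_bracketing)
  then show ?thesis by (simp add: bracket_def bracket_letters_def)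
qed

lemma foliage_flatten:
  "set (leaves t) \<subseteq> Z \<Longrightarrow> foliage (flatten (map_bracketing bracket_letter t)) = leaves t"
  by (induction t) (auto simp: fol)

end

abbreviation lookup :: "('b \<Rightarrow>\<^sub>0 'k::zero) \<Rightarrow> 'b \<Rightarrow> 'k" where
  "lookup \<equiv> Poly_Mapping.lookup"

abbreviation keys :: "('b \<Rightarrow>\<^sub>0 'k::zero) \<Rightarrow> 'b set" where
  "keys \<equiv> Poly_Mapping.keys"

lemma ALSW_op_own_letters: "w \<in> ALSW_op X \<Longrightarrow> w \<in> ALSW prime_gt (set w)"
  by (auto simp: ALSW_op_eq ALSW_def neWords_def)

lemma foliage_bracket_letter:
  fixes X :: "'a::wellorder set"
  assumes "p \<in> lyndon_letters X"
  shows "foliage (bracket_letter p) = [p]"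
  using assms
proof (induction p)
  case (Op u)
  then have u: "u \<in> ALSW_op X" by simp
  then have fol: "\<And>q. q \<in> set u \<Longrightarrow> foliage (bracket_letter q) = [q]"
    using Op.IH ALSW_op_set by blast
  have Z: "set u \<subseteq> letters X" using ALSW_op_set[OF u] lyndon_letters_subset by blast
  then interpret Z: ordered_alphabet prime_gt "set u" by (rule ordered_alphabet_letters)
  have "leaves (standard_bracketing prime_gt u) = u"
    by (rule Z.standard_bracketing(2)[OF ALSW_op_own_letters[OF u]])
  then have "foliage (bracket u) = u"
    using bracket_eq[OF Z fol ALSW_op_own_letters[OF u]]
      foliage_flatten[OF Z fol, of "standard_bracketing prime_gt u"] by simp
  then show ?case by (simp add: bracket_def)
qed simp

lemma bracket_eq_lyndon:
  assumes "w \<in> ALSW_op (X :: 'a::wellorder set)"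
  shows "bracket w = flatten (map_bracketing bracket_letter (standard_bracketing prime_gt w))"
  using assms bracket_eq[OF lyndon_letters_subset foliage_bracket_letter] by (simp add: ALSW_op_eq)

lemma foliage_flatten_lyndon:
  "set (leaves t) \<subseteq> lyndon_letters (X :: 'a::wellorder set) \<Longrightarrow>
    foliage (flatten (map_bracketing bracket_letter t)) = leaves t"
  by (rule foliage_flatten[OF lyndon_letters_subset foliage_bracket_letter])

lemma foliage_bracket:
  assumes "w \<in> ALSW_op (X :: 'a::wellorder set)"
  shows "foliage (bracket w) = w"
  using foliage_flatten_lyndon[of "standard_bracketing prime_gt w" X]
    bracket_eq_lyndon[OF assms] lyndon.standard_bracketing(2)[of w X] ALSW_op_set[OF assms] assms
  by (simp add: ALSW_op_eq)

lemma Op_in_ALSW_op: "w \<in> ALSW_op X \<Longrightarrow> [Op w] \<in> ALSW_op (X :: 'a::wellorder set)"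
  by (simp add: ALSW_op_eq lyndon.Lyndon_singleton)

lemma Var_in_ALSW_op: "x \<in> X \<Longrightarrow> [Var x] \<in> ALSW_op (X :: 'a::wellorder set)"
  by (simp add: ALSW_op_eq lyndon.Lyndon_singleton)

lemma bracket_single:
  assumes "[p] \<in> ALSW_op (X :: 'a::wellorder set)"
  shows "bracket [p] = bracket_letter p"
proof -
  have "standard_bracketing prime_gt [p] = Leaf p"
    using lyndon.standard_bracketing_leaves[of X "Leaf p"] assms by (simp add: ALSW_op_eq)
  then show ?thesis using bracket_eq_lyndon[OF assms] by simp
qed

lemma bracket_Op:
  assumes "w \<in> ALSW_op (X :: 'a::wellorder set)"
  shows "bracket [Op w] = NOp (bracket w)"
  using bracket_single[OF Op_in_ALSW_op[OF assms]] by (simp add: bracket_def)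

lemma bracket_Var: "x \<in> X \<Longrightarrow> bracket [Var x] = NVar (x :: 'a::wellorder)"
  using bracket_single[OF Var_in_ALSW_op] by simp

text \<open>In a descending tree the leading word of the commutator at every node is the
  concatenation of the leading words of its factors.\<close>

primrec descending :: "'a::linorder nword \<Rightarrow> bool" where
  "descending (NVar x) \<longleftrightarrow> True"
| "descending (NOp t) \<longleftrightarrow> descending t"
| "descending (NBr s t) \<longleftrightarrow> descending s \<and> descending t \<and> dl_less (foliage t @ foliage s) (foliage s @ foliage t)"

lemma descending_flatten:
  assumes "NLSW prime_gt (lyndon_letters X) t" "\<And>p. p \<in> set (leaves t) \<Longrightarrow> descending (bracket_letter p)"
  shows "descending (flatten (map_bracketing bracket_letter t :: 'a::wellorder nword bracketing))"
  using assms
proof (induction t)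
  case (Node s t)
  have fol: "foliage (flatten (map_bracketing bracket_letter r)) = leaves r"
    if "NLSW prime_gt (lyndon_letters X) r" for r
    by (rule foliage_flatten_lyndon[OF lyndon.Lyndon_set[OF lyndon.NLSW_leaves[OF that]]])
  have "lex_gt prime_gt (leaves s @ leaves t) (leaves t @ leaves s)"
    using Node.prems(1) by (auto simp: ALSW_def)
  then have "dl_less (leaves t @ leaves s) (leaves s @ leaves t)"
    by (rule lex_gt_imp_dl_less) auto
  then show ?case using Node fol by auto
qed simp

lemma descending_bracket_aux:
  assumes "w \<in> ALSW_op (X :: 'a::wellorder set)" "\<And>p. p \<in> set w \<Longrightarrow> descending (bracket_letter p)"
  shows "descending (bracket w)"
  using descending_flatten[of X "standard_bracketing prime_gt w"] lyndon.standard_bracketing[of w X] assms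
    bracket_eq_lyndon[OF assms(1)] by (simp add: ALSW_op_eq)

lemma descending_bracket:
  assumes "w \<in> ALSW_op (X :: 'a::wellorder set)"
  shows "descending (bracket w)"
proof -
  have "p \<in> lyndon_letters X \<Longrightarrow> descending (bracket_letter p)" for p
  proof (induction p)
    case (Op u)
    then have "descending (bracket u)"
      using ALSW_op_set[of u X] by (intro descending_bracket_aux[of u X]) auto
    then show ?case by (simp add: bracket_def)
  qed simp
  then show ?thesis using ALSW_op_set[OF assms] by (intro descending_bracket_aux[OF assms]) auto
qed

lemma foliage_nonempty [simp]: "foliage t \<noteq> []"
  by (induction t) auto

section \<open>Evaluation of bracketed words in an arbitrary algebra with an operator\<close>

primrec leval :: "('k::field, 'a, 'm) lie_op_scheme \<Rightarrow> ('x \<Rightarrow> 'a) \<Rightarrow> 'x nword \<Rightarrow> 'a" where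
  "leval L \<phi> (NVar x) = \<phi> x"
| "leval L \<phi> (NOp t) = oper L (leval L \<phi> t)"
| "leval L \<phi> (NBr s t) = lbr L (leval L \<phi> s) (leval L \<phi> t)"

definition lyndon_brackets ::
  "('k::field, 'a, 'm) lie_op_scheme \<Rightarrow> ('x \<Rightarrow> 'a) \<Rightarrow> 'x::linorder set \<Rightarrow> 'a set" where
  "lyndon_brackets L \<phi> X = (\<lambda>u. leval L \<phi> (bracket u)) ` ALSW_op X"

context lie_op_algebra
begin

context
  fixes \<phi> :: "'x::wellorder \<Rightarrow> 'a" and X :: "'x set"
  assumes \<phi>: "\<phi> \<in> X \<rightarrow> carrier L"
begin

lemma leval_closed: "foliage t \<in> words X \<Longrightarrow> leval L \<phi> t \<in> carrier L"
  by (induction t) (use \<phi> in \<open>auto simp: words_iff oper_closed lbr_closed\<close>)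

lemma lyndon_brackets_closed: "lyndon_brackets L \<phi> X \<subseteq> carrier L"
  using leval_closed ALSW_op_subset_words foliage_bracket by (fastforce simp: lyndon_brackets_def)

abbreviation tree_val :: "'x letter bracketing \<Rightarrow> 'a" where
  "tree_val r \<equiv> leval L \<phi> (flatten (map_bracketing bracket_letter r))"

lemma lyndon_brackets_eq:
  "lyndon_brackets L \<phi> X = {tree_val r | r. NLSW prime_gt (lyndon_letters X) r}" (is "?A = ?B")
proof
  show "?A \<subseteq> ?B"
    unfolding lyndon_brackets_def using bracket_eq_lyndon[of _ X] lyndon.standard_bracketing(1)[of _ X]
    by (fastforce simp: ALSW_op_eq)
  show "?B \<subseteq> ?A"
  proof
    fix x assume "x \<in> ?B"
    then obtain r where r: "x = tree_val r" "NLSW prime_gt (lyndon_letters X) r" by blast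
    then have "leaves r \<in> ALSW_op X" by (simp add: ALSW_op_eq lyndon.NLSW_leaves)
    moreover from this have "bracket (leaves r) = flatten (map_bracketing bracket_letter r)"
      using bracket_eq_lyndon[of "leaves r" X] lyndon.standard_bracketing_leaves[OF r(2)] by simp
    ultimately show "x \<in> ?A" unfolding lyndon_brackets_def by (intro image_eqI) (simp_all add: r)
  qed
qed

lemma lie_brackets_lyndon: "lie_brackets L prime_gt (lyndon_letters X) tree_val"
proof unfold_locales
  fix z assume z: "z \<in> lyndon_letters X"
  then have "foliage (bracket_letter z) \<in> words X"
    using lyndon_letters_subset[of X] by (auto simp: foliage_bracket_letter[OF z] words_iff)
  then show "tree_val (Leaf z) \<in> carrier L" using leval_closed by simp
qed simp

text \<open>Valid in every algebra with an operator, this is applied twice: in the associative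
  algebra it makes \<open>lie_polys X\<close> closed under commutators, and in a product algebra it
  expands both components of a graph with the same coefficients.\<close>

lemma lspan_lyndon_lbr:
  assumes "x \<in> lspan L (lyndon_brackets L \<phi> X)" "y \<in> lspan L (lyndon_brackets L \<phi> X)"
  shows "lbr L x y \<in> lspan L (lyndon_brackets L \<phi> X)"
  using assms lyndon_brackets_closed lyndon_brackets_closed
proof (rule lspan_lbr)
  interpret lie_brackets L prime_gt "lyndon_letters X" tree_val by (rule lie_brackets_lyndon)
  fix b c assume "b \<in> lyndon_brackets L \<phi> X" "c \<in> lyndon_brackets L \<phi> X"
  then show "lbr L b c \<in> lspan L (lyndon_brackets L \<phi> X)"
    using lbr_NLSW_span unfolding lyndon_brackets_eq by blast
qed

lemma lspan_lyndon_oper: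
  assumes "x \<in> lspan L (lyndon_brackets L \<phi> X)"
  shows "oper L x \<in> lspan L (lyndon_brackets L \<phi> X)"
  using assms lyndon_brackets_closed
proof (rule lspan_oper)
  fix b assume "b \<in> lyndon_brackets L \<phi> X"
  then obtain u where u: "u \<in> ALSW_op X" "b = leval L \<phi> (bracket u)"
    by (auto simp: lyndon_brackets_def)
  then have "oper L b = leval L \<phi> (bracket [Op u])" by (simp add: bracket_Op)
  then show "oper L b \<in> lspan L (lyndon_brackets L \<phi> X)"
    using Op_in_ALSW_op u by (auto simp: lyndon_brackets_def intro!: lspan_base)
qed

end

end

section \<open>Polynomials in operator words\<close>

lemma lookup_scale [simp]: "lookup (scale c f) w = c * lookup f w"
  by (simp add: scale_def Poly_Mapping.map.rep_eq when_def)

interpretation opoly: vector_space "scale :: 'k::field \<Rightarrow> ('x, 'k) opoly \<Rightarrow> ('x, 'k) opoly"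
  by unfold_locales (auto intro!: poly_mapping_eqI simp: lookup_add algebra_simps)

lemma lookup_opP_Op [simp]: "lookup (opP f) [Op w] = lookup f w"
  by (auto simp: opP_def lookup_sum lookup_single when_def in_keys_iff sum.delta)

lemma lookup_opP_other: "v \<notin> range (\<lambda>w. [Op w]) \<Longrightarrow> lookup (opP f) v = 0"
  by (auto simp: opP_def lookup_sum lookup_single when_def intro!: sum.neutral)

lemma opP_eqI:
  assumes "\<And>w. lookup (opP f) [Op w] = lookup g [Op w]" "\<And>v. v \<notin> range (\<lambda>w. [Op w]) \<Longrightarrow> lookup g v = 0"
  shows "opP f = g"
proof (rule poly_mapping_eqI)
  fix v
  show "lookup (opP f) v = lookup g v"
    by (cases "v \<in> range (\<lambda>w. [Op w])") (auto simp: assms(2) lookup_opP_other simp flip: assms(1))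
qed

lemma opP_add: "opP (f + g) = opP f + opP g"
  by (rule opP_eqI) (auto simp: lookup_add lookup_opP_other)

lemma opP_diff: "opP (f - g) = opP f - opP g"
  by (rule opP_eqI) (auto simp: lookup_minus lookup_opP_other)

lemma opP_scale: "opP (scale c f) = scale c (opP f)"
  by (rule opP_eqI) (auto simp: lookup_opP_other)

lemma opP_zero [simp]: "opP 0 = 0"
  by (simp add: opP_def)

lemma opP_wd: "opP (wd w) = wd [Op w]"
  by (simp add: opP_def)

lemma keys_opP: "keys (opP f) = (\<lambda>w. [Op w]) ` keys f"
proof
  show "keys (opP f) \<subseteq> (\<lambda>w. [Op w]) ` keys f"
  proof
    fix v assume v: "v \<in> keys (opP f)"
    then obtain w where "v = [Op w]" using lookup_opP_other[of v f] by (auto simp: in_keys_iff)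
    with v show "v \<in> (\<lambda>w. [Op w]) ` keys f" by (simp add: in_keys_iff)
  qed
qed (auto simp: in_keys_iff)

lemma wd_mult: "wd u * wd v = (wd (u @ v) :: ('x, 'k::field) opoly)"
  by (simp add: mult_single plus_list_def)

lemma wd_Nil: "wd [] = (1 :: ('x, 'k::field) opoly)"
  by (simp flip: zero_list_def)

lemma keys_mult_subset: "w \<in> keys (f * g) \<Longrightarrow> \<exists>u\<in>keys f. \<exists>v\<in>keys g. w = u @ (v :: 'x word)"
  using keys_mult[of f g] unfolding plus_list_def by blast

lemma opoly_expand: "f = (\<Sum>w\<in>keys f. scale (lookup f w) (wd w))" for f :: "('x, 'k::field) opoly"
  by (rule poly_mapping_eqI) (simp add: lookup_sum lookup_single when_def in_keys_iff if_distrib[of "(*) _"] cong: if_cong)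

lemma scale_mult_left: "scale c f * g = scale c (f * g)" for f g :: "('x, 'k::field) opoly"
  by (simp add: scale_def mult_map_scale_conv_mult mult.assoc)

text \<open>Scaling is left multiplication by a constant polynomial, so the point is that constants
  commute with every word.\<close>

lemma scale_mult_right: "f * scale c g = scale c (f * g)" for f g :: "('x, 'k::field) opoly"
proof -
  have "scale c' (wd w) * Poly_Mapping.single 0 c = Poly_Mapping.single 0 c * scale c' (wd w)" for c' and w :: "'x word"
    by (simp add: scale_def mult_single mult.commute)
  then have "f * Poly_Mapping.single 0 c = Poly_Mapping.single 0 c * f"
    using opoly_expand[of f] by (metis (no_types, lifting) sum.cong sum_distrib_left sum_distrib_right)
  then show ?thesis by (simp add: scale_def mult_map_scale_conv_mult flip: mult.assoc)
qed

lemma commutator_simps: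
  fixes f g h :: "('x, 'k::field) opoly"
  shows "commutator (f + g) h = commutator f h + commutator g h"
    "commutator h (f + g) = commutator h f + commutator h g"
    "commutator (scale c f) h = scale c (commutator f h)"
    "commutator h (scale c f) = scale c (commutator h f)"
    "commutator f f = 0"
  by (simp_all add: commutator_def algebra_simps scale_mult_left scale_mult_right opoly.scale_right_diff_distrib)

text \<open>Both \<open>assoc_op X\<close> and \<open>free_lie_op X\<close> turn out to have this
  form, so the algebra laws are checked once for a variable carrier.\<close>

definition opoly_lie :: "('x, 'k::field) opoly set \<Rightarrow> ('k, ('x, 'k) opoly) lie_op" where
  "opoly_lie C = \<lparr>carrier = C, mult = (*), one = undefined, zero = 0, add = (+), smult = scale,
     lbr = commutator, oper = opP\<rparr>"

lemma opoly_lie_simps [simp]: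
  "carrier (opoly_lie C) = C" "zero (opoly_lie C) = 0" "add (opoly_lie C) = (+)"
  "smult (opoly_lie C) = scale" "lbr (opoly_lie C) = commutator" "oper (opoly_lie C) = opP"
  by (simp_all add: opoly_lie_def)

lemma lie_op_algebra_opoly:
  fixes C :: "('x, 'k::field) opoly set"
  assumes C: "opoly.subspace C"
    and br: "\<And>f g. f \<in> C \<Longrightarrow> g \<in> C \<Longrightarrow> commutator f g \<in> C" and op: "\<And>f. f \<in> C \<Longrightarrow> opP f \<in> C"
  shows "lie_op_algebra (opoly_lie C)"
proof -
  note [simp] = opoly.subspace_add[OF C] opoly.subspace_0[OF C] opoly.subspace_scale[OF C]
  have grp: "abelian_group (opoly_lie C)"
    by (rule abelian_groupI) (auto simp: algebra_simps intro: bexI[OF _ opoly.subspace_neg[OF C]])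
  have "Module.module class_ring (opoly_lie C)"
    by (rule moduleI[OF class_cring.is_cring grp])
      (auto simp: opoly.scale_left_distrib opoly.scale_right_distrib)
  then have "vectorspace class_ring (opoly_lie C)"
    by (rule vectorspace.intro[OF _ class_field.field_axioms])
  moreover have "lie_op_algebra_axioms (opoly_lie C)"
    by (rule lie_op_algebra_axioms.intro)
      (simp_all add: commutator_simps opP_add opP_scale br op, simp add: commutator_def algebra_simps)
  ultimately show ?thesis by (rule lie_op_algebra.intro)
qed

lemma words_closed:
  fixes f :: "('x, 'k::field) opoly"
  shows "opoly.subspace {f :: ('x, 'k) opoly. keys f \<subseteq> words X}"
    "keys f \<subseteq> words X \<Longrightarrow> keys g \<subseteq> words X \<Longrightarrow> keys (f * g) \<subseteq> words X"
    "keys f \<subseteq> words X \<Longrightarrow> keys g \<subseteq> words X \<Longrightarrow> keys (commutator f g) \<subseteq> words X"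
    "keys f \<subseteq> words X \<Longrightarrow> keys (opP f) \<subseteq> words X"
proof -
  show sub: "opoly.subspace {f :: ('x, 'k) opoly. keys f \<subseteq> words X}"
  proof (rule opoly.subspaceI)
    fix f g :: "('x, 'k) opoly" and c
    assume f: "f \<in> {f. keys f \<subseteq> words X}" and "g \<in> {f. keys f \<subseteq> words X}"
    then show "f + g \<in> {f. keys f \<subseteq> words X}" using keys_add[of f g] by blast
    show "scale c f \<in> {f. keys f \<subseteq> words X}" using f by (auto simp: in_keys_iff)
  qed simp
  show mult: "keys (f * g) \<subseteq> words X" if "keys f \<subseteq> words X" "keys g \<subseteq> words X" for f g :: "('x, 'k) opoly"
    using that keys_mult_subset[of _ f g] words_append by blast
  show "keys (commutator f g) \<subseteq> words X" if "keys f \<subseteq> words X" "keys g \<subseteq> words X"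
    using opoly.subspace_diff[OF sub, of "f * g" "g * f"] mult that by (simp add: commutator_def)
  show "keys (opP f) \<subseteq> words X" if "keys f \<subseteq> words X"
    using that by (auto simp: keys_opP words_iff[of "[_]"])
qed

lemma assoc_op_eq: "assoc_op X = opoly_lie {f. keys f \<subseteq> words X}"
  by (simp add: assoc_op_def opoly_lie_def)

lemma lie_op_algebra_assoc_op: "lie_op_algebra (assoc_op X :: ('k::field, ('x, 'k) opoly) lie_op)"
  unfolding assoc_op_eq by (rule lie_op_algebra_opoly) (simp_all add: words_closed)

section \<open>Leading words\<close>

definition below :: "('x::linorder, 'k::field) opoly \<Rightarrow> 'x word \<Rightarrow> bool" where
  "below f w \<longleftrightarrow> (\<forall>v\<in>keys f. dl_less v w)"

text \<open>Monic with leading word \<open>w\<close>, phrased without a maximum: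
  \<open>f * g - wd (u @ v)\<close> splits into two products, each with one factor that is
  \<open>below\<close>, so the property passes to products without recourse to totality of the
  order.\<close>

definition leads :: "('x::linorder, 'k::field) opoly \<Rightarrow> 'x word \<Rightarrow> bool" where
  "leads f w \<longleftrightarrow> below (f - wd w) w"

context
  fixes f g :: "('x::wellorder, 'k::field) opoly"
begin

lemma below_0: "below (0 :: ('x, 'k) opoly) w"
  by (simp add: below_def)

lemma below_add: "below f w \<Longrightarrow> below g w \<Longrightarrow> below (f + g) w"
  unfolding below_def using keys_add[of f g] by blast

lemma below_diff: "below f w \<Longrightarrow> below g w \<Longrightarrow> below (f - g) w"
  unfolding below_def using keys_diff[of f g] by blast

lemma below_scale: "below f w \<Longrightarrow> below (scale c f) w"
  by (auto simp: below_def in_keys_iff)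

lemma below_mult:
  assumes "below f u" "below g v \<or> leads g v"
  shows "below (f * g) (u @ v)"
proof -
  have "dl_le q v" if "q \<in> keys g" for q
    using assms(2)
  proof
    assume "leads g v"
    with that show ?thesis by (cases "q = v") (auto simp: leads_def below_def in_keys_iff lookup_minus lookup_single when_def dl_le_def)
  qed (use that in \<open>auto simp: below_def dl_le_def\<close>)
  then show ?thesis using assms(1) keys_mult_subset[of _ f g] dl_less_append_mono(1)
    unfolding below_def by metis
qed

lemma below_mult_right:
  assumes "leads f u" "below g v"
  shows "below (f * g) (u @ v)"
proof -
  have "dl_le q u" if "q \<in> keys f" for q
    using assms(1) that by (cases "q = u") (auto simp: leads_def below_def in_keys_iff lookup_minus lookup_single when_def dl_le_def)
  then show ?thesis using assms(2) keys_mult_subset[of _ f g] dl_less_append_mono(2)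
    unfolding below_def by metis
qed

lemma below_opP: "below f w \<Longrightarrow> below (opP f) [Op w]"
  by (auto simp: below_def keys_opP dl_less_single prime_less_Op)

end

lemma leads_iff:
  "leads f w \<longleftrightarrow> lookup f w = 1 \<and> (\<forall>v\<in>keys f. dl_le v (w :: 'x::wellorder word))"
proof -
  have *: "lookup (f - wd w) v = lookup f v - (if v = w then 1 else 0)" for v
    by (simp add: lookup_minus lookup_single when_def)
  show ?thesis
  proof
    assume l: "leads f w"
    then have "w \<notin> keys (f - wd w)" unfolding leads_def below_def using dl_less_irrefl by blast
    then have "lookup f w = 1" by (simp add: in_keys_iff *)
    moreover have "dl_le v w" if "v \<in> keys f" for v
      using l that by (cases "v = w") (auto simp: leads_def below_def in_keys_iff * dl_le_def)
    ultimately show "lookup f w = 1 \<and> (\<forall>v\<in>keys f. dl_le v w)" by blast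
  next
    assume r: "lookup f w = 1 \<and> (\<forall>v\<in>keys f. dl_le v w)"
    have "dl_less v w" if "v \<in> keys (f - wd w)" for v
      using r that by (cases "v = w") (auto simp: in_keys_iff * dl_le_def)
    then show "leads f w" by (simp add: leads_def below_def)
  qed
qed

lemma leads_wd: "leads (wd w :: ('x::wellorder, 'k::field) opoly) w"
  by (simp add: leads_def below_0)

lemma leads_diff: "leads f w \<Longrightarrow> below g w \<Longrightarrow> leads (f - g) (w :: 'x::wellorder word)"
  using below_diff[of "f - wd w" w g] by (simp add: leads_def algebra_simps)

lemma below_leads_diff: "leads f w \<Longrightarrow> leads g w \<Longrightarrow> below (f - g) (w :: 'x::wellorder word)"
  using below_diff[of "f - wd w" w "g - wd w"] by (simp add: leads_def)

lemma leads_below: "leads f v \<Longrightarrow> dl_less v w \<Longrightarrow> below f (w :: 'x::wellorder word)"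
  unfolding leads_iff below_def using dl_le_less_trans by blast

lemma leads_mult:
  fixes f :: "('x::wellorder, 'k::field) opoly"
  assumes "leads f u" "leads g v"
  shows "leads (f * g) (u @ v)"
proof -
  have "f * g - wd (u @ v) = (f - wd u) * g + wd u * (g - wd v)"
    by (simp add: algebra_simps flip: wd_mult)
  moreover have "below ((f - wd u) * g) (u @ v)" "below (wd u * (g - wd v)) (u @ v)"
    using assms below_mult[of "f - wd u" u g v] below_mult_right[of "wd u" u "g - wd v" v] leads_wd
    by (auto simp: leads_def)
  ultimately show ?thesis by (simp add: leads_def below_add)
qed

lemma leads_opP: "leads f w \<Longrightarrow> leads (opP f) [Op (w :: 'x::wellorder word)]"
  using below_opP[of "f - wd w" w] by (simp add: leads_def opP_diff opP_wd)

lemma leads_commutator: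
  fixes f :: "('x::wellorder, 'k::field) opoly"
  assumes "leads f u" "leads g v" "dl_less (v @ u) (u @ v)"
  shows "leads (commutator f g) (u @ v)"
  unfolding commutator_def using assms leads_mult leads_below leads_diff by blast

lemma leads_lie_elem:
  "descending t \<Longrightarrow> leads (lie_elem t :: ('x::wellorder, 'k::field) opoly) (foliage t)"
  by (induction t) (auto simp: leads_wd leads_opP leads_commutator)

lemma leads_bracket:
  "u \<in> ALSW_op X \<Longrightarrow> leads (lie_elem (bracket u) :: ('x::wellorder, 'k::field) opoly) u"
  using leads_lie_elem[OF descending_bracket] foliage_bracket by metis

lemma leads_nonzero: "leads f w \<Longrightarrow> f \<noteq> 0" for w :: "'x::wellorder word"
  by (auto simp: leads_iff)

lemma leads_unique: "leads f w \<Longrightarrow> leads f v \<Longrightarrow> v = (w :: 'x::wellorder word)"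
  unfolding leads_iff using dl_less_asym by (metis dl_le_def in_keys_iff zero_neq_one)

lemma lead_word_eq: "leads f w \<Longrightarrow> lead_word f = (w :: 'x::wellorder word)"
  unfolding lead_word_def leads_iff
proof (rule the_equality)
  assume l: "lookup f w = 1 \<and> (\<forall>v\<in>keys f. dl_le v w)"
  then show w: "w \<in> keys f \<and> (\<forall>v\<in>keys f. v = w \<or> dl_less v w)" by (auto simp: dl_le_def in_keys_iff)
  fix v assume v: "v \<in> keys f \<and> (\<forall>u\<in>keys f. u = v \<or> dl_less u v)"
  have "v = w \<or> dl_less v w" by (rule bspec[OF conjunct2[OF w] conjunct1[OF v]])
  moreover have "w = v \<or> dl_less w v" by (rule bspec[OF conjunct2[OF v] conjunct1[OF w]])
  ultimately show "v = w" using dl_less_asym[of v w] by auto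
qed

lemma leads_monic: "leads f w \<Longrightarrow> monic_opoly f" for w :: "'x::wellorder word"
  using leads_nonzero[of f w] lead_word_eq[of f w] by (simp add: monic_opoly_def leads_iff)

section \<open>Triangular families and the diamond lemma\<close>

lemma span_image_obtain:
  fixes b :: "'i \<Rightarrow> ('x, 'k::field) opoly"
  assumes "f \<in> opoly.span (b ` W)"
  obtains F c where "finite F" "F \<subseteq> W" "\<And>w. w \<in> F \<Longrightarrow> c w \<noteq> 0" "f = (\<Sum>w\<in>F. scale (c w) (b w))"
proof -
  have "\<exists>F c. finite F \<and> F \<subseteq> W \<and> f = (\<Sum>w\<in>F. scale (c w) (b w))"
    using assms
  proof (induction rule: opoly.span_induct_alt)
    case base
    show ?case by (intro exI[of _ "{}"]) simp
  next
    case (step a x y)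
    then obtain w F c where w: "w \<in> W" "x = b w" and F: "finite F" "F \<subseteq> W" "y = (\<Sum>w\<in>F. scale (c w) (b w))"
      by blast
    define c' where "c' = (\<lambda>v. (if v \<in> F then c v else 0) + (if v = w then a else 0))"
    have "(\<Sum>v\<in>insert w F. scale (c' v) (b v)) =
      (\<Sum>v\<in>insert w F. scale (if v \<in> F then c v else 0) (b v)) + (\<Sum>v\<in>insert w F. scale (if v = w then a else 0) (b v))"
      by (simp add: c'_def opoly.scale_left_distrib sum.distrib)
    also have "(\<Sum>v\<in>insert w F. scale (if v \<in> F then c v else 0) (b v)) = y"
      unfolding F(3) using F(1) by (intro sum.mono_neutral_cong_right) auto
    also have "(\<Sum>v\<in>insert w F. scale (if v = w then a else 0) (b v)) = scale a x"
      using F(1) w by (subst sum.mono_neutral_cong_right[of _ "{w}" _ "\<lambda>v. scale a (b v)"]) auto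
    finally show ?case using F w by (intro exI[of _ "insert w F"] exI[of _ c']) (auto simp: add.commute)
  qed
  then obtain F c where F: "finite F" "F \<subseteq> W" "f = (\<Sum>w\<in>F. scale (c w) (b w))" by blast
  have "f = (\<Sum>w\<in>{w \<in> F. c w \<noteq> 0}. scale (c w) (b w))"
    unfolding F(3) using F(1) by (intro sum.mono_neutral_right) auto
  then show ?thesis using F(1,2) by (intro that[of "{w \<in> F. c w \<noteq> 0}" c]) auto
qed

text \<open>With one element per leading word, the largest of the finitely many leading words
  involved occurs only once at the top and cannot cancel. Both the control of leading words in spans
  and the linear independence of brackets come from this.\<close>

lemma span_leading_word:
  fixes b :: "'x::wellorder word \<Rightarrow> ('x, 'k::field) opoly"
  assumes W: "W \<subseteq> words X" and b: "\<And>w. w \<in> W \<Longrightarrow> leads (b w) w"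
    and f: "f \<in> opoly.span (b ` W)" "f \<noteq> 0"
  obtains w where "w \<in> W" "w \<in> keys f" "\<And>v. v \<in> keys f \<Longrightarrow> dl_le v w"
    "f \<in> opoly.span (b ` {v \<in> W. dl_le v w})"
proof -
  from f(1) obtain F c where F: "finite F" "F \<subseteq> W" "\<And>w. w \<in> F \<Longrightarrow> c w \<noteq> 0"
    and fs: "f = (\<Sum>w\<in>F. scale (c w) (b w))" by (rule span_image_obtain) blast
  have "F \<noteq> {}" using f(2) fs by auto
  then obtain w where w: "w \<in> F" "\<And>v. v \<in> F \<Longrightarrow> dl_le v w"
    using finite_words_max[of F X] F(1) subset_trans[OF F(2) W] by blast
  have top: "v \<in> keys (b u) \<Longrightarrow> dl_le v u" if "u \<in> F" for u v
    using b[of u] F that by (auto simp: leads_iff)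
  have "lookup (b u) w = 0" if "u \<in> F - {w}" for u
    using top[of u w] w(2)[of u] that by (auto simp: dl_le_def in_keys_iff dest: dl_less_asym)
  then have "lookup f w = c w * lookup (b w) w"
    unfolding fs lookup_sum using F(1) w(1) by (simp only: sum.remove[of F w]) simp
  then have "lookup f w \<noteq> 0" using b[of w] w(1) F by (auto simp: leads_iff)
  moreover have "dl_le v w" if "v \<in> keys f" for v
  proof -
    have "lookup f v \<noteq> 0" using that by (simp add: in_keys_iff)
    then obtain u where "u \<in> F" "c u * lookup (b u) v \<noteq> 0"
      unfolding fs lookup_sum using sum.not_neutral_contains_not_neutral by (metis (mono_tags, lifting) lookup_scale)
    then have "dl_le v u" by (intro top) (auto simp: in_keys_iff)
    then show ?thesis using w(2)[OF \<open>u \<in> F\<close>] dl_le_trans by blast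
  qed
  moreover have "f \<in> opoly.span (b ` {v \<in> W. dl_le v w})"
    unfolding fs using F w by (intro opoly.span_sum opoly.span_scale opoly.span_base) auto
  ultimately show ?thesis using that w F by (auto simp: in_keys_iff)
qed

text \<open>The diamond lemma: modulo smaller elements the family has one element for each of its
  leading words, so a triangular subfamily spans the same space.\<close>

lemma diamond:
  fixes R :: "'x::wellorder word \<Rightarrow> ('x, 'k::field) opoly \<Rightarrow> bool"
  assumes W: "\<And>w r. R w r \<Longrightarrow> w \<in> words X \<and> leads r w"
    and conf: "\<And>w r r'. R w r \<Longrightarrow> R w r' \<Longrightarrow> r - r' \<in> opoly.span {s. \<exists>v. R v s \<and> dl_less v w}"
    and f: "f \<in> opoly.span {r. \<exists>w. R w r}" "f \<noteq> 0"
  obtains w r where "R w r" "w \<in> keys f" "\<And>v. v \<in> keys f \<Longrightarrow> dl_le v w"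
proof -
  define W where "W = {w. \<exists>r. R w r}"
  define \<rho> where "\<rho> w = (SOME r. R w r)" for w
  have \<rho>: "R w (\<rho> w)" if "w \<in> W" for w
    using that unfolding W_def \<rho>_def by (auto intro: someI)
  have "r \<in> opoly.span (\<rho> ` W)" if "R w r" for w r
    using that
  proof (induction w arbitrary: r rule: wf_induct_rule[OF wf_dl_less])
    case (1 w)
    have "w \<in> W" using 1(2) by (auto simp: W_def)
    have "opoly.span {s. \<exists>v. R v s \<and> dl_less v w} \<subseteq> opoly.span (\<rho> ` W)"
      using 1(1) by (intro opoly.span_minimal) auto
    then have "r - \<rho> w \<in> opoly.span (\<rho> ` W)"
      using conf[OF 1(2) \<rho>[OF \<open>w \<in> W\<close>]] by blast
    moreover have "\<rho> w \<in> opoly.span (\<rho> ` W)" using \<open>w \<in> W\<close> by (intro opoly.span_base) auto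
    ultimately show ?case using opoly.span_add by fastforce
  qed
  then have "opoly.span {r. \<exists>w. R w r} \<subseteq> opoly.span (\<rho> ` W)"
    by (intro opoly.span_minimal) auto
  then have "f \<in> opoly.span (\<rho> ` W)" using f by blast
  moreover have "W \<subseteq> words X" "\<And>w. w \<in> W \<Longrightarrow> leads (\<rho> w) w" using \<rho> assms(1) by blast+
  ultimately obtain w where "w \<in> W" "w \<in> keys f" "\<And>v. v \<in> keys f \<Longrightarrow> dl_le v w"
    using span_leading_word[of W X \<rho> f] f(2) by blast
  then show ?thesis using that \<rho> by blast
qed

section \<open>The free Lie algebra with an operator\<close>

lemma lspan_opoly: "lspan (opoly_lie C) B = opoly.span B"
proof
  show "lspan (opoly_lie C) B \<subseteq> opoly.span B"
  proof
    fix x assume "x \<in> lspan (opoly_lie C) B"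
    then show "x \<in> opoly.span B"
      by induction (auto intro: opoly.span_base opoly.span_zero opoly.span_add opoly.span_scale)
  qed
  show "opoly.span B \<subseteq> lspan (opoly_lie C) B"
  proof
    fix x assume "x \<in> opoly.span B"
    then show "x \<in> lspan (opoly_lie C) B"
    proof (induction rule: opoly.span_induct_alt)
      case base
      show ?case using lspan_zero[of "opoly_lie C" B] by simp
    next
      case (step c x y)
      have "scale c x \<in> lspan (opoly_lie C) B"
        using lspan_smult[OF lspan_base[OF step(1)], of "opoly_lie C" c] by simp
      from lspan_add[OF this step(2)] show ?case by simp
    qed
  qed
qed

lemma leval_opoly: "leval (opoly_lie C) (\<lambda>x. wd [Var x]) t = lie_elem t"
  by (induction t) auto

abbreviation lyndon_elem :: "'x::linorder word \<Rightarrow> ('x, 'k::field) opoly" where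
  "lyndon_elem u \<equiv> lie_elem (bracket u)"

text \<open>The free Lie algebra with an operator, presented by a spanning set with distinct leading
  words; \<open>free_lie_op_eq\<close> identifies it with the subalgebra generated by
  \<open>X\<close>.\<close>

definition lie_polys :: "'x::linorder set \<Rightarrow> ('x, 'k::field) opoly set" where
  "lie_polys X = opoly.span (lyndon_elem ` ALSW_op X)"

lemma lspan_lie_polys:
  "lspan (assoc_op X) (lyndon_brackets (assoc_op X) (\<lambda>x. wd [Var x]) X) = lie_polys X"
  by (simp add: assoc_op_eq lspan_opoly lyndon_brackets_def leval_opoly lie_polys_def)

context
  fixes X :: "'x::wellorder set"
begin

lemma gen_carrier: "(\<lambda>x. wd [Var x]) \<in> X \<rightarrow> carrier (assoc_op X :: ('k::field, ('x, 'k) opoly) lie_op)"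
  by (auto simp: assoc_op_eq words_iff)

lemma lie_polys_subspace: "opoly.subspace (lie_polys X)"
  by (simp add: lie_polys_def)

lemma lie_polys_commutator:
  "f \<in> lie_polys X \<Longrightarrow> g \<in> lie_polys X \<Longrightarrow> commutator f g \<in> (lie_polys X :: ('x, 'k::field) opoly set)"
  using lie_op_algebra.lspan_lyndon_lbr[OF lie_op_algebra_assoc_op gen_carrier, of f g]
  unfolding lspan_lie_polys by (simp add: assoc_op_eq)

lemma lie_polys_opP: "f \<in> lie_polys X \<Longrightarrow> opP f \<in> (lie_polys X :: ('x, 'k::field) opoly set)"
  using lie_op_algebra.lspan_lyndon_oper[OF lie_op_algebra_assoc_op gen_carrier, of f]
  unfolding lspan_lie_polys by (simp add: assoc_op_eq)

lemma lyndon_elem_lie_polys: "u \<in> ALSW_op X \<Longrightarrow> lyndon_elem u \<in> lie_polys X"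
  unfolding lie_polys_def by (intro opoly.span_base) auto

lemma lie_elem_lie_polys: "foliage t \<in> words X \<Longrightarrow> lie_elem t \<in> (lie_polys X :: ('x, 'k::field) opoly set)"
proof (induction t)
  case (NVar x)
  then have "x \<in> X" by (simp add: words_iff)
  then show ?case using lyndon_elem_lie_polys[OF Var_in_ALSW_op] bracket_Var by fastforce
next
  case (NBr s t)
  then have "foliage s \<in> words X" "foliage t \<in> words X" by (auto simp: words_iff)
  then show ?case using NBr.IH lie_polys_commutator by simp
qed (auto simp: words_iff[of "[_]"] lie_polys_opP)

lemma lie_polys_words: "f \<in> lie_polys X \<Longrightarrow> keys f \<subseteq> words X"
  using lie_op_algebra.lspan_closed[OF lie_op_algebra_assoc_op
      lie_op_algebra.lyndon_brackets_closed[OF lie_op_algebra_assoc_op gen_carrier], of f]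
  unfolding lspan_lie_polys by (simp add: assoc_op_eq)

lemma lie_polys_leading_word:
  fixes f :: "('x, 'k::field) opoly"
  assumes "f \<in> lie_polys X" "f \<noteq> 0"
  obtains w where "w \<in> ALSW_op X" "w \<in> keys f" "\<And>v. v \<in> keys f \<Longrightarrow> dl_le v w"
    "f \<in> opoly.span (lyndon_elem ` {v \<in> ALSW_op X. dl_le v w})"
proof (rule span_leading_word[of "ALSW_op X" X lyndon_elem f])
  show "leads (lyndon_elem w :: ('x, 'k) opoly) w" if "w \<in> ALSW_op X" for w
    using that by (rule leads_bracket)
qed (use assms that ALSW_op_subset_words in \<open>auto simp: lie_polys_def\<close>)

lemma submodule_opoly:
  fixes C D :: "('x, 'k::field) opoly set"
  assumes D: "lie_op_algebra (opoly_lie D)"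
  shows "LinearCombinations.submodule class_ring C (opoly_lie D) \<longleftrightarrow> C \<subseteq> D \<and> opoly.subspace C"
proof -
  have "Module.module class_ring (opoly_lie D)"
    using D by (simp add: lie_op_algebra_def vectorspace_def)
  then show ?thesis
    by (auto simp: submodule_def opoly.subspace_def)
qed

lemma free_lie_op_eq: "free_lie_op X = (opoly_lie (lie_polys X) :: ('k::field, ('x, 'k) opoly) lie_op)"
proof -
  let ?A = "assoc_op X :: ('k, ('x, 'k) opoly) lie_op"
  have sub: "lie_op_subalgebra A ?A \<longleftrightarrow> A \<subseteq> {f. keys f \<subseteq> words X} \<and> opoly.subspace A \<and>
      (\<forall>x\<in>A. \<forall>y\<in>A. commutator x y \<in> A) \<and> (\<forall>x\<in>A. opP x \<in> A)" for A
    using submodule_opoly[OF lie_op_algebra_assoc_op[of X, unfolded assoc_op_eq], of A]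
    by (simp add: lie_op_subalgebra_def assoc_op_eq)
  have "(\<lambda>A. lie_op_subalgebra A ?A) hull ((\<lambda>x. wd [Var x]) ` X) = lie_polys X"
  proof (rule hull_unique)
    show "(\<lambda>x. wd [Var x]) ` X \<subseteq> (lie_polys X :: ('x, 'k) opoly set)"
      using lie_elem_lie_polys[of "NVar _"] by (auto simp: words_iff)
    show "lie_op_subalgebra (lie_polys X) ?A"
      using lie_polys_words lie_polys_commutator lie_polys_opP by (auto simp: sub lie_polys_subspace)
    fix A assume gen: "(\<lambda>x. wd [Var x]) ` X \<subseteq> A" and A: "lie_op_subalgebra A ?A"
    have "lie_elem t \<in> A" if "foliage t \<in> words X" for t
      using that A gen unfolding sub by (induction t) (auto simp: words_iff)
    then have "lyndon_elem ` ALSW_op X \<subseteq> A"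
      using foliage_bracket ALSW_op_subset_words by fastforce
    then show "lie_polys X \<subseteq> A" unfolding lie_polys_def
      using A by (intro opoly.span_minimal) (auto simp: sub)
  qed
  then show ?thesis by (simp add: free_lie_op_def assoc_op_eq opoly_lie_def)
qed

lemma lie_op_algebra_lie_polys: "lie_op_algebra (opoly_lie (lie_polys X) :: ('k::field, ('x, 'k) opoly) lie_op)"
  by (rule lie_op_algebra_opoly) (auto simp: lie_polys_subspace lie_polys_commutator lie_polys_opP)

end

section \<open>Star contexts and special normal words\<close>

lemma words_append_iff: "u \<noteq> [] \<Longrightarrow> v \<noteq> [] \<Longrightarrow> u @ v \<in> words X \<longleftrightarrow> u \<in> words X \<and> v \<in> words X"
  by (auto simp: words_iff)

lemma words_Op: "[Op w] \<in> words X \<longleftrightarrow> w \<in> words X"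
  by (simp add: words_iff[of "[_]"])

text \<open>Bracketed star words described along the path to their single star, with star-free
  siblings. This replaces the counting of stars by a form on which rule induction works.\<close>

inductive nword_context :: "'x set \<Rightarrow> 'x option nword \<Rightarrow> bool" for X where
  star: "nword_context X (NVar None)"
| op: "nword_context X T \<Longrightarrow> nword_context X (NOp T)"
| left: "nword_context X T \<Longrightarrow> foliage t \<in> words X \<Longrightarrow> nword_context X (NBr T (map_nword Some t))"
| right: "nword_context X T \<Longrightarrow> foliage t \<in> words X \<Longrightarrow> nword_context X (NBr (map_nword Some t) T)"

lemma no_star:
  "foliage T \<in> words (insert None (Some ` X)) \<Longrightarrow> sum_list (map (lcount None) (foliage T)) = 0 \<Longrightarrow>
    \<exists>t. T = map_nword Some t \<and> foliage t \<in> words X"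
proof (induction T)
  case (NVar a)
  then obtain x where "a = Some x" "x \<in> X" by (cases a) (auto simp: words_iff)
  then show ?case by (intro exI[of _ "NVar x"]) (auto simp: words_iff)
next
  case (NOp T)
  then obtain t where "T = map_nword Some t" "foliage t \<in> words X" by (auto simp: words_Op)
  then show ?case by (intro exI[of _ "NOp t"]) (auto simp: words_Op)
next
  case (NBr S T)
  then obtain s t where "S = map_nword Some s" "foliage s \<in> words X" "T = map_nword Some t" "foliage t \<in> words X"
    by (auto simp: words_append_iff)
  then show ?case by (intro exI[of _ "NBr s t"]) (auto simp: words_append_iff)
qed

lemma nword_contextI: "foliage T \<in> star_words X \<Longrightarrow> nword_context X T"
proof (induction T)
  case (NVar a)
  then have "a = None" by (cases a) (auto simp: star_words_def)
  then show ?case by (simp add: nword_context.star)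
next
  case (NOp T)
  then show ?case by (auto simp: star_words_def words_Op intro: nword_context.op)
next
  case (NBr S T)
  then have w: "foliage S \<in> words (insert None (Some ` X))" "foliage T \<in> words (insert None (Some ` X))"
    by (auto simp: star_words_def words_append_iff)
  from NBr.prems consider "sum_list (map (lcount None) (foliage S)) = 1" "sum_list (map (lcount None) (foliage T)) = 0"
    | "sum_list (map (lcount None) (foliage S)) = 0" "sum_list (map (lcount None) (foliage T)) = 1"
    by (auto simp: star_words_def add_is_1)
  then show ?case
  proof cases
    case 1
    then show ?thesis using no_star[of T X] NBr.IH(1) w by (auto simp: star_words_def intro: nword_context.left)
  next
    case 2
    then show ?thesis using no_star[of S X] NBr.IH(2) w by (auto simp: star_words_def intro: nword_context.right)
  qed
qed

lemma nplug_simps [simp]: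
  "nplug (NVar None) b = b" "nplug (NOp T) b = NOp (nplug T b)"
  "nplug (NBr S T) b = NBr (nplug S b) (nplug T b)" "nplug (map_nword Some t) b = t"
proof -
  show "nplug (map_nword Some t) b = t" by (induction t) (auto simp: nplug_def)
qed (auto simp: nplug_def)

abbreviation fill :: "'x option nword \<Rightarrow> ('x, 'k::field) opoly \<Rightarrow> ('x, 'k) opoly" where
  "fill T g \<equiv> neval (case_option g (\<lambda>x. wd [Var x])) T"

lemma fill_no_star [simp]: "fill (map_nword Some t) g = lie_elem t"
  by (induction t) auto

text \<open>The conditions in \<open>descending\<close> mention foliages only, so at the star any
  \<open>g\<close> with the same leading word may stand in for the bracket \<open>b\<close>.\<close>

lemma leads_fill:
  fixes g :: "('x::wellorder, 'k::field) opoly"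
  assumes "nword_context X T" "leads g (foliage b)" "descending (nplug T b)"
  shows "leads (fill T g) (foliage (nplug T b))"
  using assms by induction (auto simp: leads_opP leads_commutator leads_lie_elem)

text \<open>\<open>I n\<close> plays the role of the elements of degree at most \<open>n\<close> of an ideal.\<close>

lemma fill_in_ideal:
  fixes g :: "('x::wellorder, 'k::field) opoly" and I :: "nat \<Rightarrow> ('x, 'k) opoly set"
  assumes "nword_context X T" "g \<in> I (deg (foliage b))"
    and br: "\<And>n f t. f \<in> I n \<Longrightarrow> foliage t \<in> words X \<Longrightarrow> commutator f (lie_elem t) \<in> I (n + deg (foliage t))
      \<and> commutator (lie_elem t) f \<in> I (deg (foliage t) + n)"
    and op: "\<And>n f. f \<in> I n \<Longrightarrow> opP f \<in> I (Suc n)"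
  shows "fill T g \<in> I (deg (foliage (nplug T b)))"
  using assms(1,2) by induction (use br op in auto)

lemma lyndon_factors:
  assumes "set c \<subseteq> lyndon_letters (X :: 'x::wellorder set)"
  shows "lyndon.lyndon_decreasing X (lyndon_factors X c)" "concat (lyndon_factors X c) = c"
proof -
  let ?P = "\<lambda>cs. concat cs = c \<and> set cs \<subseteq> ALSW_op X \<and>
     (\<forall>t. Suc t < length cs \<longrightarrow> cs ! t = cs ! Suc t \<or> lex_gt prime_gt (cs ! Suc t) (cs ! t))"
  have P: "?P cs \<longleftrightarrow> concat cs = c \<and> lyndon.lyndon_decreasing X cs" for cs
    unfolding lyndon.lyndon_decreasing_iff ALSW_op_eq by blast
  obtain cs where cs: "lyndon.lyndon_decreasing X cs" "concat cs = c"
    using lyndon.lyndon_factorization_exists[OF assms] by blast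
  have "\<exists>!cs. ?P cs"
  proof (rule ex1I)
    show "?P cs" by (rule iffD2[OF P conjI[OF cs(2,1)]])
    fix ds assume "?P ds"
    then have ds: "concat ds = c \<and> lyndon.lyndon_decreasing X ds" by (rule iffD1[OF P])
    show "ds = cs"
      by (rule lyndon.lyndon_factorization_unique[OF conjunct2[OF ds] cs(1)]) (simp only: cs(2) conjunct1[OF ds])
  qed
  from theI'[OF this] have "?P (lyndon_factors X c)" unfolding lyndon_factors_def .
  from iffD1[OF P this] show "lyndon.lyndon_decreasing X (lyndon_factors X c)" "concat (lyndon_factors X c) = c"
    by (rule conjunct2, rule conjunct1)
qed

definition factor_commutator :: "('x::linorder, 'k::field) opoly \<Rightarrow> 'x word list \<Rightarrow> ('x, 'k) opoly" where
  "factor_commutator f cs = foldl (\<lambda>g c. commutator g (lyndon_elem c)) f cs"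

text \<open>Every partial product is again a Lyndon-Shirshov word by
  \<open>Lyndon_append_factors\<close>, so in each successive commutator the product in the given
  order has the larger leading word.\<close>

lemma leads_factor_commutator:
  fixes f :: "('x::wellorder, 'k::field) opoly"
  assumes v: "v \<in> ALSW_op X" and f: "leads f v"
    and cs: "lyndon.lyndon_decreasing X cs" and vc: "v @ concat cs \<in> ALSW_op X"
  shows "leads (factor_commutator f cs) (v @ concat cs)"
  using cs vc
proof (induction cs rule: rev_induct)
  case Nil
  then show ?case using f by (simp add: factor_commutator_def)
next
  case (snoc c cs)
  have ds: "lyndon.lyndon_decreasing X cs" using snoc.prems(1) by (simp add: sorted_wrt_append)
  have "v @ concat cs \<in> ALSW_op X"
    using lyndon.Lyndon_append_factors[of v X cs "[c]"] v snoc.prems unfolding ALSW_op_eq by blast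
  then have IH: "leads (factor_commutator f cs) (v @ concat cs)" by (rule snoc.IH[OF ds])
  have c: "c \<in> ALSW_op X" using snoc.prems(1) by (simp add: ALSW_op_eq)
  then have "c \<noteq> []" "v \<noteq> []" using v by (auto simp: ALSW_op_eq lyndon.Lyndon_nonempty)
  moreover have "(v @ concat cs) @ c \<in> ALSW_op X" using snoc.prems(2) by simp
  ultimately have "lex_gt prime_gt ((v @ concat cs) @ c) (c @ (v @ concat cs))"
    unfolding ALSW_op_eq ALSW_def by blast
  then have "dl_less (c @ (v @ concat cs)) ((v @ concat cs) @ c)"
    by (rule lex_gt_imp_dl_less) auto
  then have "leads (commutator (factor_commutator f cs) (lyndon_elem c)) ((v @ concat cs) @ c)"
    using IH leads_bracket[OF c] leads_commutator by blast
  then show ?case by (simp add: factor_commutator_def)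
qed

lemma factor_commutator_in_ideal:
  fixes f :: "('x::wellorder, 'k::field) opoly" and I :: "nat \<Rightarrow> ('x, 'k) opoly set"
  assumes "f \<in> I n" "set cs \<subseteq> ALSW_op X"
    and br: "\<And>n f t. f \<in> I n \<Longrightarrow> foliage t \<in> words X \<Longrightarrow> commutator f (lie_elem t) \<in> I (n + deg (foliage t))"
  shows "factor_commutator f cs \<in> I (n + deg (concat cs))"
  using assms(2)
proof (induction cs rule: rev_induct)
  case Nil
  then show ?case using assms(1) by (simp add: factor_commutator_def)
next
  case (snoc c cs)
  then have c: "c \<in> ALSW_op X" by simp
  have "commutator (factor_commutator f cs) (lyndon_elem c) \<in> I (n + deg (concat cs) + deg (foliage (bracket c)))"
    using snoc c ALSW_op_subset_words[of X] foliage_bracket[OF c] by (intro br) auto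
  then show ?case using foliage_bracket[OF c] by (simp add: factor_commutator_def add.assoc)
qed

lemma neval_nsubst: "neval \<sigma> (nsubst \<tau> T) = neval (\<lambda>b. neval \<sigma> (\<tau> b)) T"
  by (induction T) auto

lemma fill_nplug_star: "fill (nplug_star T E) f = fill T (fill E f)"
proof -
  have "(\<lambda>b. fill (case b of None \<Rightarrow> E | Some x \<Rightarrow> NVar (Some x)) f) = case_option (fill E f) (\<lambda>x. wd [Var x])"
    by (auto split: option.splits)
  then show ?thesis by (simp add: nplug_star_def neval_nsubst)
qed

lemma fill_foldl:
  "fill (foldl (\<lambda>t ci. NBr t (map_nword Some (bracket ci))) (NVar None) cs) f = factor_commutator f cs"
  by (induction cs rule: rev_induct) (auto simp: factor_commutator_def)

lemma special_normal_obtain: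
  fixes f :: "('x::wellorder, 'k::field) opoly"
  assumes ch: "valid_choice X ch" and \<pi>: "\<pi> \<in> star_words X" and v: "v \<in> ALSW_op X"
    and w: "plug \<pi> v \<in> ALSW_op X" and f: "leads f v"
  obtains T c where "nword_context X T" "set c \<subseteq> lyndon_letters X" "v @ c \<in> ALSW_op X"
    "bracket (plug \<pi> v) = nplug T (bracket (v @ c))"
    "special_normal X ch \<pi> f = fill T (factor_commutator f (lyndon_factors X c))"
proof -
  obtain T c where Tc: "ch \<pi> v = (T, c)" by (cases "ch \<pi> v") auto
  have "admissible X \<pi> v (ch \<pi> v)" using ch \<pi> v w by (auto simp: valid_choice_def)
  then have adm: "foliage T \<in> star_words X" "v @ c \<in> ALSW_op X"
    "bracket (plug \<pi> v) = nplug T (bracket (v @ c))"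
    unfolding Tc admissible_def by auto
  have "special_normal X ch \<pi> f = fill T (factor_commutator f (lyndon_factors X c))"
    using lead_word_eq[OF f] Tc
    by (simp add: special_normal_def special_context_def fill_nplug_star fill_foldl)
  then show ?thesis using that nword_contextI[OF adm(1)] adm(2,3) ALSW_op_set[OF adm(2)] by auto
qed

lemma leads_special_normal:
  fixes f :: "('x::wellorder, 'k::field) opoly"
  assumes ch: "valid_choice X ch" and \<pi>: "\<pi> \<in> star_words X" and v: "v \<in> ALSW_op X"
    and w: "plug \<pi> v \<in> ALSW_op X" and f: "leads f v"
  shows "leads (special_normal X ch \<pi> f) (plug \<pi> v)"
proof -
  obtain T c where T: "nword_context X T" and c: "set c \<subseteq> lyndon_letters X" "v @ c \<in> ALSW_op X"
    and b: "bracket (plug \<pi> v) = nplug T (bracket (v @ c))"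
    and sn: "special_normal X ch \<pi> f = fill T (factor_commutator f (lyndon_factors X c))"
    using special_normal_obtain[OF assms] by blast
  have "leads (factor_commutator f (lyndon_factors X c)) (foliage (bracket (v @ c)))"
    using leads_factor_commutator[OF v f lyndon_factors(1)[OF c(1)]] c(2)
    by (simp add: lyndon_factors(2)[OF c(1)] foliage_bracket[OF c(2)])
  from leads_fill[OF T this] show ?thesis
    using descending_bracket[OF w] foliage_bracket[OF w] unfolding b sn by simp
qed

text \<open>The family \<open>I\<close> covers three uses: the constant families of Lie polynomials
  and of the Rota-Baxter ideal, and the degree filtration of the rewriting span.\<close>

lemma special_normal_in_ideal:
  fixes f :: "('x::wellorder, 'k::field) opoly" and I :: "nat \<Rightarrow> ('x, 'k) opoly set"
  assumes sn: "valid_choice X ch" "\<pi> \<in> star_words X" "v \<in> ALSW_op X" "plug \<pi> v \<in> ALSW_op X" "leads f v"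
    and f: "f \<in> I (deg v)"
    and br: "\<And>n f t. f \<in> I n \<Longrightarrow> foliage t \<in> words X \<Longrightarrow> commutator f (lie_elem t) \<in> I (n + deg (foliage t))
      \<and> commutator (lie_elem t) f \<in> I (deg (foliage t) + n)"
    and op: "\<And>n f. f \<in> I n \<Longrightarrow> opP f \<in> I (Suc n)"
  shows "special_normal X ch \<pi> f \<in> I (deg (plug \<pi> v))"
proof -
  obtain T c where T: "nword_context X T" and c: "set c \<subseteq> lyndon_letters X" "v @ c \<in> ALSW_op X"
    and b: "bracket (plug \<pi> v) = nplug T (bracket (v @ c))"
    and eq: "special_normal X ch \<pi> f = fill T (factor_commutator f (lyndon_factors X c))"
    using special_normal_obtain[OF sn] by blast
  have "set (lyndon_factors X c) \<subseteq> ALSW_op X" using lyndon_factors(1)[OF c(1)] unfolding ALSW_op_eq by blast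
  then have "factor_commutator f (lyndon_factors X c) \<in> I (deg (foliage (bracket (v @ c))))"
    using factor_commutator_in_ideal[of f I "deg v" "lyndon_factors X c" X] f br lyndon_factors(2)[OF c(1)]
      foliage_bracket[OF c(2)] by simp
  from fill_in_ideal[OF T this br op] show ?thesis
    using foliage_bracket[OF sn(4)] unfolding b eq by simp
qed

section \<open>Reducible words\<close>

text \<open>Occurrence of a forbidden pattern by recursion on its depth instead of by star words;
  \<open>reducible_obtain\<close> and \<open>plug_reducible\<close> pass between the two
  descriptions.\<close>

inductive reducible :: "'x::linorder set \<Rightarrow> 'x word \<Rightarrow> bool" for X where
  here: "\<lbrakk>u \<in> ALSW_op X; v \<in> ALSW_op X; dl_less v u\<rbrakk> \<Longrightarrow> reducible X (a @ [Op u, Op v] @ b)"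
| inside: "reducible X w \<Longrightarrow> reducible X (a @ [Op w] @ b)"

definition irr_words :: "'x::linorder set \<Rightarrow> 'x word set" where
  "irr_words X = {w \<in> ALSW_op X. \<not> reducible X w}"

lemma reducible_append: "reducible X w \<Longrightarrow> reducible X (a @ w @ b)"
proof (induction rule: reducible.cases)
  case (here u v a' b')
  then show ?case using reducible.here[of u X v "a @ a'" "b' @ b"] by simp
next
  case (inside w a' b')
  then show ?case using reducible.inside[of X w "a @ a'" "b' @ b"] by simp
qed

lemma plug_simps [simp]:
  "plug [] v = []" "plug (\<pi> @ \<rho>) v = plug \<pi> v @ plug \<rho> v" "plug [Var None] v = v"
  "plug [Op \<pi>] v = [Op (plug \<pi> v)]"
  by (simp_all add: plug_def wsubst_def)

lemma plug_Cons [simp]: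
  "plug (Var None # \<rho>) v = v @ plug \<rho> v" "plug (Op \<pi> # \<rho>) v = Op (plug \<pi> v) # plug \<rho> v"
  by (simp_all add: plug_def wsubst_def)

lemma plug_emb [simp]: "plug (emb a) v = a"
proof -
  let ?\<sigma> = "lsubst (case_option v (\<lambda>x. [Var x]))"
  have *: "concat (map ?\<sigma> (emb w)) = w" if "\<And>p. p \<in> set w \<Longrightarrow> ?\<sigma> (map_letter Some p) = [p]" for w
    using that by (induction w) auto
  have "?\<sigma> (map_letter Some p) = [p]" for p
  proof (induction p)
    case (Op w)
    then show ?case using *[of w] by simp
  qed simp
  then show ?thesis using * by (simp only: plug_def wsubst_def)
qed

lemma lcount_emb [simp]: "lcount None (map_letter Some p) = 0"
  by (induction p) auto

lemma emb_letters: "p \<in> letters X \<Longrightarrow> map_letter Some p \<in> letters (insert None (Some ` X))"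
  by (induction p) (auto simp: words_iff)

lemma star_words_append:
  assumes "\<pi> \<in> star_words X" "set a \<subseteq> letters X" "set b \<subseteq> letters X"
  shows "emb a @ \<pi> @ emb b \<in> star_words X"
  using assms emb_letters[of _ X] by (auto simp: star_words_def words_iff)

lemma star_words_star: "[Var None] \<in> star_words X"
  by (simp add: star_words_def words_iff)

lemma star_words_Op: "\<pi> \<in> star_words X \<Longrightarrow> [Op \<pi>] \<in> star_words X"
  by (simp add: star_words_def words_Op)

text \<open>If \<open>u\<close> or \<open>v\<close> is itself reducible, the search continues inside
  it, where the degree is smaller. An innermost pattern is reached, and for this reason its
  arguments can be taken irreducible.\<close>

lemma reducible_obtain:
  fixes w :: "'x::wellorder word"
  assumes "reducible X w" "w \<in> words X"
  shows "\<exists>\<pi>\<in>star_words X. \<exists>u\<in>irr_words X. \<exists>v\<in>irr_words X. dl_less v u \<and> w = plug \<pi> [Op u, Op v]"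
  using assms
proof (induction "deg w" arbitrary: w rule: less_induct)
  case less
  have ctx: "\<exists>\<pi>\<in>star_words X. \<exists>u\<in>irr_words X. \<exists>v\<in>irr_words X. dl_less v u \<and> w = plug \<pi> [Op u, Op v]"
    if w: "w = a @ [Op w'] @ b" and red: "reducible X w'" for a w' b
  proof -
    have "w' \<in> words X" "set a \<subseteq> letters X" "set b \<subseteq> letters X"
      using less.prems(2) w by (auto simp: words_iff[of "_ @ _"])
    then obtain \<pi> u v where "\<pi> \<in> star_words X" "u \<in> irr_words X" "v \<in> irr_words X" "dl_less v u"
      "w' = plug \<pi> [Op u, Op v]" using less.hyps[of w'] red w by auto
    then show ?thesis
      using star_words_append[OF star_words_Op[of \<pi> X] \<open>set a \<subseteq> _\<close> \<open>set b \<subseteq> _\<close>] w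
      by - (rule bexI[of _ "emb a @ [Op \<pi>] @ emb b"], rule bexI[of _ u], rule bexI[of _ v], auto)
  qed
  from less.prems(1) show ?case
  proof cases
    case (here u v a b)
    consider "reducible X u" | "reducible X v" | "u \<in> irr_words X" "v \<in> irr_words X"
      using here by (auto simp: irr_words_def)
    then show ?thesis
    proof cases
      case 1
      then show ?thesis using ctx[of a u "[Op v] @ b"] here by simp
    next
      case 2
      then show ?thesis using ctx[of "a @ [Op u]" v b] here by simp
    next
      case 3
      have "set a \<subseteq> letters X" "set b \<subseteq> letters X"
        using less.prems(2) here by (auto simp: words_iff[of "_ @ _"])
      then show ?thesis using 3 here star_words_append[OF star_words_star]
        by - (rule bexI[of _ "emb a @ [Var None] @ emb b"], rule bexI[of _ u], rule bexI[of _ v], auto)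
    qed
  qed (use ctx in auto)
qed

lemma sum_list_eq_1_split:
  fixes f :: "'b \<Rightarrow> nat"
  shows "sum_list (map f xs) = 1 \<Longrightarrow> \<exists>a x b. xs = a @ x # b \<and> f x = 1"
proof (induction xs)
  case (Cons y xs)
  then consider "f y = 1" | "sum_list (map f xs) = 1" by (auto simp: add_is_1)
  then show ?case
  proof cases
    case 1
    then show ?thesis by (intro exI[of _ "[]"] exI[of _ y] exI[of _ xs]) simp
  next
    case 2
    then obtain a x b where "xs = a @ x # b" "f x = 1" using Cons.IH by blast
    then show ?thesis by (intro exI[of _ "y # a"] exI[of _ x] exI[of _ b]) simp
  qed
qed simp

lemma plug_reducible:
  assumes "sum_list (map (lcount None) \<pi>) = 1" "u \<in> ALSW_op X" "v \<in> ALSW_op X" "dl_less v u"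
  shows "reducible X (plug \<pi> [Op u, Op v])"
proof -
  let ?\<sigma> = "case_option [Op u, Op v] (\<lambda>x. [Var x])"
  have *: "reducible X (concat (map (lsubst ?\<sigma>) w))"
    if w: "sum_list (map (lcount None) w) = 1" and p: "\<And>p. p \<in> set w \<Longrightarrow> lcount None p = 1 \<Longrightarrow> reducible X (lsubst ?\<sigma> p)" for w
  proof -
    obtain a x b where "w = a @ x # b" "lcount None x = 1" using sum_list_eq_1_split[OF w] by blast
    then show ?thesis using p[of x] reducible_append by simp
  qed
  have "lcount None p = 1 \<Longrightarrow> reducible X (lsubst ?\<sigma> p)" for p
  proof (induction p)
    case (Var a)
    then show ?case using reducible.here[of u X v "[]" "[]"] assms by (cases a) auto
  next
    case (Op w)
    then have "reducible X (concat (map (lsubst ?\<sigma>) w))" by (intro *) auto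
    then show ?case using reducible.inside[of X _ "[]" "[]"] by simp
  qed
  then show ?thesis using * assms(1) by (simp add: plug_def wsubst_def)
qed

lemma Irr_RB_eq: "Irr_RB X = bracket ` irr_words (X :: 'x::wellorder set)"
proof -
  have "reducible X w \<longleftrightarrow> \<not> (\<forall>\<pi>\<in>star_words X. \<forall>u\<in>ALSW_op X. \<forall>v\<in>ALSW_op X. dl_less v u \<longrightarrow> w \<noteq> plug \<pi> [Op u, Op v])"
    if w: "w \<in> ALSW_op X" for w
  proof
    assume "reducible X w"
    then obtain \<pi> u v where "\<pi> \<in> star_words X" "u \<in> irr_words X" "v \<in> irr_words X" "dl_less v u" "w = plug \<pi> [Op u, Op v]"
      using reducible_obtain[of X w] subsetD[OF ALSW_op_subset_words w] by blast
    then show "\<not> (\<forall>\<pi>\<in>star_words X. \<forall>u\<in>ALSW_op X. \<forall>v\<in>ALSW_op X. dl_less v u \<longrightarrow> w \<noteq> plug \<pi> [Op u, Op v])"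
      by (auto simp: irr_words_def)
  qed (use plug_reducible in \<open>auto simp: star_words_def\<close>)
  then show ?thesis unfolding Irr_RB_def irr_words_def by blast
qed

section \<open>The Rota-Baxter relations\<close>

text \<open>The product \<open>a \<circ> b\<close> of the overview. In a Rota-Baxter Lie algebra it
  is a second Lie bracket, and the operator maps it homomorphically to the original one;
  \<open>rb_form\<close> measures the failure of the latter.\<close>

definition rb_prod :: "'k::field \<Rightarrow> ('x, 'k) opoly \<Rightarrow> ('x, 'k) opoly \<Rightarrow> ('x, 'k) opoly" where
  "rb_prod lam f g = commutator (opP f) g + commutator f (opP g) + scale lam (commutator f g)"

definition rb_form :: "'k::field \<Rightarrow> ('x, 'k) opoly \<Rightarrow> ('x, 'k) opoly \<Rightarrow> ('x, 'k) opoly" where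
  "rb_form lam f g = commutator (opP f) (opP g) - opP (rb_prod lam f g)"

lemma rb_poly_eq: "rb_poly lam u v = rb_form lam (lyndon_elem u) (lyndon_elem v)"
  by (simp add: rb_poly_def rb_form_def rb_prod_def Let_def opP_add opP_scale algebra_simps)

lemma rb_form_bilinear:
  "rb_form lam (f + g) h = rb_form lam f h + rb_form lam g h"
  "rb_form lam h (f + g) = rb_form lam h f + rb_form lam h g"
  "rb_form lam (scale c f) h = scale c (rb_form lam f h)"
  "rb_form lam h (scale c f) = scale c (rb_form lam h f)"
  by (simp_all add: rb_form_def rb_prod_def opP_add opP_scale commutator_simps algebra_simps
      opoly.scale_right_distrib opoly.scale_right_diff_distrib mult.commute)

lemma commutator_swap: "commutator g f = - commutator f g"
  by (simp add: commutator_def)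

lemma opP_minus: "opP (- f) = - opP f"
  using opP_diff[of 0 f] by simp

lemma rb_prod_swap: "rb_prod lam g f = - rb_prod lam f g"
  unfolding rb_prod_def commutator_swap[of "opP g"] commutator_swap[of g] by simp

lemma rb_form_swap: "rb_form lam g f = - rb_form lam f g"
  unfolding rb_form_def rb_prod_swap[of lam g f] commutator_swap[of "opP g"] by (simp add: opP_minus)

lemma rb_form_same: "rb_form lam f f = 0"
proof -
  have "commutator (opP f) f + commutator f (opP f) = 0" by (simp add: commutator_def)
  then show ?thesis by (simp add: rb_form_def rb_prod_def commutator_simps)
qed

lemma commutator_jacobi:
  "commutator (commutator a b) c + commutator (commutator b c) a + commutator (commutator c a) b = 0"
  by (simp add: commutator_def algebra_simps)

text \<open>Once each \<open>opP (rb_prod lam f g)\<close> is replaced by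
  \<open>commutator a b - rb_form lam f g\<close>, the remaining terms cancel by the Jacobi identity
  for commutators in \<open>f\<close>, \<open>g\<close>, \<open>h\<close>, \<open>a\<close>,
  \<open>b\<close>, \<open>c\<close>; only the defects are left.\<close>

lemma rb_prod_jacobi:
  fixes f g h :: "('x, 'k::field) opoly"
  shows
  "rb_prod lam (rb_prod lam f g) h + rb_prod lam (rb_prod lam g h) f + rb_prod lam (rb_prod lam h f) g =
    - (commutator (rb_form lam f g) h + commutator (rb_form lam g h) f + commutator (rb_form lam h f) g)"
proof -
  define a b c where "a = opP f" and "b = opP g" and "c = opP h"
  have P: "opP (rb_prod lam f g) = commutator a b - rb_form lam f g"
    "opP (rb_prod lam g h) = commutator b c - rb_form lam g h"
    "opP (rb_prod lam h f) = commutator c a - rb_form lam h f"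
    by (simp_all add: rb_form_def a_def b_def c_def)
  show ?thesis
    unfolding rb_prod_def[of lam "rb_prod lam _ _"] P
    unfolding rb_prod_def a_def[symmetric] b_def[symmetric] c_def[symmetric]
    by (simp add: commutator_def algebra_simps scale_mult_left scale_mult_right
        opoly.scale_right_distrib opoly.scale_right_diff_distrib)
qed

lemma rb_form_jacobi:
  fixes f g h :: "('x, 'k::field) opoly"
  shows
  "commutator (rb_form lam f g) (opP h) + commutator (rb_form lam g h) (opP f) + commutator (rb_form lam h f) (opP g) =
    opP (commutator (rb_form lam f g) h + commutator (rb_form lam g h) f + commutator (rb_form lam h f) g)
    - (rb_form lam (rb_prod lam f g) h + rb_form lam (rb_prod lam g h) f + rb_form lam (rb_prod lam h f) g)"
proof -
  \<comment> \<open>The inner \<open>commutator (opP (rb_prod lam x y)) (opP z)\<close> is rewritten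
    by \<open>rb_form\<close> a second time. In the cyclic sum the first terms then vanish by
    Jacobi, and the last ones are treated by \<open>rb_prod_jacobi\<close>.\<close>
  have comm: "commutator (rb_form lam x y) (opP z) = commutator (commutator (opP x) (opP y)) (opP z)
      - (rb_form lam (rb_prod lam x y) z + opP (rb_prod lam (rb_prod lam x y) z))" for x y z :: "('x, 'k) opoly"
    by (simp add: rb_form_def commutator_def algebra_simps)
  have "opP (rb_prod lam (rb_prod lam f g) h) + opP (rb_prod lam (rb_prod lam g h) f) + opP (rb_prod lam (rb_prod lam h f) g)
    = - opP (commutator (rb_form lam f g) h + commutator (rb_form lam g h) f + commutator (rb_form lam h f) g)"
    unfolding opP_add[symmetric] opP_minus[symmetric] rb_prod_jacobi ..
  moreover have "commutator (commutator (opP f) (opP g)) (opP h) + commutator (commutator (opP g) (opP h)) (opP f)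
      + commutator (commutator (opP h) (opP f)) (opP g) = 0" by (rule commutator_jacobi)
  moreover have "(x - (r + p)) + (y - (s + q)) + (z - (t + u)) = d - (r + s + t)"
    if "p + q + u = - d" "x + y + z = 0" for x y z r s t p q u d :: "('x, 'k) opoly"
    using that by (simp add: algebra_simps)
  ultimately show ?thesis unfolding comm by blast
qed

section \<open>Degree bounds and the leading words of the relations\<close>

definition deg_le :: "('x, 'k::field) opoly \<Rightarrow> nat \<Rightarrow> bool" where
  "deg_le f n \<longleftrightarrow> (\<forall>v\<in>keys f. deg v \<le> n)"

lemma deg_le_mono: "deg_le f m \<Longrightarrow> m \<le> n \<Longrightarrow> deg_le f n"
  by (auto simp: deg_le_def)

lemma deg_le_add: "deg_le f n \<Longrightarrow> deg_le g n \<Longrightarrow> deg_le (f + g) n"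
  unfolding deg_le_def using keys_add[of f g] by blast

lemma deg_le_scale: "deg_le f n \<Longrightarrow> deg_le (scale c f) n"
  by (auto simp: deg_le_def in_keys_iff)

lemma deg_le_mult: "deg_le f m \<Longrightarrow> deg_le g n \<Longrightarrow> deg_le (f * g) (m + n)"
  unfolding deg_le_def using keys_mult_subset[of _ f g] by (metis add_mono deg_simps(3))

lemma deg_le_commutator:
  assumes "deg_le f m" "deg_le g n"
  shows "deg_le (commutator f g) (m + n)"
  using deg_le_mult[OF assms] deg_le_mult[OF assms(2,1)] keys_diff[of "f * g" "g * f"]
  unfolding deg_le_def commutator_def by (auto simp: add.commute)

lemma deg_le_opP: "deg_le f n \<Longrightarrow> deg_le (opP f) (Suc n)"
  by (auto simp: deg_le_def keys_opP)

lemma deg_le_rb_prod: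
  assumes "deg_le f m" "deg_le g n"
  shows "deg_le (rb_prod lam f g) (Suc (m + n))"
  using deg_le_commutator[OF deg_le_opP[OF assms(1)] assms(2)] deg_le_commutator[OF assms(1) deg_le_opP[OF assms(2)]]
    deg_le_mono[OF deg_le_commutator[OF assms], of "Suc (m + n)"]
  by (auto simp: rb_prod_def intro!: deg_le_add deg_le_scale)

lemma deg_le_lie_elem: "deg_le (lie_elem t) (deg (foliage t))"
proof (induction t)
  case (NBr s t)
  then show ?case using deg_le_commutator by simp
qed (auto simp: deg_le_def keys_opP)

lemma deg_le_lyndon_elem: "u \<in> ALSW_op X \<Longrightarrow> deg_le (lyndon_elem u) (deg (u :: 'x::wellorder word))"
  using deg_le_lie_elem[of "bracket u"] foliage_bracket by metis

lemma leads_deg_le: "leads f w \<Longrightarrow> deg_le f (deg (w :: 'x::wellorder word))"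
  by (auto simp: leads_iff deg_le_def dl_le_deg)

lemma dl_less_length: "deg v \<le> deg w \<Longrightarrow> length v < length w \<Longrightarrow> dl_less v w"
  using dl_deg dl_bre by (metis le_neq_implies_less)

text \<open>All words of \<open>opP f\<close> have breadth one, so a word of breadth two or more and
  no smaller degree exceeds them even when the degrees are equal.\<close>

lemma below_opP_long: "deg_le f n \<Longrightarrow> Suc n \<le> deg w \<Longrightarrow> 2 \<le> length w \<Longrightarrow> below (opP f) w"
  unfolding below_def keys_opP deg_le_def by (auto intro!: dl_less_length)

lemma dl_less_Cons: "prime_less p q \<Longrightarrow> length u = length v \<Longrightarrow> deg (p # u) = deg (q # v) \<Longrightarrow> dl_less (p # u) (q # v)"
  using dl_lex[of "[]"] by simp

lemma decreasing_Op_ALSW: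
  assumes "u \<in> ALSW_op X" "[Op v] @ w \<in> ALSW_op X" "dl_less v (u :: 'x::wellorder word)"
  shows "[Op u, Op v] @ w \<in> ALSW_op X"
proof -
  have "lex_gt prime_gt [Op u] ([Op v] @ w)" using assms(3) by (simp add: prime_gt_iff prime_less_Op)
  then show ?thesis using lyndon.Lyndon_append[of "[Op u]" X "[Op v] @ w"] Op_in_ALSW_op[OF assms(1)] assms(2)
    by (simp add: ALSW_op_eq)
qed

text \<open>The terms under \<open>opP\<close> may reach the degree of \<open>[Op u, Op v]\<close>,
  so it is their breadth one that puts them below; inside the commutator \<open>dl_less v u\<close>
  selects the leading word.\<close>

lemma leads_rb_poly:
  fixes lam :: "'k::field"
  assumes "u \<in> ALSW_op X" "v \<in> ALSW_op X" "dl_less v (u :: 'x::wellorder word)"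
  shows "leads (rb_poly lam u v) [Op u, Op v]"
proof -
  let ?U = "lyndon_elem u :: ('x, 'k) opoly" and ?V = "lyndon_elem v :: ('x, 'k) opoly"
  have "dl_less ([Op v] @ [Op u]) ([Op u] @ [Op v])"
    using assms(3) by (auto intro!: dl_less_Cons simp: prime_less_Op)
  then have "leads (commutator (opP ?U) (opP ?V)) ([Op u] @ [Op v])"
    using assms by (intro leads_commutator leads_opP leads_bracket)
  moreover have "below (opP (rb_prod lam ?U ?V)) [Op u, Op v]"
    using assms by (intro below_opP_long[OF deg_le_rb_prod[OF deg_le_lyndon_elem deg_le_lyndon_elem]]) auto
  ultimately show ?thesis by (simp add: rb_poly_eq rb_form_def leads_diff)
qed

lemma rb_form_lie_polys:
  fixes X :: "'x::wellorder set"
  assumes "f \<in> lie_polys X" "g \<in> lie_polys X"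
  shows "rb_prod lam f g \<in> lie_polys X" "rb_form lam f g \<in> lie_polys X"
proof -
  show "rb_prod lam f g \<in> lie_polys X" using assms
    by (simp add: rb_prod_def lie_polys_opP lie_polys_commutator opoly.subspace_add[OF lie_polys_subspace]
        opoly.subspace_scale[OF lie_polys_subspace])
  then show "rb_form lam f g \<in> lie_polys X" using assms
    by (simp add: rb_form_def lie_polys_opP lie_polys_commutator opoly.subspace_diff[OF lie_polys_subspace])
qed

lemma rb_poly_lie_polys:
  "u \<in> ALSW_op X \<Longrightarrow> v \<in> ALSW_op X \<Longrightarrow> rb_poly lam u v \<in> lie_polys (X :: 'x::wellorder set)"
  by (simp add: rb_poly_eq rb_form_lie_polys lyndon_elem_lie_polys)

section \<open>Rewriting Lyndon-Shirshov words to irreducible ones\<close>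

text \<open>The leading word is an explicit index, so that bounds on it can be stated for whole
  spans; the arguments \<open>u\<close>, \<open>v\<close> are irreducible, as
  \<open>reducible_obtain\<close> supplies them.\<close>

definition rb_special_normal ::
  "'k::field \<Rightarrow> 'x::wellorder set \<Rightarrow> 'x choice \<Rightarrow> 'x word \<Rightarrow> ('x, 'k) opoly \<Rightarrow> bool" where
  "rb_special_normal lam X ch w g \<longleftrightarrow> (\<exists>\<pi>\<in>star_words X. \<exists>u\<in>irr_words X. \<exists>v\<in>irr_words X.
     dl_less v u \<and> w = plug \<pi> [Op u, Op v] \<and> w \<in> ALSW_op X \<and> g = special_normal X ch \<pi> (rb_poly lam u v))"

lemma special_normal_lie_polys:
  fixes X :: "'x::wellorder set" and f :: "('x, 'k::field) opoly"
  assumes "valid_choice X ch" "\<pi> \<in> star_words X" "v \<in> ALSW_op X" "plug \<pi> v \<in> ALSW_op X" "leads f v" "f \<in> lie_polys X"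
  shows "special_normal X ch \<pi> f \<in> lie_polys X"
  using special_normal_in_ideal[OF assms(1-5), of "\<lambda>_. lie_polys X"] assms(6)
    lie_polys_commutator[of _ X] lie_polys_opP[of _ X] lie_elem_lie_polys[of _ X] by blast

text \<open>For reducible \<open>w\<close> a special normal word with the same leading word is
  subtracted; the difference is a Lie polynomial below \<open>w\<close>, hence a combination of
  brackets of smaller words. Confluence does not enter, so the confluence proof may use
  this.\<close>

lemma reduction:
  fixes X :: "'x::wellorder set"
  assumes ch: "valid_choice X ch" and w: "w \<in> ALSW_op X"
  shows "(lyndon_elem w :: ('x, 'k::field) opoly) \<in> opoly.span
    (lyndon_elem ` {u \<in> irr_words X. dl_le u w} \<union> {g. \<exists>v. rb_special_normal lam X ch v g \<and> dl_le v w})"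
  using w
proof (induction w rule: wf_induct_rule[OF wf_dl_less])
  case (1 w)
  let ?S = "\<lambda>w. lyndon_elem ` {u \<in> irr_words X. dl_le u w} \<union> {g :: ('x, 'k) opoly. \<exists>v. rb_special_normal lam X ch v g \<and> dl_le v w}"
  show ?case
  proof (cases "reducible X w")
    case False
    then show ?thesis using 1(2) by (intro opoly.span_base) (auto simp: irr_words_def)
  next
    case True
    then obtain \<pi> u v where \<pi>: "\<pi> \<in> star_words X" and uv: "u \<in> irr_words X" "v \<in> irr_words X" "dl_less v u"
      and w: "w = plug \<pi> [Op u, Op v]" using reducible_obtain ALSW_op_subset_words 1(2) by blast
    define g :: "('x, 'k) opoly" where "g = special_normal X ch \<pi> (rb_poly lam u v)"
    have uvA: "u \<in> ALSW_op X" "v \<in> ALSW_op X" using uv by (auto simp: irr_words_def)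
    then have "[Op u, Op v] \<in> ALSW_op X" using decreasing_Op_ALSW[of u X v "[]"] Op_in_ALSW_op[of v X] uv(3) by simp
    note sn = ch \<pi> this 1(2)[unfolded w] leads_rb_poly[OF uvA uv(3), of lam]
    have "rb_special_normal lam X ch w g" using \<pi> uv w 1(2) unfolding rb_special_normal_def g_def by blast
    then have g: "g \<in> opoly.span (?S w)" by (intro opoly.span_base) auto
    let ?d = "lyndon_elem w - g"
    have d: "?d \<in> lie_polys X"
      unfolding g_def
      by (rule opoly.subspace_diff[OF lie_polys_subspace lyndon_elem_lie_polys[OF 1(2)]
            special_normal_lie_polys[OF sn rb_poly_lie_polys[OF uvA]]])
    have bel: "below ?d w"
      unfolding g_def
      by (rule below_leads_diff[OF leads_bracket[OF 1(2)] leads_special_normal[OF sn, folded w]])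
    have "?d \<in> opoly.span (?S w)"
    proof (cases "?d = 0")
      case True
      show ?thesis unfolding True by (rule opoly.span_zero)
    next
      case False
      from lie_polys_leading_word[OF d False] obtain w' where w': "w' \<in> keys ?d"
        and sp: "?d \<in> opoly.span (lyndon_elem ` {v \<in> ALSW_op X. dl_le v w'})" by blast
      have "dl_less w' w" using bel w' by (auto simp: below_def)
      have "lyndon_elem ` {v \<in> ALSW_op X. dl_le v w'} \<subseteq> opoly.span (?S w)"
      proof
        fix x :: "('x, 'k) opoly" assume "x \<in> lyndon_elem ` {v \<in> ALSW_op X. dl_le v w'}"
        then obtain v where v: "v \<in> ALSW_op X" "dl_le v w'" "x = lyndon_elem v" by blast
        then have vw: "dl_less v w" using \<open>dl_less w' w\<close> dl_le_less_trans by blast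
        then have "x \<in> opoly.span (?S v)" using 1(1)[of v] v by simp
        moreover have "?S v \<subseteq> ?S w" using vw dl_le_trans[of _ v w] by (auto simp: dl_le_def[of v w])
        ultimately show "x \<in> opoly.span (?S w)" using opoly.span_mono by blast
      qed
      then have "opoly.span (lyndon_elem ` {v \<in> ALSW_op X. dl_le v w'}) \<subseteq> opoly.span (?S w)"
        by (intro opoly.span_minimal) auto
      then show ?thesis using sp by blast
    qed
    then have "?d + g \<in> opoly.span (?S w)" using g by (intro opoly.span_add)
    then show ?thesis by simp
  qed
qed

section \<open>The associative ideal of the Rota-Baxter relations\<close>

text \<open>Only irreducible \<open>u\<close> and \<open>v\<close> are admitted in the rewriting steps: the general \<open>f\<^bsub>u,v\<^esub>\<close> turns out
  to lie in the span of these steps, and no inclusion ambiguities arise.\<close>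

inductive rb_red :: "'k::field \<Rightarrow> 'x::linorder set \<Rightarrow> 'x word \<Rightarrow> ('x, 'k) opoly \<Rightarrow> bool" for lam X where
  base: "\<lbrakk>u \<in> irr_words X; v \<in> irr_words X; dl_less v u; set a \<subseteq> letters X; set b \<subseteq> letters X\<rbrakk>
    \<Longrightarrow> rb_red lam X (a @ [Op u, Op v] @ b) (wd a * rb_poly lam u v * wd b)"
| op: "\<lbrakk>rb_red lam X w r; set a \<subseteq> letters X; set b \<subseteq> letters X\<rbrakk>
    \<Longrightarrow> rb_red lam X (a @ [Op w] @ b) (wd a * opP r * wd b)"

lemma leads_wd_mult:
  "leads f w \<Longrightarrow> leads (wd a * f * wd b) (a @ w @ b)" for w :: "'x::wellorder word"
  using leads_mult[OF leads_mult[OF leads_wd[of a]] leads_wd[of b]] by simp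

lemma keys_wd_mult:
  fixes f :: "('x, 'k::field) opoly"
  assumes "keys f \<subseteq> words X" "set a \<subseteq> letters X" "set b \<subseteq> letters X"
  shows "keys (wd a * f * wd b) \<subseteq> words X"
proof
  fix w assume "w \<in> keys (wd a * f * wd b)"
  then obtain v k where "v \<in> keys (wd a * f)" "w = v @ k" "k \<in> keys (wd b :: ('x, 'k) opoly)"
    using keys_mult_subset by blast
  moreover from this(1) obtain k' u where "k' \<in> keys (wd a :: ('x, 'k) opoly)" "u \<in> keys f" "v = k' @ u"
    using keys_mult_subset by blast
  ultimately have w: "w = a @ u @ b" "u \<in> keys f" by (auto split: if_splits)
  then have "u \<in> words X" using assms(1) by blast
  then show "w \<in> words X" using assms(2,3) w by (auto simp: words_iff)
qed

lemma rb_form_zero: "rb_form lam 0 f = 0" "rb_form lam f 0 = 0"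
  by (simp_all add: rb_form_def rb_prod_def commutator_def)

context
  fixes lam :: "'k::field" and X :: "'x::wellorder set"
begin

abbreviation red where "red \<equiv> rb_red lam X"

lemma irr_words_ALSW: "u \<in> irr_words X \<Longrightarrow> u \<in> ALSW_op X"
  by (simp add: irr_words_def)

lemma irr_words_words: "u \<in> irr_words X \<Longrightarrow> u \<in> words X"
  using irr_words_ALSW ALSW_op_subset_words by blast

lemma red_props: "red w r \<Longrightarrow> w \<in> words X \<and> leads r w \<and> reducible X w \<and> keys r \<subseteq> words X"
proof (induction rule: rb_red.induct)
  case (base u v a b)
  then show ?case
    using leads_wd_mult[OF leads_rb_poly[of u X v lam], of a b] irr_words_words[of u] irr_words_words[of v]
      irr_words_ALSW[of u] irr_words_ALSW[of v] reducible.here[of u X v a b]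
      keys_wd_mult[OF lie_polys_words[OF rb_poly_lie_polys[of u X v lam]], of a b]
    by (auto simp: words_iff[of "_ @ _"])
next
  case (op w r a b)
  then show ?case
    using leads_wd_mult[OF leads_opP[of r w], of a b] reducible.inside[of X w a b]
      keys_wd_mult[OF words_closed(4)[of r X], of a b]
    by (auto simp: words_iff[of "_ @ _"])
qed

lemma red_append:
  "red w r \<Longrightarrow> set a \<subseteq> letters X \<Longrightarrow> set b \<subseteq> letters X \<Longrightarrow> red (a @ w @ b) (wd a * r * wd b)"
proof (induction rule: rb_red.cases)
  case (base u v a' b')
  then have "red ((a @ a') @ [Op u, Op v] @ (b' @ b)) (wd (a @ a') * rb_poly lam u v * wd (b' @ b))"
    by (intro rb_red.base) auto
  then show ?case using base by (simp add: mult.assoc flip: wd_mult)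
next
  case (op w r a' b')
  then have "red ((a @ a') @ [Op w] @ (b' @ b)) (wd (a @ a') * opP r * wd (b' @ b))"
    by (intro rb_red.op) auto
  then show ?case using op by (simp add: mult.assoc flip: wd_mult)
qed

lemma red_base: "u \<in> irr_words X \<Longrightarrow> v \<in> irr_words X \<Longrightarrow> dl_less v u \<Longrightarrow> red [Op u, Op v] (rb_poly lam u v)"
  using rb_red.base[of u X v "[]" "[]" lam] by (simp add: wd_Nil)

lemma red_op: "red w r \<Longrightarrow> red [Op w] (opP r)"
  using rb_red.op[of lam X w r "[]" "[]"] by (simp add: wd_Nil)

text \<open>The predicate restricts the leading words of the steps, not the words of their sum. One
  definition thus serves for the degree filtration, for the breadth bound and for everything below a
  given word.\<close>

definition red_span :: "('x word \<Rightarrow> bool) \<Rightarrow> ('x, 'k) opoly set" where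
  "red_span P = opoly.span {r. \<exists>w. red w r \<and> P w}"

lemma red_span_subspace [simp]: "opoly.subspace (red_span P)"
  by (simp add: red_span_def)

lemmas red_span_add = opoly.subspace_add[OF red_span_subspace]
  and red_span_diff = opoly.subspace_diff[OF red_span_subspace]
  and red_span_neg = opoly.subspace_neg[OF red_span_subspace]
  and red_span_scale = opoly.subspace_scale[OF red_span_subspace]
  and red_span_0 = opoly.subspace_0[OF red_span_subspace]

lemma red_spanI: "red w r \<Longrightarrow> P w \<Longrightarrow> r \<in> red_span P"
  unfolding red_span_def by (intro opoly.span_base) auto

lemma red_span_mono: "(\<And>w. P w \<Longrightarrow> Q w) \<Longrightarrow> red_span P \<subseteq> red_span Q"
  unfolding red_span_def by (intro opoly.span_mono) auto

lemma red_span_mult_right: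
  assumes f: "f \<in> red_span P" and g: "\<And>k. k \<in> keys g \<Longrightarrow> set k \<subseteq> letters X"
    and Q: "\<And>k w. k \<in> keys g \<Longrightarrow> P w \<Longrightarrow> Q (w @ k)"
  shows "f * g \<in> red_span Q"
proof -
  have "r * g \<in> red_span Q" if r: "red w r" "P w" for w r
  proof -
    have "r * wd k \<in> red_span Q" if "k \<in> keys g" for k
      using red_append[OF r(1), of "[]" k] Q[OF that r(2)] g[OF that] by (intro red_spanI) (auto simp: wd_Nil)
    then have "(\<Sum>k\<in>keys g. scale (lookup g k) (r * wd k)) \<in> red_span Q"
      by (intro opoly.subspace_sum red_span_subspace red_span_scale)
    then show ?thesis by (subst opoly_expand[of g]) (simp add: sum_distrib_left scale_mult_right)
  qed
  with f show ?thesis unfolding red_span_def[of P]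
    by (induction rule: opoly.span_induct_alt)
      (auto simp: red_span_0 distrib_right scale_mult_left intro!: red_span_add red_span_scale)
qed

lemma red_span_mult_left:
  assumes f: "f \<in> red_span P" and g: "\<And>k. k \<in> keys g \<Longrightarrow> set k \<subseteq> letters X"
    and Q: "\<And>k w. k \<in> keys g \<Longrightarrow> P w \<Longrightarrow> Q (k @ w)"
  shows "g * f \<in> red_span Q"
proof -
  have "g * r \<in> red_span Q" if r: "red w r" "P w" for w r
  proof -
    have "wd k * r \<in> red_span Q" if "k \<in> keys g" for k
      using red_append[OF r(1), of k "[]"] Q[OF that r(2)] g[OF that] by (intro red_spanI) (auto simp: wd_Nil)
    then have "(\<Sum>k\<in>keys g. scale (lookup g k) (wd k * r)) \<in> red_span Q"
      by (intro opoly.subspace_sum red_span_subspace red_span_scale)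
    then show ?thesis by (subst opoly_expand[of g]) (simp add: sum_distrib_right scale_mult_left)
  qed
  with f show ?thesis unfolding red_span_def[of P]
    by (induction rule: opoly.span_induct_alt)
      (auto simp: red_span_0 distrib_left scale_mult_right intro!: red_span_add red_span_scale)
qed

lemma red_span_opP:
  assumes "f \<in> red_span P" "\<And>w. P w \<Longrightarrow> Q [Op w]"
  shows "opP f \<in> red_span Q"
  using assms(1) unfolding red_span_def[of P]
proof (induction rule: opoly.span_induct_alt)
  case (step c r f)
  then obtain w where "red w r" "P w" by blast
  then have "opP r \<in> red_span Q" using red_op assms(2) by (intro red_spanI)
  with step show ?case by (simp add: opP_add opP_scale red_span_add red_span_scale)
qed (simp add: red_span_0)

section \<open>The degree filtration of the rewriting span\<close>

abbreviation red_span_deg :: "nat \<Rightarrow> ('x, 'k) opoly set" where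
  "red_span_deg n \<equiv> red_span (\<lambda>w. deg w \<le> n)"

lemma keys_letters: "keys g \<subseteq> words X \<Longrightarrow> k \<in> keys g \<Longrightarrow> set k \<subseteq> letters X"
  using words_iff by blast

lemma red_span_deg_commutator:
  assumes f: "f \<in> red_span_deg m" and g: "keys g \<subseteq> words X" "deg_le g n"
  shows "commutator f g \<in> red_span_deg (m + n)"
  unfolding commutator_def
proof (rule red_span_diff)
  show "f * g \<in> red_span_deg (m + n)"
    using g(2) by (intro red_span_mult_right[OF f keys_letters[OF g(1)]]) (auto simp: deg_le_def add_mono)
  show "g * f \<in> red_span_deg (m + n)"
    using g(2) by (intro red_span_mult_left[OF f keys_letters[OF g(1)]]) (auto simp: deg_le_def add_mono add.commute)
qed

text \<open>The bridge from Lie to associative rewriting: filling a bracketed context only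
  multiplies by Lie elements and applies the operator, and the degree bound grows by exactly the
  degree of the context.\<close>

lemma rb_special_normal_red_span:
  assumes ch: "valid_choice X ch" and g: "rb_special_normal lam X ch w g"
  shows "g \<in> red_span_deg (deg w)"
proof -
  from g obtain \<pi> u v where \<pi>: "\<pi> \<in> star_words X" and uv: "u \<in> irr_words X" "v \<in> irr_words X" "dl_less v u"
    and w: "w = plug \<pi> [Op u, Op v]" "w \<in> ALSW_op X" and g: "g = special_normal X ch \<pi> (rb_poly lam u v)"
    unfolding rb_special_normal_def by blast
  note uvA = irr_words_ALSW[OF uv(1)] irr_words_ALSW[OF uv(2)]
  have A: "[Op u, Op v] \<in> ALSW_op X"
    using decreasing_Op_ALSW[of u X v "[]"] Op_in_ALSW_op[of v X] uv(3) uvA by simp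
  show ?thesis unfolding g w(1)
  proof (rule special_normal_in_ideal[OF ch \<pi> A w(2)[unfolded w(1)] leads_rb_poly[OF uvA uv(3)], where I = red_span_deg])
    show "rb_poly lam u v \<in> red_span_deg (deg [Op u, Op v])"
      using red_base uv by (intro red_spanI) auto
    show "commutator f (lie_elem t) \<in> red_span_deg (n + deg (foliage t)) \<and>
        commutator (lie_elem t) f \<in> red_span_deg (deg (foliage t) + n)"
      if "f \<in> red_span_deg n" "foliage t \<in> words X" for n f t
    proof -
      have "commutator f (lie_elem t) \<in> red_span_deg (n + deg (foliage t))"
        using that lie_polys_words[OF lie_elem_lie_polys] deg_le_lie_elem by (intro red_span_deg_commutator)
      then show ?thesis using red_span_neg by (metis add.commute commutator_swap)
    qed
    show "opP f \<in> red_span_deg (Suc n)" if "f \<in> red_span_deg n" for n f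
      using that by (rule red_span_opP) simp
  qed
qed

text \<open>By \<open>lie_polys_irr_red\<close> these generators span the Lie polynomials of degree
  at most \<open>n\<close>, so bilinear statements about Lie polynomials reduce to them without loss
  in the degree.\<close>

definition irr_red_gens :: "nat \<Rightarrow> ('x, 'k) opoly set" where
  "irr_red_gens n = lyndon_elem ` {u \<in> irr_words X. deg u \<le> n} \<union> {r. \<exists>w. red w r \<and> deg w \<le> n}"

lemma irr_red_gens_props:
  assumes "f \<in> irr_red_gens n"
  shows "deg_le f n" "keys f \<subseteq> words X"
proof -
  from assms consider u where "f = lyndon_elem u" "u \<in> irr_words X" "deg u \<le> n" | w where "red w f" "deg w \<le> n"
    by (auto simp: irr_red_gens_def)
  then have "deg_le f n \<and> keys f \<subseteq> words X"
  proof cases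
    case 1
    then show ?thesis using deg_le_mono[OF deg_le_lyndon_elem[of u X]] irr_words_ALSW[of u]
        lie_polys_words[OF lyndon_elem_lie_polys[of u X]] by blast
  next
    case 2
    then show ?thesis using red_props[of w f] leads_deg_le[of f w] deg_le_mono by blast
  qed
  then show "deg_le f n" "keys f \<subseteq> words X" by auto
qed

lemma lie_polys_irr_red:
  assumes ch: "valid_choice X ch" and f: "f \<in> lie_polys X" "deg_le f n"
  shows "f \<in> opoly.span (irr_red_gens n)"
proof (cases "f = 0")
  case True
  show ?thesis unfolding True by (rule opoly.span_zero)
next
  case False
  from lie_polys_leading_word[OF f(1) False] obtain w where w: "w \<in> keys f"
    and sp: "f \<in> opoly.span (lyndon_elem ` {v \<in> ALSW_op X. dl_le v w})" by blast
  have wn: "deg w \<le> n" using f(2) w by (auto simp: deg_le_def)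
  have "lyndon_elem v \<in> opoly.span (irr_red_gens n)" if v: "v \<in> ALSW_op X" "dl_le v w" for v
  proof -
    have vn: "deg v \<le> n" using dl_le_deg[OF v(2)] wn by simp
    let ?S = "lyndon_elem ` {u \<in> irr_words X. dl_le u v} \<union> {g. \<exists>w. rb_special_normal lam X ch w g \<and> dl_le w v}"
    have "?S \<subseteq> opoly.span (irr_red_gens n)"
    proof
      fix g assume "g \<in> ?S"
      then consider u where "u \<in> irr_words X" "dl_le u v" "g = lyndon_elem u"
        | u where "rb_special_normal lam X ch u g" "dl_le u v" by blast
      then show "g \<in> opoly.span (irr_red_gens n)"
      proof cases
        case 1
        then show ?thesis using dl_le_deg[OF 1(2)] vn by (intro opoly.span_base) (auto simp: irr_red_gens_def)
      next
        case 2
        have "g \<in> red_span_deg (deg u)" by (rule rb_special_normal_red_span[OF ch 2(1)])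
        moreover have "red_span_deg (deg u) \<subseteq> opoly.span (irr_red_gens n)"
          unfolding red_span_def irr_red_gens_def using dl_le_deg[OF 2(2)] vn by (intro opoly.span_mono) auto
        ultimately show ?thesis by blast
      qed
    qed
    then have "opoly.span ?S \<subseteq> opoly.span (irr_red_gens n)" by (intro opoly.span_minimal) auto
    then show ?thesis using reduction[OF ch v(1), of lam] by blast
  qed
  then have "opoly.span (lyndon_elem ` {v \<in> ALSW_op X. dl_le v w}) \<subseteq> opoly.span (irr_red_gens n)"
    by (intro opoly.span_minimal) auto
  with sp show ?thesis by blast
qed

abbreviation form_bound :: "nat \<Rightarrow> 'x word \<Rightarrow> bool" where
  "form_bound n \<equiv> \<lambda>w. deg w \<le> n \<and> length w \<le> 2"

text \<open>A step applied under the operator is a step of breadth one, and all words of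
  \<open>opP g\<close> have breadth one, so the products of \<open>opP f\<close> and
  \<open>opP g\<close> keep to breadth two. The remaining part lies under \<open>opP\<close> and has
  breadth one.\<close>

lemma rb_form_red_left:
  assumes f: "f \<in> red_span_deg m" and g: "keys g \<subseteq> words X" "deg_le g n"
  shows "rb_form lam f g \<in> red_span (form_bound (m + n + 2))"
proof -
  let ?P = "\<lambda>w. deg w \<le> Suc m \<and> length w = 1"
  have Pf: "opP f \<in> red_span ?P" by (rule red_span_opP[OF f]) simp
  have Pg: "deg k \<le> Suc n \<and> length k = 1 \<and> set k \<subseteq> letters X" if "k \<in> keys (opP g)" for k
    using that g by (auto simp: keys_opP deg_le_def)
  have "opP f * opP g \<in> red_span (form_bound (m + n + 2))" "opP g * opP f \<in> red_span (form_bound (m + n + 2))"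
    using Pg by (intro red_span_mult_right[OF Pf] red_span_mult_left[OF Pf]; fastforce)+
  then have 1: "commutator (opP f) (opP g) \<in> red_span (form_bound (m + n + 2))"
    unfolding commutator_def by (rule red_span_diff)
  have Pf': "opP f \<in> red_span_deg (Suc m)" by (rule red_span_opP[OF f]) simp
  have "commutator (opP f) g \<in> red_span_deg (Suc (m + n))"
    using red_span_deg_commutator[OF Pf' g] by simp
  moreover have "commutator f (opP g) \<in> red_span_deg (Suc (m + n))"
    using red_span_deg_commutator[OF f words_closed(4)[OF g(1)] deg_le_opP[OF g(2)]] by simp
  moreover have "scale lam (commutator f g) \<in> red_span_deg (Suc (m + n))"
    using red_span_deg_commutator[OF f g] red_span_mono[of "\<lambda>w. deg w \<le> m + n" "\<lambda>w. deg w \<le> Suc (m + n)"]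
    by (intro red_span_scale) auto
  ultimately have "rb_prod lam f g \<in> red_span_deg (Suc (m + n))"
    unfolding rb_prod_def by (intro red_span_add)
  then have "opP (rb_prod lam f g) \<in> red_span (form_bound (m + n + 2))" by (rule red_span_opP) simp
  with 1 show ?thesis unfolding rb_form_def by (rule red_span_diff)
qed

lemma rb_form_gens:
  assumes f: "f \<in> irr_red_gens m" and g: "g \<in> irr_red_gens n"
  shows "rb_form lam f g \<in> red_span (form_bound (m + n + 2))"
proof -
  note fp = irr_red_gens_props[OF f] and gp = irr_red_gens_props[OF g]
  consider w where "red w f" "deg w \<le> m" | w where "red w g" "deg w \<le> n"
    | u v where "f = lyndon_elem u" "u \<in> irr_words X" "deg u \<le> m" "g = lyndon_elem v" "v \<in> irr_words X" "deg v \<le> n"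
    using f g unfolding irr_red_gens_def by blast
  then show ?thesis
  proof cases
    case 1
    then show ?thesis using rb_form_red_left[OF red_spanI gp(2,1)] by blast
  next
    case 2
    then have "rb_form lam g f \<in> red_span (form_bound (n + m + 2))"
      using rb_form_red_left[OF red_spanI fp(2,1)] by blast
    from red_span_neg[OF this] show ?thesis
      unfolding rb_form_swap[of lam f g] add.commute[of m n] .
  next
    case 3
    have base: "rb_poly lam u' v' \<in> red_span (form_bound (m + n + 2))"
      if "u' \<in> irr_words X" "v' \<in> irr_words X" "dl_less v' u'" "deg u' + deg v' \<le> m + n" for u' v'
      using red_base[OF that(1-3)] that(4) by (intro red_spanI) auto
    have "u = v \<or> dl_less u v \<or> dl_less v u" using dl_less_total irr_words_words 3 by blast
    then show ?thesis
    proof (elim disjE)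
      assume "u = v"
      then show ?thesis using 3 by (simp add: rb_form_same red_span_0)
    next
      assume "dl_less u v"
      then have "rb_poly lam v u \<in> red_span (form_bound (m + n + 2))" using base[of v u] 3 by simp
      then have "rb_form lam g f \<in> red_span (form_bound (m + n + 2))" using 3 by (simp add: rb_poly_eq)
      from red_span_neg[OF this] show ?thesis unfolding rb_form_swap[of lam f g] .
    next
      assume "dl_less v u"
      then show ?thesis using base[of u v] 3 by (simp add: rb_poly_eq)
    qed
  qed
qed

text \<open>Both arguments are expanded into the bounded generators, one after the other. The result
  covers arguments such as \<open>rb_prod lam f g\<close>, and its breadth bound is what beats a
  word of breadth three in \<open>confluent_overlap\<close>.\<close>

lemma rb_form_red_span:
  assumes ch: "valid_choice X ch"
    and f: "f \<in> lie_polys X" "deg_le f m" and g: "g \<in> lie_polys X" "deg_le g n"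
  shows "rb_form lam f g \<in> red_span (form_bound (m + n + 2))"
proof -
  have *: "rb_form lam a g \<in> red_span (form_bound (m + n + 2))" if a: "a \<in> irr_red_gens m" for a
    using lie_polys_irr_red[OF ch g]
  proof (induction rule: opoly.span_induct_alt)
    case base
    show ?case unfolding rb_form_zero by (rule red_span_0)
  next
    case (step c x y)
    show ?case unfolding rb_form_bilinear
      by (rule red_span_add[OF red_span_scale[OF rb_form_gens[OF a step(1)]] step(2)])
  qed
  from lie_polys_irr_red[OF ch f] show ?thesis
  proof (induction rule: opoly.span_induct_alt)
    case base
    show ?case unfolding rb_form_zero by (rule red_span_0)
  next
    case (step c x y)
    show ?case unfolding rb_form_bilinear by (rule red_span_add[OF red_span_scale[OF *[OF step(1)]] step(2)])
  qed
qed

subsection \<open>Confluence\<close>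

abbreviation red_below :: "'x word \<Rightarrow> ('x, 'k) opoly set" where
  "red_below w \<equiv> red_span (\<lambda>v. dl_less v w)"

lemma red_below_append:
  assumes "f \<in> red_below w" "set a \<subseteq> letters X" "set b \<subseteq> letters X"
  shows "wd a * f * wd b \<in> red_below (a @ w @ b)"
proof -
  have "wd a * f \<in> red_below (a @ w)"
    using assms(2) by (intro red_span_mult_left[OF assms(1)]) (auto split: if_splits intro: dl_less_append_left)
  then have "wd a * f * wd b \<in> red_below ((a @ w) @ b)"
    by (rule red_span_mult_right) (use assms(3) dl_less_append_right[of _ "a @ w" b] in \<open>auto split: if_splits\<close>)
  then show ?thesis by simp
qed

lemma red_below_mult_right:
  assumes r: "red c r" and s: "below s w" "keys s \<subseteq> words X"
  shows "r * s \<in> red_below (c @ w)"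
  by (rule red_span_mult_right[OF red_spanI[of c r "\<lambda>v. v = c", OF r refl] keys_letters[OF s(2)]])
    (use s(1) in \<open>auto simp: below_def intro: dl_less_append_left\<close>)

lemma red_below_mult_left:
  assumes r: "red c r" and s: "below s w" "keys s \<subseteq> words X"
  shows "s * r \<in> red_below (w @ c)"
  by (rule red_span_mult_left[OF red_spanI[of c r "\<lambda>v. v = c", OF r refl] keys_letters[OF s(2)]])
    (use s(1) in \<open>auto simp: below_def intro: dl_less_append_right\<close>)

lemma red_tail:
  assumes "red c r"
  shows "below (r - wd c) c" "keys (r - wd c) \<subseteq> words X"
  using red_props[OF assms] keys_diff[of r "wd c"] by (auto simp: leads_def split: if_splits)

text \<open>The difference equals \<open>(r - wd c) * wd b * r' - r * wd b * (r' - wd c')\<close>: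
  in each product one factor is still a step while the other has lost its leading word.\<close>

lemma confluent_disjoint:
  assumes r: "red c r" and r': "red c' r'" and b: "set b \<subseteq> letters X"
  shows "r * wd (b @ c') - wd (c @ b) * r' \<in> red_below (c @ b @ c')"
proof -
  have "r * (wd b * (r' - wd c')) \<in> red_below (c @ b @ c')"
  proof (rule red_below_mult_right[OF r])
    show "below (wd b * (r' - wd c')) (b @ c')" by (rule below_mult_right[OF leads_wd red_tail(1)[OF r']])
    show "keys (wd b * (r' - wd c')) \<subseteq> words X"
      using keys_wd_mult[OF red_tail(2)[OF r'] b, of "[]"] by (simp add: wd_Nil)
  qed
  moreover have "((r - wd c) * wd b) * r' \<in> red_below ((c @ b) @ c')"
  proof (rule red_below_mult_left[OF r'])
    show "below ((r - wd c) * wd b) (c @ b)" using below_mult[OF red_tail(1)[OF r]] leads_wd by blast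
    show "keys ((r - wd c) * wd b) \<subseteq> words X"
      using keys_wd_mult[OF red_tail(2)[OF r] _ b, of "[]"] by (simp add: wd_Nil)
  qed
  ultimately have "((r - wd c) * wd b) * r' - r * (wd b * (r' - wd c')) \<in> red_below (c @ b @ c')"
    using red_span_diff by simp
  then show ?thesis by (simp add: algebra_simps flip: wd_mult)
qed

lemma confluent_overlap:
  assumes ch: "valid_choice X ch"
    and u: "u \<in> irr_words X" and v: "v \<in> irr_words X" and z: "z \<in> irr_words X"
    and vu: "dl_less v u" and zv: "dl_less z v"
  shows "rb_poly lam u v * wd [Op z] - wd [Op u] * rb_poly lam v z \<in> red_below [Op u, Op v, Op z]"
proof -
  let ?w = "[Op u, Op v, Op z]"
  define U V Z where "U = (lyndon_elem u :: ('x, 'k) opoly)" and "V = (lyndon_elem v :: ('x, 'k) opoly)"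
    and "Z = (lyndon_elem z :: ('x, 'k) opoly)"
  define F G H where "F = rb_form lam U V" and "G = rb_form lam V Z" and "H = rb_form lam U Z"
  have zu: "dl_less z u" using zv vu by (rule dl_less_trans)
  note A = irr_words_ALSW[OF u] irr_words_ALSW[OF v] irr_words_ALSW[OF z]
  have lie: "U \<in> lie_polys X" "V \<in> lie_polys X" "Z \<in> lie_polys X"
    using A lyndon_elem_lie_polys by (auto simp: U_def V_def Z_def)
  have dg: "deg_le U (deg u)" "deg_le V (deg v)" "deg_le Z (deg z)"
    using A deg_le_lyndon_elem by (auto simp: U_def V_def Z_def)
  have Pl: "leads (opP U) [Op u]" "leads (opP V) [Op v]" "leads (opP Z) [Op z]"
    unfolding U_def V_def Z_def using A by (auto intro!: leads_opP leads_bracket)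
  have Pw: "keys (opP U) \<subseteq> words X" "keys (opP V) \<subseteq> words X" "keys (opP Z) \<subseteq> words X"
    using lie lie_polys_words words_closed(4) by blast+
  have rF: "red [Op u, Op v] F" and rG: "red [Op v, Op z] G" and rH: "red [Op u, Op z] H"
    using red_base[OF u v vu] red_base[OF v z zv] red_base[OF u z zu]
    by (simp_all add: F_def G_def H_def U_def V_def Z_def rb_poly_eq)
  have R: "r * p \<in> red_below ?w" if "red c r" "leads p q" "keys p \<subseteq> words X" "dl_less (c @ q) ?w" for c r p q
  proof (rule red_span_mult_right[OF red_spanI[of c r "\<lambda>v. v = c", OF that(1) refl] keys_letters[OF that(3)]])
    fix k v assume "k \<in> keys p" "v = c"
    then have "dl_le (v @ k) (c @ q)"
      using that(2) dl_less_append_left[of k q c] by (auto simp: leads_iff dl_le_def)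
    then show "dl_less (v @ k) ?w" using that(4) by (rule dl_le_less_trans)
  qed
  have L: "p * r \<in> red_below ?w" if "red c r" "leads p q" "keys p \<subseteq> words X" "dl_less (q @ c) ?w" for c r p q
  proof (rule red_span_mult_left[OF red_spanI[of c r "\<lambda>v. v = c", OF that(1) refl] keys_letters[OF that(3)]])
    fix k v assume "k \<in> keys p" "v = c"
    then have "dl_le (k @ v) (q @ c)"
      using that(2) dl_less_append_right[of k q c] by (auto simp: leads_iff dl_le_def)
    then show "dl_less (k @ v) ?w" using that(4) by (rule dl_le_less_trans)
  qed
  \<comment> \<open>The letters of \<open>?w\<close> decrease, so its other arrangements are smaller
    words. Those here and in \<open>less'\<close> are the leading words of the four unwanted
    products when the cyclic sum of commutators is expanded.\<close>
  have less: "dl_less ([Op z] @ [Op u, Op v]) ?w" "dl_less ([Op v, Op z] @ [Op u]) ?w"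
    "dl_less ([Op v] @ [Op u, Op z]) ?w"
    using vu zv zu by (auto intro!: dl_less_Cons simp: prime_less_Op)
  have "dl_less ([Op u] @ [Op z, Op v]) ([Op u] @ [Op v, Op z])"
    using zv by (intro dl_less_append_left dl_less_Cons) (auto simp: prime_less_Op)
  then have less': "dl_less ([Op u, Op z] @ [Op v]) ?w" by simp
  have tail: "keys (p - wd q) \<subseteq> words X" if "keys p \<subseteq> words X" "q \<in> words X" for p :: "('x, 'k) opoly" and q
  proof -
    have "keys (wd q :: ('x, 'k) opoly) \<subseteq> {q}" by simp
    then show ?thesis using keys_diff[of p "wd q"] that by blast
  qed
  have t1: "F * (opP Z - wd [Op z]) \<in> red_below ?w"
    using red_below_mult_right[OF rF _ tail[OF Pw(3)], of "[Op z]" "[Op z]"] Pl(3) irr_words_words[OF z]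
    by (simp add: leads_def words_Op)
  have t2: "(opP U - wd [Op u]) * G \<in> red_below ?w"
    using red_below_mult_left[OF rG _ tail[OF Pw(1)], of "[Op u]" "[Op u]"] Pl(1) irr_words_words[OF u]
    by (simp add: leads_def words_Op)
  have t3: "opP Z * F \<in> red_below ?w" by (rule L[OF rF Pl(3) Pw(3) less(1)])
  have t4: "G * opP U \<in> red_below ?w" by (rule R[OF rG Pl(1) Pw(1) less(2)])
  have t5: "H * opP V \<in> red_below ?w" by (rule R[OF rH Pl(2) Pw(2) less'])
  have t6: "opP V * H \<in> red_below ?w" by (rule L[OF rH Pl(2) Pw(2) less(3)])
  have short: "red_span (form_bound n) \<subseteq> red_below ?w" if "n \<le> deg ?w" for n
    using that by (intro red_span_mono) (auto intro!: dl_less_length)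
  \<comment> \<open>The degree bound \<open>Suc (i + j) + k + 2\<close> is exactly the degree of
    \<open>?w\<close>, so it is the breadth, two against three, that makes these terms
    smaller.\<close>
  have form: "rb_form lam (rb_prod lam a b) c \<in> red_below ?w"
    if "a \<in> lie_polys X" "deg_le a i" "b \<in> lie_polys X" "deg_le b j" "c \<in> lie_polys X" "deg_le c k"
      "i + j + k = deg u + deg v + deg z" for a b c i j k
    using rb_form_red_span[OF ch rb_form_lie_polys(1)[OF that(1,3)] deg_le_rb_prod[OF that(2,4)] that(5,6), of lam]
      short[of "Suc (i + j) + k + 2"] that(7) by auto
  have inner: "opP (commutator (rb_form lam a b) c) \<in> red_below ?w"
    if "a \<in> lie_polys X" "deg_le a i" "b \<in> lie_polys X" "deg_le b j" "c \<in> lie_polys X" "deg_le c k"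
      "i + j + k = deg u + deg v + deg z" for a b c i j k
  proof -
    have "rb_form lam a b \<in> red_span_deg (i + j + 2)"
      using rb_form_red_span[OF ch that(1-4)] red_span_mono[of "form_bound (i + j + 2)" "\<lambda>w. deg w \<le> i + j + 2"] by auto
    then have "commutator (rb_form lam a b) c \<in> red_span_deg (i + j + 2 + k)"
      using red_span_deg_commutator lie_polys_words[OF that(5)] that(6) by blast
    then show ?thesis by (rule red_span_opP) (use that(7) in \<open>auto intro!: dl_less_length\<close>)
  qed
  have t7: "rb_form lam (rb_prod lam U V) Z + rb_form lam (rb_prod lam V Z) U + rb_form lam (rb_prod lam Z U) V \<in> red_below ?w"
    by (intro red_span_add form[OF lie(1) dg(1) lie(2) dg(2) lie(3) dg(3)] form[OF lie(2) dg(2) lie(3) dg(3) lie(1) dg(1)]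
        form[OF lie(3) dg(3) lie(1) dg(1) lie(2) dg(2)]) simp_all
  have t8: "opP (commutator F Z + commutator G U + commutator (rb_form lam Z U) V) \<in> red_below ?w"
    unfolding opP_add F_def G_def
    by (intro red_span_add inner[OF lie(1) dg(1) lie(2) dg(2) lie(3) dg(3)] inner[OF lie(2) dg(2) lie(3) dg(3) lie(1) dg(1)]
        inner[OF lie(3) dg(3) lie(1) dg(1) lie(2) dg(2)]) simp_all
  \<comment> \<open>The cyclic sum is added and its unwanted products are taken away again, as are
    the lower terms of \<open>opP Z\<close> and \<open>opP U\<close>. The third form appears as
    \<open>- H\<close>, since a step exists only for the larger argument \<open>u\<close> in front
    of \<open>z\<close>.\<close>
  have "F * wd [Op z] - wd [Op u] * G =
      - (F * (opP Z - wd [Op z])) + opP Z * F - G * opP U + (opP U - wd [Op u]) * G + H * opP V - opP V * H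
      + (commutator F (opP Z) + commutator G (opP U) + commutator (rb_form lam Z U) (opP V))"
    unfolding rb_form_swap[of lam Z U] H_def[symmetric] by (simp add: commutator_def algebra_simps)
  also have "\<dots> = - (F * (opP Z - wd [Op z])) + opP Z * F - G * opP U + (opP U - wd [Op u]) * G + H * opP V - opP V * H
      + (opP (commutator F Z + commutator G U + commutator (rb_form lam Z U) V)
        - (rb_form lam (rb_prod lam U V) Z + rb_form lam (rb_prod lam V Z) U + rb_form lam (rb_prod lam Z U) V))"
    unfolding F_def G_def rb_form_jacobi ..
  also have "\<dots> \<in> red_below ?w"
    by (intro red_span_add red_span_diff red_span_neg t1 t2 t3 t4 t5 t6 t7 t8)
  finally show ?thesis by (simp add: F_def G_def U_def V_def Z_def rb_poly_eq)
qed

text \<open>A step stripped of its outer factors. Its word has breadth one or two, which leaves very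
  few ways for two cores to overlap.\<close>

definition red_core :: "'x word \<Rightarrow> ('x, 'k) opoly \<Rightarrow> bool" where
  "red_core c r \<longleftrightarrow> (\<exists>u\<in>irr_words X. \<exists>v\<in>irr_words X. dl_less v u \<and> c = [Op u, Op v] \<and> r = rb_poly lam u v)
     \<or> (\<exists>w s. red w s \<and> c = [Op w] \<and> r = opP s)"

lemma red_core_red: "red_core c r \<Longrightarrow> red c r"
  using red_base red_op by (auto simp: red_core_def)

lemma red_coreE:
  assumes "red w r"
  obtains a b c s where "w = a @ c @ b" "r = wd a * s * wd b" "red_core c s" "set a \<subseteq> letters X" "set b \<subseteq> letters X"
  using assms
proof cases
  case (base u v a b)
  then show ?thesis by (intro that[of a "[Op u, Op v]" b "rb_poly lam u v"]) (auto simp: red_core_def)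
next
  case (op w' s a b)
  then show ?thesis by (intro that[of a "[Op w']" b "opP s"]) (auto simp: red_core_def)
qed

text \<open>The reason why inclusion ambiguities do not arise: the arguments \<open>u\<close> and
  \<open>v\<close> of a base step admit no step themselves.\<close>

lemma irr_not_red: "u \<in> irr_words X \<Longrightarrow> \<not> red u r"
  using red_props[of u r] by (auto simp: irr_words_def)

lemma confluent_core:
  assumes ch: "valid_choice X ch" and c: "red_core c r" and c': "red_core c' r'"
    and eq: "c @ b = x @ c' @ b'" and X: "set b \<subseteq> letters X" "set x \<subseteq> letters X" "set b' \<subseteq> letters X"
    and IH: "\<And>w s s'. red w s \<Longrightarrow> red w s' \<Longrightarrow> deg w < deg (c @ b) \<Longrightarrow> s - s' \<in> red_below w"
  shows "r * wd b - wd x * r' * wd b' \<in> red_below (c @ b)"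
proof -
  \<comment> \<open>With \<open>c\<close> starting no later than \<open>c'\<close>, the second core
    starts at the same letter, after the end of \<open>c\<close>, or at the second letter of
    \<open>c\<close>; the last is possible only for a base step.\<close>
  consider "x = []" | y where "x = c @ y" | u v where "x = [Op u]" "c = [Op u, Op v]"
    "u \<in> irr_words X" "v \<in> irr_words X" "dl_less v u" "r = rb_poly lam u v"
  proof (cases "length c \<le> length x")
    case True
    then have "x = c @ drop (length c) x" using eq by (metis append_eq_append_conv_if append_take_drop_id)
    then show ?thesis using that(2) by blast
  next
    case False
    with c eq show ?thesis
      by (auto simp: red_core_def Cons_eq_append_conv intro: that)
  qed
  then show ?thesis
  proof cases
    case 1
    with eq have eq: "c @ b = c' @ b'" by simp
    from c show ?thesis unfolding red_core_def
    proof (elim disjE bexE conjE exE)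
      fix u v assume uv: "u \<in> irr_words X" "c = [Op u, Op v]" "r = rb_poly lam u v"
      from c' have "c' = c \<and> r' = r \<and> b' = b"
        unfolding red_core_def
      proof (elim disjE bexE conjE exE)
        fix u' v' assume "c' = [Op u', Op v']" "r' = rb_poly lam u' v'"
        then show ?thesis using eq uv by simp
      next
        fix w s assume "red w s" "c' = [Op w]"
        moreover from this have "w = u" using eq uv by simp
        ultimately show ?thesis using irr_not_red[OF uv(1)] by blast
      qed
      then show ?thesis using 1 by (simp add: wd_Nil red_span_0)
    next
      \<comment> \<open>Both steps turn out to act inside the same operator letter. The induction
        hypothesis for its argument, which has smaller degree, is lifted through
        \<open>opP\<close>.\<close>
      fix w s assume w: "red w s" "c = [Op w]" "r = opP s"
      from c' have "b' = b \<and> (\<exists>s'. red w s' \<and> r' = opP s')"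
        unfolding red_core_def
      proof (elim disjE bexE conjE exE)
        fix u v assume "u \<in> irr_words X" "c' = [Op u, Op v]"
        moreover from this have "w = u" using eq w by simp
        ultimately show ?thesis using irr_not_red w by blast
      next
        fix w' s' assume "red w' s'" "c' = [Op w']" "r' = opP s'"
        then show ?thesis using eq w by auto
      qed
      then obtain s' where s': "b' = b" "red w s'" "r' = opP s'" by blast
      have "s - s' \<in> red_below w" using IH[OF w(1) s'(2)] w(2) by simp
      then have "opP (s - s') \<in> red_below c"
        unfolding w(2) by (rule red_span_opP) (simp add: dl_less_single prime_less_Op)
      from red_below_append[OF this, of "[]" b] X show ?thesis
        using 1 s' w by (simp add: wd_Nil opP_diff algebra_simps)
    qed
  next
    case (2 y)
    then have b: "b = y @ c' @ b'" using eq by simp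
    have "r * wd (y @ c') - wd (c @ y) * r' \<in> red_below (c @ y @ c')"
      using confluent_disjoint[OF red_core_red[OF c] red_core_red[OF c']] X 2 by simp
    from red_below_append[OF this, of "[]" b'] X show ?thesis
      unfolding 2 b by (simp add: wd_Nil algebra_simps flip: wd_mult)
  next
    case (3 u v)
    then have eq: "Op v # b = c' @ b'" using eq by simp
    from c' have "\<exists>z\<in>irr_words X. dl_less z v \<and> c' = [Op v, Op z] \<and> r' = rb_poly lam v z"
      unfolding red_core_def
    proof (elim disjE bexE conjE exE)
      fix u' z assume z: "z \<in> irr_words X" "dl_less z u'" "c' = [Op u', Op z]" "r' = rb_poly lam u' z"
      moreover have "u' = v" using eq z(3) by simp
      ultimately show ?thesis by blast
    next
      fix w s assume "red w s" "c' = [Op w]"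
      moreover from this have "w = v" using eq by simp
      ultimately show ?thesis using irr_not_red[OF 3(4)] by blast
    qed
    then obtain z where z: "z \<in> irr_words X" "dl_less z v" "c' = [Op v, Op z]" "r' = rb_poly lam v z"
      by blast
    then have b: "b = Op z # b'" using eq by simp
    from red_below_append[OF confluent_overlap[OF ch 3(3,4) z(1) 3(5) z(2)], of "[]" b'] X
    have "(r * wd [Op z] - wd [Op u] * r') * wd b' \<in> red_below (c @ b)"
      by (simp add: wd_Nil 3 z b)
    moreover have "wd [Op z] * wd b' = (wd b :: ('x, 'k) opoly)" by (simp add: wd_mult b)
    ultimately show ?thesis using 3(1) by (simp add: algebra_simps)
  qed
qed

lemma confluent:
  assumes ch: "valid_choice X ch"
  shows "red w r \<Longrightarrow> red w r' \<Longrightarrow> r - r' \<in> red_below w"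
proof (induction "deg w" arbitrary: w r r' rule: less_induct)
  case less
  have aux: "wd a * s * wd b - wd (a @ x) * s' * wd b' \<in> red_below w"
    if "w = a @ c @ b" "red_core c s" "red_core c' s'" "c @ b = x @ c' @ b'"
      "set a \<subseteq> letters X" "set b \<subseteq> letters X" "set x \<subseteq> letters X" "set b' \<subseteq> letters X" for a b c s x b' c' s'
  proof -
    have "s * wd b - wd x * s' * wd b' \<in> red_below (c @ b)"
      using that(4,6-8) by (intro confluent_core[OF ch that(2,3)]) (auto intro!: less.hyps simp: that(1))
    from red_below_append[OF this that(5), of "[]"] show ?thesis
      by (simp add: wd_Nil that(1) algebra_simps flip: wd_mult)
  qed
  obtain a b c s where 1: "w = a @ c @ b" "r = wd a * s * wd b" "red_core c s" "set a \<subseteq> letters X" "set b \<subseteq> letters X"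
    using red_coreE[OF less.prems(1)] .
  obtain a' b' c' s' where 2: "w = a' @ c' @ b'" "r' = wd a' * s' * wd b'" "red_core c' s'"
    "set a' \<subseteq> letters X" "set b' \<subseteq> letters X"
    using red_coreE[OF less.prems(2)] .
  have "a @ (c @ b) = a' @ (c' @ b')" using 1(1) 2(1) by simp
  then show ?case
  proof (cases rule: append_eq_cases)
    case (left x)
    then have "r' - r \<in> red_below w"
      using aux[of a' c' b' s' c s x b] 1 2 by simp
    from red_span_neg[OF this] show ?thesis by simp
  next
    case (right x)
    then show ?thesis using aux[of a c b s c' s' x b'] 1 2 by simp
  qed
qed

lemma red_span_leading_word:
  assumes ch: "valid_choice X ch" and f: "f \<in> red_span (\<lambda>_. True)" "f \<noteq> 0"
  obtains w where "reducible X w" "w \<in> keys f" "\<And>v. v \<in> keys f \<Longrightarrow> dl_le v w"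
proof (rule diamond[of red X f])
  show "w \<in> words X \<and> leads r w" if "red w r" for w r using red_props[OF that] by blast
  show "r - r' \<in> opoly.span {s. \<exists>v. red v s \<and> dl_less v w}" if "red w r" "red w r'" for w r r'
    using confluent[OF ch that] by (simp add: red_span_def)
  show "f \<in> opoly.span {r. \<exists>w. red w r}" using f(1) by (simp add: red_span_def)
qed (use f(2) that red_props in blast)+

lemma rb_poly_red_span:
  assumes ch: "valid_choice X ch" and "u \<in> ALSW_op X" "v \<in> ALSW_op X"
  shows "rb_poly lam u v \<in> red_span (\<lambda>_. True)"
  using rb_form_red_span[OF ch lyndon_elem_lie_polys deg_le_lyndon_elem lyndon_elem_lie_polys deg_le_lyndon_elem,
      of u X v X] assms red_span_mono[of _ "\<lambda>_. True"] by (auto simp: rb_poly_eq)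

end

section \<open>The Rota-Baxter ideal\<close>

context
  fixes lam :: "'k::field" and X :: "'x::wellorder set"
begin

abbreviation lie_set :: "('x, 'k) opoly set" where "lie_set \<equiv> lie_polys X"

abbreviation rb_ideal :: "('x, 'k) opoly set" where "rb_ideal \<equiv> RBL_ideal lam X"

lemma lie_set_subspace: "opoly.subspace lie_set"
  by (rule lie_polys_subspace)

lemma lie_op_ideal_iff:
  "lie_op_ideal I (opoly_lie lie_set) \<longleftrightarrow> I \<subseteq> lie_set \<and> opoly.subspace I \<and>
     (\<forall>f\<in>lie_set. \<forall>g\<in>I. commutator f g \<in> I \<and> commutator g f \<in> I) \<and> (\<forall>g\<in>I. opP g \<in> I)"
  using submodule_opoly[OF lie_op_algebra_lie_polys[of X], of I] by (simp add: lie_op_ideal_def)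

lemma rb_relations_lie_set: "rb_relations lam X \<subseteq> lie_set"
  using rb_poly_lie_polys by (auto simp: rb_relations_def)

lemma rb_ideal_eq: "rb_ideal = \<Inter>{I. lie_op_ideal I (opoly_lie lie_set) \<and> rb_relations lam X \<subseteq> I}"
  by (simp add: RBL_ideal_def generated_ideal_def hull_def free_lie_op_eq)

lemma rb_ideal_minimal:
  "lie_op_ideal I (opoly_lie lie_set) \<Longrightarrow> rb_relations lam X \<subseteq> I \<Longrightarrow> rb_ideal \<subseteq> I"
  unfolding rb_ideal_eq by blast

lemma rb_relations_rb_ideal: "rb_relations lam X \<subseteq> rb_ideal"
  unfolding rb_ideal_eq by blast

lemma lie_op_ideal_lie_set: "lie_op_ideal lie_set (opoly_lie lie_set)"
  by (simp add: lie_op_ideal_iff lie_set_subspace lie_polys_commutator lie_polys_opP)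

lemma rb_ideal_subset: "rb_ideal \<subseteq> lie_set"
  by (rule rb_ideal_minimal[OF lie_op_ideal_lie_set rb_relations_lie_set])

lemma rb_ideal_subspace: "opoly.subspace rb_ideal"
  unfolding rb_ideal_eq by (rule opoly.subspace_Inter) (auto simp: lie_op_ideal_iff)

lemma rb_ideal_commutator:
  "f \<in> lie_set \<Longrightarrow> g \<in> rb_ideal \<Longrightarrow> commutator f g \<in> rb_ideal"
  "f \<in> lie_set \<Longrightarrow> g \<in> rb_ideal \<Longrightarrow> commutator g f \<in> rb_ideal"
  unfolding rb_ideal_eq lie_op_ideal_iff by auto

lemma rb_ideal_opP: "g \<in> rb_ideal \<Longrightarrow> opP g \<in> rb_ideal"
  unfolding rb_ideal_eq lie_op_ideal_iff by auto

text \<open>Relations are imposed for \<open>dl_less v u\<close> only; antisymmetry of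
  \<open>rb_form\<close> and its vanishing on equal arguments supply the other cases.\<close>

lemma rb_poly_rb_ideal:
  assumes "u \<in> ALSW_op X" "v \<in> ALSW_op X" shows "rb_poly lam u v \<in> rb_ideal"
proof -
  have *: "rb_poly lam u v \<in> rb_ideal" if "u \<in> ALSW_op X" "v \<in> ALSW_op X" "dl_less v u" for u v
    using rb_relations_rb_ideal that by (auto simp: rb_relations_def)
  have "u = v \<or> dl_less u v \<or> dl_less v u" using dl_less_total ALSW_op_subset_words assms by blast
  then show ?thesis
  proof (elim disjE)
    assume "u = v"
    then show ?thesis using opoly.subspace_0[OF rb_ideal_subspace] by (simp add: rb_poly_eq rb_form_same)
  next
    assume "dl_less u v"
    then have "- rb_poly lam v u \<in> rb_ideal" using * assms opoly.subspace_neg[OF rb_ideal_subspace] by blast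
    then show ?thesis unfolding rb_poly_eq rb_form_swap[of lam "lyndon_elem u"] .
  qed (use * assms in blast)
qed

lemma lie_set_induct [consumes 1, case_names zero lyndon add]:
  assumes "f \<in> lie_set" "P 0" "\<And>u. u \<in> ALSW_op X \<Longrightarrow> P (lyndon_elem u)"
    "\<And>c f g. f \<in> lie_set \<Longrightarrow> g \<in> lie_set \<Longrightarrow> P f \<Longrightarrow> P g \<Longrightarrow> P (scale c f + g)"
  shows "P f"
proof -
  have "f \<in> lie_set \<and> P f" using assms(1) unfolding lie_polys_def
  proof (induction rule: opoly.span_induct_alt)
    case base
    then show ?case using assms(2) by (simp add: opoly.span_zero)
  next
    case (step c x y)
    then obtain u where u: "u \<in> ALSW_op X" "x = lyndon_elem u" by blast
    then have "x \<in> lie_set" "P x" using lyndon_elem_lie_polys assms(3) by auto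
    then have "P (scale c x + y)" using step assms(4) by (simp add: lie_polys_def)
    moreover have "scale c x + y \<in> lie_set"
      using \<open>x \<in> lie_set\<close> step opoly.subspace_add[OF lie_set_subspace] opoly.subspace_scale[OF lie_set_subspace]
      by (simp add: lie_polys_def)
    ultimately show ?case by (simp add: lie_polys_def)
  qed
  then show ?thesis by blast
qed

lemma rb_form_rb_ideal:
  assumes "f \<in> lie_set" "g \<in> lie_set" shows "rb_form lam f g \<in> rb_ideal"
proof -
  note sub = rb_ideal_subspace
  have "rb_form lam (lyndon_elem u) g \<in> rb_ideal" if "u \<in> ALSW_op X" for u
    using assms(2) by (induction rule: lie_set_induct)
      (use rb_poly_rb_ideal[OF that] in \<open>auto simp: rb_form_zero rb_form_bilinear rb_poly_eq
        intro!: opoly.subspace_0[OF sub] opoly.subspace_add[OF sub] opoly.subspace_scale[OF sub]\<close>)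
  with assms(1) show ?thesis by (induction rule: lie_set_induct)
      (auto simp: rb_form_zero rb_form_bilinear
        intro!: opoly.subspace_0[OF sub] opoly.subspace_add[OF sub] opoly.subspace_scale[OF sub])
qed

lemma special_normal_rb_ideal:
  assumes "valid_choice X ch" "\<pi> \<in> star_words X" "v \<in> ALSW_op X" "plug \<pi> v \<in> ALSW_op X" "leads f v" "f \<in> rb_ideal"
  shows "special_normal X ch \<pi> f \<in> rb_ideal"
  using special_normal_in_ideal[OF assms(1-5), of "\<lambda>_. rb_ideal"] assms(6)
    rb_ideal_commutator rb_ideal_opP lie_elem_lie_polys[of _ X] by blast

text \<open>The rewriting span is closed under the operator and under multiplication by Lie
  polynomials on both sides. Its Lie polynomials thus form a Lie ideal, which contains the
  relations; minimality of the generated ideal gives the inclusion.\<close>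

lemma rb_ideal_red_span:
  assumes ch: "valid_choice X ch" shows "rb_ideal \<subseteq> red_span lam X (\<lambda>_. True)"
proof -
  let ?R = "red_span lam X (\<lambda>_. True)"
  have mult: "f * g \<in> ?R" "g * f \<in> ?R" if "f \<in> ?R" "g \<in> lie_set" for f g
    using that keys_letters[OF lie_polys_words[OF that(2)]]
    by (auto intro: red_span_mult_right red_span_mult_left)
  have "lie_op_ideal (?R \<inter> lie_set) (opoly_lie lie_set)"
    unfolding lie_op_ideal_iff
  proof (intro conjI ballI)
    show "opoly.subspace (?R \<inter> lie_set)" by (intro opoly.subspace_inter red_span_subspace lie_set_subspace)
    show "opP g \<in> ?R \<inter> lie_set" if "g \<in> ?R \<inter> lie_set" for g
      using that lie_polys_opP by (auto intro: red_span_opP)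
    show "commutator f g \<in> ?R \<inter> lie_set" "commutator g f \<in> ?R \<inter> lie_set"
      if "f \<in> lie_set" "g \<in> ?R \<inter> lie_set" for f g
      using that lie_polys_commutator mult by (auto simp: commutator_def intro!: red_span_diff)
  qed auto
  moreover have "rb_relations lam X \<subseteq> ?R \<inter> lie_set"
    using rb_poly_red_span[OF ch] rb_relations_lie_set by (auto simp: rb_relations_def)
  ultimately show ?thesis using rb_ideal_minimal by blast
qed

lemma irr_words_subset: "irr_words X \<subseteq> ALSW_op X"
  by (auto simp: irr_words_def)

text \<open>A nonzero such \<open>f\<close> would have an irreducible leading word as a combination
  of irreducible brackets, and a reducible one as an element of the rewriting span.\<close>

lemma irr_span_rb_ideal:
  assumes ch: "valid_choice X ch" and f: "f \<in> opoly.span (lyndon_elem ` irr_words X)" "f \<in> rb_ideal"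
  shows "f = 0"
proof (rule ccontr)
  assume nz: "f \<noteq> 0"
  have ld: "leads (lyndon_elem w :: ('x, 'k) opoly) w" if "w \<in> irr_words X" for w
    using that leads_bracket[of w X] irr_words_subset by blast
  from span_leading_word[OF subset_trans[OF irr_words_subset ALSW_op_subset_words] ld f(1) nz]
  obtain w where w: "w \<in> irr_words X" "w \<in> keys f" "\<And>v. v \<in> keys f \<Longrightarrow> dl_le v w" by blast
  from red_span_leading_word[OF ch subsetD[OF rb_ideal_red_span[OF ch] f(2)] nz]
  obtain w' where w': "reducible X w'" "w' \<in> keys f" "\<And>v. v \<in> keys f \<Longrightarrow> dl_le v w'" by blast
  have "w = w'" using w(3)[OF w'(2)] w'(3)[OF w(2)] dl_less_asym[of w w'] by (auto simp: dl_le_def)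
  then show False using w(1) w'(1) by (simp add: irr_words_def)
qed

lemma rb_special_normal_rb_ideal:
  assumes ch: "valid_choice X ch" and "rb_special_normal lam X ch w g"
  shows "g \<in> rb_ideal"
proof -
  from assms(2) obtain \<pi> u v where \<pi>: "\<pi> \<in> star_words X" and uv: "u \<in> irr_words X" "v \<in> irr_words X" "dl_less v u"
    and w: "w = plug \<pi> [Op u, Op v]" "w \<in> ALSW_op X" and g: "g = special_normal X ch \<pi> (rb_poly lam u v)"
    unfolding rb_special_normal_def by blast
  have uvA: "u \<in> ALSW_op X" "v \<in> ALSW_op X" using uv irr_words_subset by auto
  have "[Op u, Op v] \<in> ALSW_op X"
    using decreasing_Op_ALSW[of u X v "[]"] Op_in_ALSW_op[of v X] uv(3) uvA by simp
  from special_normal_rb_ideal[OF ch \<pi> this w(2)[unfolded w(1)] leads_rb_poly[OF uvA uv(3)] rb_poly_rb_ideal[OF uvA]]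
  show ?thesis by (simp add: g)
qed

lemma lie_set_reduce:
  assumes ch: "valid_choice X ch" and f: "f \<in> lie_set"
  shows "\<exists>g\<in>opoly.span (lyndon_elem ` irr_words X). f - g \<in> rb_ideal"
proof -
  let ?N = "{g. \<exists>w. rb_special_normal lam X ch w g}"
  have "lyndon_elem u \<in> opoly.span (lyndon_elem ` irr_words X \<union> ?N)" if "u \<in> ALSW_op X" for u
    by (rule subsetD[OF opoly.span_mono reduction[OF ch that, of lam]]) blast
  then have "lie_set \<subseteq> opoly.span (lyndon_elem ` irr_words X \<union> ?N)"
    unfolding lie_polys_def by (intro opoly.span_minimal) auto
  then obtain g h where gh: "f = g + h" "g \<in> opoly.span (lyndon_elem ` irr_words X)" "h \<in> opoly.span ?N"
    using f unfolding opoly.span_Un by blast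
  have "opoly.span ?N \<subseteq> rb_ideal"
    using rb_special_normal_rb_ideal[OF ch] rb_ideal_subspace by (intro opoly.span_minimal) auto
  then show ?thesis using gh by (intro bexI[of _ g]) auto
qed

section \<open>Triviality of the compositions\<close>

lemma trivial_mod_0: "trivial_mod X ch S w 0"
  unfolding trivial_mod_def by (intro exI[of _ "0::nat"]) simp

lemma trivial_mod_add:
  assumes h: "trivial_mod X ch S w h" and s: "s \<in> S" "\<pi> \<in> star_words X"
    "plug \<pi> (lead_word s) \<in> ALSW_op X" "dl_less (plug \<pi> (lead_word s)) w"
  shows "trivial_mod X ch S w (scale c (special_normal X ch \<pi> s) + h)"
proof -
  from h obtain n :: nat and \<alpha> \<rho> t where
    t: "\<forall>i<n. t i \<in> S \<and> \<rho> i \<in> star_words X \<and> plug (\<rho> i) (lead_word (t i)) \<in> ALSW_op X \<and>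
        dl_less (plug (\<rho> i) (lead_word (t i))) w"
    and h: "h = (\<Sum>i<n. scale (\<alpha> i) (special_normal X ch (\<rho> i) (t i)))"
    unfolding trivial_mod_def by blast
  show ?thesis unfolding trivial_mod_def
  proof (intro exI conjI)
    show "\<forall>i<Suc n. (t(n := s)) i \<in> S \<and> (\<rho>(n := \<pi>)) i \<in> star_words X \<and>
        plug ((\<rho>(n := \<pi>)) i) (lead_word ((t(n := s)) i)) \<in> ALSW_op X \<and>
        dl_less (plug ((\<rho>(n := \<pi>)) i) (lead_word ((t(n := s)) i))) w"
      using t s by (auto simp: less_Suc_eq)
    show "scale c (special_normal X ch \<pi> s) + h =
        (\<Sum>i<Suc n. scale ((\<alpha>(n := c)) i) (special_normal X ch ((\<rho>(n := \<pi>)) i) ((t(n := s)) i)))"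
      unfolding h by (simp add: add.commute)
  qed
qed

lemma rb_ideal_trivial_mod:
  assumes ch: "valid_choice X ch" and h: "h \<in> rb_ideal" and bel: "below h w"
  shows "trivial_mod X ch (rb_relations lam X) w h"
proof (cases "h = 0")
  case True
  show ?thesis unfolding True by (rule trivial_mod_0)
next
  case False
  have "h \<in> lie_set" using h rb_ideal_subset by blast
  from lie_polys_leading_word[OF this False] obtain w' where w': "w' \<in> keys h"
    and sp: "h \<in> opoly.span (lyndon_elem ` {v \<in> ALSW_op X. dl_le v w'})" by blast
  have lt: "dl_less w' w" using bel w' by (auto simp: below_def)
  let ?N = "{g. \<exists>v. rb_special_normal lam X ch v g \<and> dl_le v w'}"
  have "lyndon_elem u \<in> opoly.span (lyndon_elem ` irr_words X \<union> ?N)" if "u \<in> ALSW_op X" "dl_le u w'" for u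
    by (rule subsetD[OF opoly.span_mono reduction[OF ch that(1), of lam]]) (use dl_le_trans[OF _ that(2)] in blast)
  then have "opoly.span (lyndon_elem ` {v \<in> ALSW_op X. dl_le v w'}) \<subseteq> opoly.span (lyndon_elem ` irr_words X \<union> ?N)"
    by (intro opoly.span_minimal) auto
  then obtain x y where xy: "h = x + y" "x \<in> opoly.span (lyndon_elem ` irr_words X)" "y \<in> opoly.span ?N"
    using sp unfolding opoly.span_Un by blast
  have "opoly.span ?N \<subseteq> rb_ideal"
    using rb_special_normal_rb_ideal[OF ch] rb_ideal_subspace by (intro opoly.span_minimal) auto
  \<comment> \<open>The irreducible part is a difference of two elements of the ideal and hence
    vanishes; what remains are special normal words with leading words at most \<open>w'\<close>,
    thus below \<open>w\<close>.\<close>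
  then have "x \<in> rb_ideal" using xy h opoly.subspace_diff[OF rb_ideal_subspace, of h y] by auto
  then have "x = 0" using irr_span_rb_ideal[OF ch] xy by blast
  have "trivial_mod X ch (rb_relations lam X) w y"
    using xy(3)
  proof (induction rule: opoly.span_induct_alt)
    case (step c g y)
    then obtain \<pi> u v where \<pi>: "\<pi> \<in> star_words X" and uv: "u \<in> irr_words X" "v \<in> irr_words X" "dl_less v u"
      and p: "plug \<pi> [Op u, Op v] \<in> ALSW_op X" "dl_le (plug \<pi> [Op u, Op v]) w'"
      and g: "g = special_normal X ch \<pi> (rb_poly lam u v)"
      unfolding rb_special_normal_def by blast
    have uvA: "u \<in> ALSW_op X" "v \<in> ALSW_op X" using uv irr_words_subset by auto
    have lw: "lead_word (rb_poly lam u v) = [Op u, Op v]" by (rule lead_word_eq[OF leads_rb_poly[OF uvA uv(3)]])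
    have "rb_poly lam u v \<in> rb_relations lam X" using uvA uv(3) unfolding rb_relations_def by blast
    moreover have "dl_less (plug \<pi> [Op u, Op v]) w" using p(2) lt by (rule dl_le_less_trans)
    ultimately show ?case unfolding g using step(2) \<pi> p by (intro trivial_mod_add) (simp_all add: lw)
  qed (rule trivial_mod_0)
  then show ?thesis using xy(1) \<open>x = 0\<close> by simp
qed

lemma composition_trivial:
  assumes ch: "valid_choice X ch" and f: "f \<in> rb_relations lam X" and g: "g \<in> rb_relations lam X"
    and comp: "composition X ch f g w h"
  shows "trivial_mod X ch (rb_relations lam X) w h"
proof -
  from f obtain u v where uv: "f = rb_poly lam u v" "u \<in> ALSW_op X" "v \<in> ALSW_op X" "dl_less v u"
    by (auto simp: rb_relations_def)
  from g obtain u' v' where uv': "g = rb_poly lam u' v'" "u' \<in> ALSW_op X" "v' \<in> ALSW_op X" "dl_less v' u'"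
    by (auto simp: rb_relations_def)
  have lf: "leads f [Op u, Op v]" and lg: "leads g [Op u', Op v']" using uv uv' leads_rb_poly by auto
  have fA: "[Op u, Op v] \<in> ALSW_op X" and gA: "[Op u', Op v'] \<in> ALSW_op X"
    using decreasing_Op_ALSW[of u X v "[]"] decreasing_Op_ALSW[of u' X v' "[]"]
      Op_in_ALSW_op[of v X] Op_in_ALSW_op[of v' X] uv uv' by auto
  have fI: "f \<in> rb_ideal" and gI: "g \<in> rb_ideal" using f g rb_relations_rb_ideal by auto
  note lw = lead_word_eq[OF lf] lead_word_eq[OF lg]
  from comp show ?thesis
  proof cases
    case (intersection a b)
    have w_eq: "w = [Op u, Op v] @ a" "w = b @ [Op u', Op v']" using intersection lw by simp_all
    have "length a + 2 = length w" using w_eq(1) by simp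
    moreover have "length b + 2 = length w" using w_eq(2) by simp
    moreover have "length w < 4" using intersection lw by simp
    moreover have "length a \<noteq> 0" "length b \<noteq> 0" using intersection(2,3) by (simp_all add: words_iff)
    \<comment> \<open>Both leading words have breadth two, so \<open>w\<close> has breadth three: it
      is less than four by hypothesis and more than two as \<open>a\<close> is nonempty. The overlap
      is therefore a single letter.\<close>
    ultimately have "length a = 1" "length b = 1" by linarith+
    then obtain p q where pq: "a = [p]" "b = [q]" by (auto simp: length_Suc_conv)
    have w: "w = [Op u, Op v, p]" "w = [q, Op u', Op v']" using w_eq pq by simp_all
    then have eqs: "u' = v" "p = Op v'" "q = Op u" by auto
    have wA: "w \<in> ALSW_op X" using decreasing_Op_ALSW[of u X v "[Op v']"] gA uv w eqs by simp
    have \<pi>: "Var None # emb a \<in> star_words X" "emb b @ [Var None] \<in> star_words X"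
      using star_words_append[OF star_words_star, of "[]" X a] star_words_append[OF star_words_star, of b X "[]"]
        intersection by (auto simp: words_iff)
    have pl: "plug (Var None # emb a) [Op u, Op v] = w" "plug (emb b @ [Var None]) [Op u', Op v'] = w"
      by (simp_all only: plug_Cons plug_simps plug_emb append_Nil2 flip: w_eq)
    have pA: "plug (Var None # emb a) [Op u, Op v] \<in> ALSW_op X" "plug (emb b @ [Var None]) [Op u', Op v'] \<in> ALSW_op X"
      unfolding pl by (rule wA)+
    have "h \<in> rb_ideal" unfolding intersection(1)
      by (rule opoly.subspace_diff[OF rb_ideal_subspace special_normal_rb_ideal[OF ch \<pi>(1) fA pA(1) lf fI]
            special_normal_rb_ideal[OF ch \<pi>(2) gA pA(2) lg gI]])
    moreover have "below h w" unfolding intersection(1)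
      by (rule below_leads_diff[OF leads_special_normal[OF ch \<pi>(1) fA pA(1) lf, unfolded pl(1)]
            leads_special_normal[OF ch \<pi>(2) gA pA(2) lg, unfolded pl(2)]])
    ultimately show ?thesis using rb_ideal_trivial_mod[OF ch] by blast
  next
    case (inclusion \<pi>)
    then have w: "w = [Op u, Op v]" "w = plug \<pi> [Op u', Op v']" using lw by auto
    then have pA: "plug \<pi> [Op u', Op v'] \<in> ALSW_op X" using fA by simp
    have "h \<in> rb_ideal" unfolding inclusion(1)
      by (rule opoly.subspace_diff[OF rb_ideal_subspace fI special_normal_rb_ideal[OF ch inclusion(2) gA pA lg gI]])
    moreover have "below h w" unfolding inclusion(1)
      by (rule below_leads_diff[OF lf[folded w(1)] leads_special_normal[OF ch inclusion(2) gA pA lg, folded w(2)]])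
    ultimately show ?thesis using rb_ideal_trivial_mod[OF ch] by blast
  qed
qed

lemma GS_basis_rb_relations:
  assumes ch: "valid_choice X ch"
  shows "GS_basis X ch (rb_relations lam X)"
  unfolding GS_basis_def
proof (intro conjI ballI allI impI)
  show "rb_relations lam X \<subseteq> carrier (free_lie_op X)"
    using rb_relations_lie_set by (simp add: free_lie_op_eq)
  show "monic_opoly f" if "f \<in> rb_relations lam X" for f
    using that leads_rb_poly leads_monic unfolding rb_relations_def by blast
qed (rule composition_trivial[OF ch])

end

section \<open>The quotient algebra\<close>

text \<open>All laws are equations, apart from the existence of negatives, whose witnesses are
  images too. They therefore pass to any image with induced operations, here to the quotient along
  the class map.\<close>

lemma lie_op_algebra_image:
  fixes L :: "('k::field, 'a, 'm) lie_op_scheme" and M :: "('k, 'b, 'n) lie_op_scheme"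
  assumes "lie_op_algebra L" and car: "carrier M = q ` carrier L" and zero: "\<zero>\<^bsub>M\<^esub> = q \<zero>\<^bsub>L\<^esub>"
    and add: "\<And>x y. x \<in> carrier L \<Longrightarrow> y \<in> carrier L \<Longrightarrow> q x \<oplus>\<^bsub>M\<^esub> q y = q (x \<oplus>\<^bsub>L\<^esub> y)"
    and smult: "\<And>c x. x \<in> carrier L \<Longrightarrow> c \<odot>\<^bsub>M\<^esub> q x = q (c \<odot>\<^bsub>L\<^esub> x)"
    and lbr: "\<And>x y. x \<in> carrier L \<Longrightarrow> y \<in> carrier L \<Longrightarrow> lbr M (q x) (q y) = q (lbr L x y)"
    and oper: "\<And>x. x \<in> carrier L \<Longrightarrow> oper M (q x) = q (oper L x)"
  shows "lie_op_algebra M"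
proof -
  interpret L: lie_op_algebra L by fact
  note [simp] = L.vsmult_closed L.lbr_closed L.oper_closed
  have grp: "abelian_group M"
  proof (rule abelian_groupI)
    fix x assume "x \<in> carrier M"
    then obtain a where a: "a \<in> carrier L" "x = q a" by (auto simp: car)
    then have "q (\<ominus>\<^bsub>L\<^esub> a) \<oplus>\<^bsub>M\<^esub> x = \<zero>\<^bsub>M\<^esub>" by (simp add: add zero L.M.l_neg)
    then show "\<exists>y\<in>carrier M. y \<oplus>\<^bsub>M\<^esub> x = \<zero>\<^bsub>M\<^esub>" using a by (auto simp: car)
  qed (auto simp: car add zero L.M.a_ac)
  have "Module.module class_ring M"
    by (rule moduleI[OF class_cring.is_cring grp])
      (auto simp: car smult add L.smult_l_distr[simplified] L.smult_r_distr[simplified]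
        L.smult_assoc1[simplified] L.smult_one[simplified])
  then have "vectorspace class_ring M" by (rule vectorspace.intro[OF _ class_field.field_axioms])
  moreover have "lie_op_algebra_axioms M"
    by (rule lie_op_algebra_axioms.intro)
      (auto simp: car smult add zero lbr oper L.lbr_add_left L.lbr_add_right L.lbr_smult_left L.lbr_smult_right
        L.lbr_alternating L.jacobi L.oper_add L.oper_smult)
  ultimately show ?thesis by (rule lie_op_algebra.intro)
qed

context
  fixes lam :: "'k::field" and X :: "'x::wellorder set"
begin

abbreviation (input) cls :: "('x, 'k) opoly \<Rightarrow> ('x, 'k) opoly set" where "cls \<equiv> RBL_class lam X"

abbreviation lie_alg :: "('k, ('x, 'k) opoly) lie_op" where "lie_alg \<equiv> opoly_lie (lie_polys X)"

lemmas idl_add = opoly.subspace_add[OF rb_ideal_subspace[of lam X]]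
  and idl_diff = opoly.subspace_diff[OF rb_ideal_subspace[of lam X]]
  and idl_scale = opoly.subspace_scale[OF rb_ideal_subspace[of lam X]]
  and idl_zero = opoly.subspace_0[OF rb_ideal_subspace[of lam X]]

lemma coset_eq: "I +>\<^bsub>lie_alg\<^esub> f = (\<lambda>h. h + f) ` I"
  by (auto simp: a_r_coset_def r_coset_def)

lemma cls_eq_image: "cls f = (\<lambda>h. h + f) ` rb_ideal lam X"
  by (simp add: RBL_class_def free_lie_op_eq coset_eq)

lemma coset_cls: "(rb_ideal lam X) +>\<^bsub>lie_alg\<^esub> f = cls f"
  by (simp add: cls_eq_image coset_eq)

lemma mem_cls_iff: "g \<in> cls f \<longleftrightarrow> g - f \<in> rb_ideal lam X"
  unfolding cls_eq_image by (auto simp: image_iff intro: bexI[of _ "g - f"])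

lemma cls_eq_iff: "cls f = cls g \<longleftrightarrow> f - g \<in> rb_ideal lam X"
proof
  assume "cls f = cls g"
  then have "f \<in> cls g" using idl_zero by (simp add: mem_cls_iff flip: \<open>cls f = cls g\<close>)
  then show "f - g \<in> rb_ideal lam X" by (simp add: mem_cls_iff)
next
  assume fg: "f - g \<in> rb_ideal lam X"
  have "h - f \<in> rb_ideal lam X \<longleftrightarrow> h - g \<in> rb_ideal lam X" for h
    using idl_add[of "h - f" "f - g"] idl_diff[of "h - g" "f - g"] fg by (auto simp: algebra_simps)
  then show "cls f = cls g" by (auto simp: mem_cls_iff)
qed

lemma cls_self: "f \<in> cls f"
  using idl_zero by (simp add: mem_cls_iff)

text \<open>The operations of the quotient are unions of cosets over all representatives; once every
  representative yields the same coset, the union collapses to it.\<close>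

lemma UN_cls: "(\<And>g. g \<in> cls f \<Longrightarrow> F g = A) \<Longrightarrow> (\<Union>g\<in>cls f. F g) = A"
  using cls_self[of f] by blast

lemma cls_subset: "f \<in> lie_polys X \<Longrightarrow> g \<in> cls f \<Longrightarrow> g \<in> lie_polys X"
  using opoly.subspace_add[OF lie_set_subspace[of X], of "g - f" f] rb_ideal_subset[of lam X]
  by (auto simp: mem_cls_iff)

lemma RBL_simps:
  "carrier (RBL lam X) = cls ` lie_polys X" "\<zero>\<^bsub>RBL lam X\<^esub> = cls 0"
  "f \<in> lie_polys X \<Longrightarrow> g \<in> lie_polys X \<Longrightarrow> cls f \<oplus>\<^bsub>RBL lam X\<^esub> cls g = cls (f + g)"
  "f \<in> lie_polys X \<Longrightarrow> c \<odot>\<^bsub>RBL lam X\<^esub> cls f = cls (scale c f)"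
  "f \<in> lie_polys X \<Longrightarrow> g \<in> lie_polys X \<Longrightarrow> lbr (RBL lam X) (cls f) (cls g) = cls (commutator f g)"
  "f \<in> lie_polys X \<Longrightarrow> oper (RBL lam X) (cls f) = cls (opP f)"
proof -
  have Q: "RBL lam X = quotient_lie lie_alg (RBL_ideal lam X)" by (simp add: RBL_def free_lie_op_eq)
  show "carrier (RBL lam X) = cls ` lie_polys X"
    by (auto simp: Q quotient_lie_def A_RCOSETS_def' coset_cls)
  show "\<zero>\<^bsub>RBL lam X\<^esub> = cls 0" by (simp add: Q quotient_lie_def cls_eq_image)
  show "cls f \<oplus>\<^bsub>RBL lam X\<^esub> cls g = cls (f + g)"
  proof -
    have "h + k \<in> cls (f + g)" if "h \<in> cls f" "k \<in> cls g" for h k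
      using idl_add[of "h - f" "k - g"] that by (simp add: mem_cls_iff algebra_simps)
    moreover have "\<exists>k\<in>cls f. \<exists>l\<in>cls g. h = k + l" if "h \<in> cls (f + g)" for h
      using that cls_self[of g] by (intro bexI[of _ "h - g"] bexI[of _ g]) (auto simp: mem_cls_iff algebra_simps)
    ultimately show ?thesis by (auto simp: Q quotient_lie_def set_add_def')
  qed
  show "c \<odot>\<^bsub>RBL lam X\<^esub> cls f = cls (scale c f)" if "f \<in> lie_polys X"
  proof -
    have "cls (scale c g) = cls (scale c f)" if "g \<in> cls f" for g
      using that idl_scale[of "g - f" c] by (simp add: cls_eq_iff mem_cls_iff opoly.scale_right_diff_distrib)
    then have "(\<Union>g\<in>cls f. cls (scale c g)) = cls (scale c f)" by (rule UN_cls)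
    then show ?thesis by (simp add: Q quotient_lie_def coset_cls)
  qed
  show "oper (RBL lam X) (cls f) = cls (opP f)" if "f \<in> lie_polys X"
  proof -
    have "cls (opP g) = cls (opP f)" if "g \<in> cls f" for g
      using that rb_ideal_opP[of "g - f" lam X] by (simp add: cls_eq_iff mem_cls_iff opP_diff)
    then have "(\<Union>g\<in>cls f. cls (opP g)) = cls (opP f)" by (rule UN_cls)
    then show ?thesis by (simp add: Q quotient_lie_def coset_cls)
  qed
  show "lbr (RBL lam X) (cls f) (cls g) = cls (commutator f g)" if fg: "f \<in> lie_polys X" "g \<in> lie_polys X"
  proof -
    have "cls (commutator f' g') = cls (commutator f g)" if "f' \<in> cls f" "g' \<in> cls g" for f' g'
    proof -
      have "commutator (f' - f) g' + commutator f (g' - g) \<in> rb_ideal lam X"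
        using that fg cls_subset[OF fg(2) that(2)]
        by (intro idl_add rb_ideal_commutator) (auto simp: mem_cls_iff)
      moreover have "commutator (f' - f) g' + commutator f (g' - g) = commutator f' g' - commutator f g"
        by (simp add: commutator_def algebra_simps)
      ultimately show ?thesis by (simp add: cls_eq_iff)
    qed
    then have "(\<Union>f'\<in>cls f. \<Union>g'\<in>cls g. cls (commutator f' g')) = cls (commutator f g)"
      by (intro UN_cls)
    then show ?thesis by (simp add: Q quotient_lie_def coset_cls)
  qed
qed

lemma lie_op_algebra_RBL: "lie_op_algebra (RBL lam X)"
  by (rule lie_op_algebra_image[OF lie_op_algebra_lie_polys[of X, where 'k = 'k], of "RBL lam X" cls])
    (auto simp: RBL_simps)

lemma rota_baxter_RBL: "rota_baxter_lie_algebra lam (RBL lam X)"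
proof (rule rota_baxter_lie_algebra.intro[OF lie_op_algebra_RBL], rule rota_baxter_lie_algebra_axioms.intro)
  fix x y assume "x \<in> carrier (RBL lam X)" "y \<in> carrier (RBL lam X)"
  then obtain f g where fg: "f \<in> lie_polys X" "g \<in> lie_polys X" "x = cls f" "y = cls g"
    by (auto simp: RBL_simps)
  note [simp] = lie_polys_opP lie_polys_commutator opoly.subspace_add[OF lie_set_subspace[of X]]
    opoly.subspace_scale[OF lie_set_subspace[of X]]
  have "commutator (opP f) (opP g) - (opP (commutator (opP f) g) + opP (commutator f (opP g)) + scale lam (opP (commutator f g))) \<in> rb_ideal lam X"
    using rb_form_rb_ideal[OF fg(1,2)] by (simp add: rb_form_def rb_prod_def opP_add opP_scale)
  then show "lbr (RBL lam X) (oper (RBL lam X) x) (oper (RBL lam X) y) =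
      oper (RBL lam X) (lbr (RBL lam X) (oper (RBL lam X) x) y) \<oplus>\<^bsub>RBL lam X\<^esub>
      oper (RBL lam X) (lbr (RBL lam X) x (oper (RBL lam X) y)) \<oplus>\<^bsub>RBL lam X\<^esub>
      lam \<odot>\<^bsub>RBL lam X\<^esub> oper (RBL lam X) (lbr (RBL lam X) x y)"
    using fg by (simp add: RBL_simps cls_eq_iff)
qed

end

section \<open>Freeness\<close>

text \<open>Home of the graph of a homomorphism: the spanning theorem applied to pairs expands both
  components simultaneously.\<close>

definition prod_lie :: "('k::field, 'a) lie_op \<Rightarrow> ('k, 'b) lie_op \<Rightarrow> ('k, 'a \<times> 'b) lie_op" where
  "prod_lie L M = \<lparr>carrier = carrier L \<times> carrier M, mult = undefined, one = undefined,
     zero = (\<zero>\<^bsub>L\<^esub>, \<zero>\<^bsub>M\<^esub>), add = (\<lambda>x y. (fst x \<oplus>\<^bsub>L\<^esub> fst y, snd x \<oplus>\<^bsub>M\<^esub> snd y)),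
     smult = (\<lambda>c x. (c \<odot>\<^bsub>L\<^esub> fst x, c \<odot>\<^bsub>M\<^esub> snd x)),
     lbr = (\<lambda>x y. (lbr L (fst x) (fst y), lbr M (snd x) (snd y))), oper = (\<lambda>x. (oper L (fst x), oper M (snd x)))\<rparr>"

lemma prod_lie_simps [simp]:
  "carrier (prod_lie L M) = carrier L \<times> carrier M" "\<zero>\<^bsub>prod_lie L M\<^esub> = (\<zero>\<^bsub>L\<^esub>, \<zero>\<^bsub>M\<^esub>)"
  "x \<oplus>\<^bsub>prod_lie L M\<^esub> y = (fst x \<oplus>\<^bsub>L\<^esub> fst y, snd x \<oplus>\<^bsub>M\<^esub> snd y)"
  "c \<odot>\<^bsub>prod_lie L M\<^esub> x = (c \<odot>\<^bsub>L\<^esub> fst x, c \<odot>\<^bsub>M\<^esub> snd x)"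
  "lbr (prod_lie L M) x y = (lbr L (fst x) (fst y), lbr M (snd x) (snd y))"
  "oper (prod_lie L M) x = (oper L (fst x), oper M (snd x))"
  by (simp_all add: prod_lie_def)

lemma lie_op_algebra_prod:
  fixes L :: "('k::field, 'a) lie_op" and M :: "('k, 'b) lie_op"
  assumes "lie_op_algebra L" "lie_op_algebra M"
  shows "lie_op_algebra (prod_lie L M)"
proof -
  interpret L: lie_op_algebra L by fact
  interpret M: lie_op_algebra M by fact
  note [simp] = L.vsmult_closed L.lbr_closed L.oper_closed M.vsmult_closed M.lbr_closed M.oper_closed
  have grp: "abelian_group (prod_lie L M)"
  proof (rule abelian_groupI)
    fix x assume x: "x \<in> carrier (prod_lie L M)"
    then show "\<exists>y\<in>carrier (prod_lie L M). y \<oplus>\<^bsub>prod_lie L M\<^esub> x = \<zero>\<^bsub>prod_lie L M\<^esub>"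
      by (intro bexI[of _ "(\<ominus>\<^bsub>L\<^esub> fst x, \<ominus>\<^bsub>M\<^esub> snd x)"]) (auto simp: L.M.l_neg M.M.l_neg)
  qed (auto simp: L.M.a_ac M.M.a_ac)
  have "Module.module class_ring (prod_lie L M)"
    by (rule moduleI[OF class_cring.is_cring grp])
      (auto simp: L.smult_l_distr[simplified] L.smult_r_distr[simplified] L.smult_assoc1[simplified] L.smult_one[simplified]
        M.smult_l_distr[simplified] M.smult_r_distr[simplified] M.smult_assoc1[simplified] M.smult_one[simplified])
  then have "vectorspace class_ring (prod_lie L M)" by (rule vectorspace.intro[OF _ class_field.field_axioms])
  moreover have "lie_op_algebra_axioms (prod_lie L M)"
    by (rule lie_op_algebra_axioms.intro)
      (auto simp: L.lbr_add_left L.lbr_add_right L.lbr_smult_left L.lbr_smult_right L.lbr_alternating L.jacobi L.oper_add L.oper_smult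
        M.lbr_add_left M.lbr_add_right M.lbr_smult_left M.lbr_smult_right M.lbr_alternating M.jacobi M.oper_add M.oper_smult)
  ultimately show ?thesis by (rule lie_op_algebra.intro)
qed

lemma leval_prod: "leval (prod_lie L M) (\<lambda>x. (\<phi> x, \<psi> x)) t = (leval L \<phi> t, leval M \<psi> t)"
  by (induction t) auto

lemma lspan_finite:
  "x \<in> lspan L B \<Longrightarrow> \<exists>F. finite F \<and> F \<subseteq> B \<and> x \<in> lspan L F"
proof (induction rule: lspan.induct)
  case (lspan_base x)
  then show ?case by (intro exI[of _ "{x}"]) (auto intro: lspan.lspan_base)
next
  case lspan_zero
  then show ?case by (intro exI[of _ "{}"]) (auto intro: lspan.lspan_zero)
next
  case (lspan_add x y)
  then obtain F G where "finite F" "F \<subseteq> B" "x \<in> lspan L F" "finite G" "G \<subseteq> B" "y \<in> lspan L G" by blast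
  then show ?case using lspan_mono[of F "F \<union> G" L] lspan_mono[of G "F \<union> G" L]
    by (intro exI[of _ "F \<union> G"]) (auto intro!: lspan.lspan_add)
qed (auto intro: lspan.lspan_smult)

lemma (in lie_op_algebra) lspan_insert:
  assumes "x \<in> lspan L (insert b B)" "insert b B \<subseteq> carrier L"
  shows "\<exists>c. \<exists>y\<in>lspan L B. x = c \<odot>\<^bsub>L\<^esub> b \<oplus> y"
  using assms(1)
proof induction
  case (lspan_base x)
  then show ?case
  proof
    assume "x = b"
    then have eq: "x = 1 \<odot>\<^bsub>L\<^esub> b \<oplus> \<zero>" using assms(2) smult_one[of b] by simp
    show ?thesis by (rule exI[of _ 1], rule bexI[of _ \<zero>], rule eq, rule lspan.lspan_zero)
  next
    assume "x \<in> B"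
    then have eq: "x = 0 \<odot>\<^bsub>L\<^esub> b \<oplus> x" using assms(2) zero_smult[of b] by auto
    show ?thesis by (rule exI[of _ 0], rule bexI[of _ x], rule eq, rule lspan.lspan_base[OF \<open>x \<in> B\<close>])
  qed
next
  case lspan_zero
  have eq: "\<zero> = 0 \<odot>\<^bsub>L\<^esub> b \<oplus> \<zero>" using assms(2) zero_smult[of b] by auto
  show ?case by (rule exI[of _ 0], rule bexI[of _ \<zero>], rule eq, rule lspan.lspan_zero)
next
  case (lspan_add x x')
  then obtain c y c' y' where y: "y \<in> lspan L B" "x = c \<odot>\<^bsub>L\<^esub> b \<oplus> y" "y' \<in> lspan L B" "x' = c' \<odot>\<^bsub>L\<^esub> b \<oplus> y'" by blast
  have cl: "b \<in> carrier L" "y \<in> carrier L" "y' \<in> carrier L" using assms(2) y lspan_closed[of B] by auto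
  have eq: "x \<oplus> x' = (c + c') \<odot>\<^bsub>L\<^esub> b \<oplus> (y \<oplus> y')"
    using cl y smult_l_distr[of c c' b] vsmult_closed by (simp add: M.a_ac)
  show ?case by (rule exI[of _ "c + c'"], rule bexI[of _ "y \<oplus> y'"], rule eq, rule lspan.lspan_add[OF y(1,3)])
next
  case (lspan_smult x a)
  then obtain c y where y: "y \<in> lspan L B" "x = c \<odot>\<^bsub>L\<^esub> b \<oplus> y" by blast
  have cl: "b \<in> carrier L" "y \<in> carrier L" using assms(2) y lspan_closed[of B] by auto
  have eq: "a \<odot>\<^bsub>L\<^esub> x = (a * c) \<odot>\<^bsub>L\<^esub> b \<oplus> a \<odot>\<^bsub>L\<^esub> y"
    using cl y smult_assoc1[of a c b] smult_r_distr[of a "c \<odot>\<^bsub>L\<^esub> b" y] vsmult_closed by simp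
  show ?case by (rule exI[of _ "a * c"], rule bexI[of _ "a \<odot>\<^bsub>L\<^esub> y"], rule eq, rule lspan.lspan_smult[OF y(1)])
qed

text \<open>The homomorphism extending \<open>\<phi>\<close> is obtained as its graph, the subalgebra of the
  product generated by the pairs \<open>(\<phi> x, x)\<close>. It is spanned by the Lyndon-Shirshov brackets, whose
  second components are linearly independent, so the graph is functional.\<close>

context
  fixes X :: "'x::wellorder set" and M :: "('k::field, 'l) lie_op" and \<phi> :: "'x \<Rightarrow> 'l"
  assumes M: "lie_op_algebra M" and \<phi>: "\<phi> \<in> X \<rightarrow> carrier M"
begin

interpretation M: lie_op_algebra M by (rule M)

abbreviation graph_alg :: "('k, 'l \<times> ('x, 'k) opoly) lie_op" where
  "graph_alg \<equiv> prod_lie M (opoly_lie (lie_polys X))"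

abbreviation graph_gen :: "'x \<Rightarrow> 'l \<times> ('x, 'k) opoly" where
  "graph_gen \<equiv> \<lambda>x. (\<phi> x, wd [Var x])"

abbreviation graph_pair :: "'x word \<Rightarrow> 'l \<times> ('x, 'k) opoly" where
  "graph_pair \<equiv> \<lambda>u. (leval M \<phi> (bracket u), lyndon_elem u)"

definition hom_graph :: "('l \<times> ('x, 'k) opoly) set" where
  "hom_graph = lspan graph_alg (graph_pair ` ALSW_op X)"

lemma lie_op_algebra_graph_alg: "lie_op_algebra graph_alg"
  by (rule lie_op_algebra_prod[OF M lie_op_algebra_lie_polys])

interpretation G: lie_op_algebra graph_alg by (rule lie_op_algebra_graph_alg)

lemma wd_Var_lie_polys: "x \<in> X \<Longrightarrow> wd [Var x] \<in> (lie_polys X :: ('x, 'k) opoly set)"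
  using lie_elem_lie_polys[of "NVar x" X] by (simp add: words_iff)

lemma graph_gen_closed: "graph_gen \<in> X \<rightarrow> carrier graph_alg"
  using \<phi> wd_Var_lie_polys by auto

lemma graph_pairs: "lyndon_brackets graph_alg graph_gen X = graph_pair ` ALSW_op X"
  by (simp add: lyndon_brackets_def leval_prod leval_opoly)

lemma graph_pair_closed: "graph_pair ` ALSW_op X \<subseteq> carrier graph_alg"
  using G.lyndon_brackets_closed[OF graph_gen_closed] unfolding graph_pairs .

lemma hom_graph_closed: "(m, f) \<in> hom_graph \<Longrightarrow> m \<in> carrier M \<and> f \<in> lie_polys X"
  using G.lspan_closed[OF graph_pair_closed, of "(m, f)"] by (auto simp: hom_graph_def)

lemma hom_graph_ops:
  "(m, f) \<in> hom_graph \<Longrightarrow> (n, g) \<in> hom_graph \<Longrightarrow> (m \<oplus>\<^bsub>M\<^esub> n, f + g) \<in> hom_graph"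
  "(m, f) \<in> hom_graph \<Longrightarrow> (c \<odot>\<^bsub>M\<^esub> m, scale c f) \<in> hom_graph"
  "(m, f) \<in> hom_graph \<Longrightarrow> (n, g) \<in> hom_graph \<Longrightarrow> (lbr M m n, commutator f g) \<in> hom_graph"
  "(m, f) \<in> hom_graph \<Longrightarrow> (oper M m, opP f) \<in> hom_graph"
  using lspan_add[of "(m, f)" graph_alg "graph_pair ` ALSW_op X" "(n, g)"]
    lspan_smult[of "(m, f)" graph_alg "graph_pair ` ALSW_op X" c]
    G.lspan_lyndon_lbr[OF graph_gen_closed, of "(m, f)" "(n, g)"]
    G.lspan_lyndon_oper[OF graph_gen_closed, of "(m, f)"]
  unfolding graph_pairs by (simp_all add: hom_graph_def)

lemma lspan_empty: "x \<in> lspan graph_alg {} \<Longrightarrow> x = \<zero>\<^bsub>graph_alg\<^esub>"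
proof (induction rule: lspan.induct)
  case (lspan_smult x c)
  then show ?case using G.smult_r_null[of c] by (simp del: prod_lie_simps)
qed (simp_all del: prod_lie_simps)

lemma hom_graph_zero_aux:
  "finite F \<Longrightarrow> F \<subseteq> ALSW_op X \<Longrightarrow> (m, 0) \<in> lspan graph_alg (graph_pair ` F) \<Longrightarrow> m = \<zero>\<^bsub>M\<^esub>"
proof (induction "card F" arbitrary: F m)
  case 0
  then show ?case using lspan_empty[of "(m, 0)"] by simp
next
  case (Suc n)
  then have "F \<noteq> {}" by auto
  with Suc.prems obtain w where w: "w \<in> F" "\<And>v. v \<in> F \<Longrightarrow> dl_le v w"
    using finite_words_max[of F X] subset_trans[OF Suc.prems(2) ALSW_op_subset_words] by blast
  let ?B = "graph_pair ` (F - {w})"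
  have F: "graph_pair ` F = insert (graph_pair w) ?B" using w(1) by auto
  have "insert (graph_pair w) ?B \<subseteq> carrier graph_alg"
    unfolding F[symmetric] using graph_pair_closed Suc.prems(2) by blast
  from G.lspan_insert[OF Suc.prems(3)[unfolded F] this] obtain c y
    where y: "y \<in> lspan graph_alg ?B" and eq: "(m, 0) = c \<odot>\<^bsub>graph_alg\<^esub> graph_pair w \<oplus>\<^bsub>graph_alg\<^esub> y" by blast
  \<comment> \<open>Coefficients of the largest word \<open>w\<close> are compared in the second
    component: it is 1 in \<open>lyndon_elem w\<close> and 0 in \<open>snd y\<close>, which forces
    \<open>c = 0\<close> and removes \<open>w\<close> from \<open>F\<close>.\<close>
  have "below (snd y) w" using y
  proof (induction rule: lspan.induct)
    case (lspan_base x)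
    then obtain u where u: "u \<in> F" "u \<noteq> w" "x = graph_pair u" by blast
    then have "u \<in> ALSW_op X" "dl_less u w" using Suc.prems(2) w(2)[of u] by (auto simp: dl_le_def)
    then show ?case using leads_below[OF leads_bracket[of u X]] u(3) by simp
  qed (simp_all add: below_0 below_add below_scale)
  then have "lookup (snd y) w = 0" unfolding below_def by (metis dl_less_irrefl in_keys_iff)
  moreover have "0 = scale c (lyndon_elem w) + snd y" using eq by simp
  then have "lookup (scale c (lyndon_elem w) + snd y) w = 0" by (metis lookup_zero)
  moreover have "lookup (lyndon_elem w :: ('x, 'k) opoly) w = 1"
    using leads_bracket[of w X] w(1) Suc.prems(2) by (auto simp: leads_iff)
  ultimately have "c = 0" by (simp add: lookup_add)
  have "graph_pair w \<in> carrier graph_alg" "y \<in> carrier graph_alg"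
    using graph_pair_closed w(1) Suc.prems(2) G.lspan_closed[OF _ y] by blast+
  then have "(m, 0) = y" using eq G.zero_smult[of "graph_pair w"] unfolding \<open>c = 0\<close> by (simp del: prod_lie_simps)
  then have "(m, 0) \<in> lspan graph_alg ?B" using y by simp
  moreover have "n = card (F - {w})" using Suc.hyps(2) Suc.prems(1) w(1) by simp
  ultimately show ?case using Suc.hyps(1)[of "F - {w}" m] Suc.prems by blast
qed

lemma hom_graph_unique:
  assumes "(m, f) \<in> hom_graph" "(m', f) \<in> hom_graph"
  shows "m = m'"
proof -
  have cl: "m \<in> carrier M" "m' \<in> carrier M" using assms hom_graph_closed by auto
  have "(m \<oplus>\<^bsub>M\<^esub> (-1) \<odot>\<^bsub>M\<^esub> m', f + scale (-1) f) \<in> hom_graph"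
    by (rule hom_graph_ops(1)[OF assms(1) hom_graph_ops(2)[OF assms(2)]])
  then have "(m \<oplus>\<^bsub>M\<^esub> \<ominus>\<^bsub>M\<^esub> m', 0) \<in> lspan graph_alg (graph_pair ` ALSW_op X)"
    using M.minus_one_smult[OF cl(2)] by (simp add: hom_graph_def)
  from lspan_finite[OF this] obtain E where E: "finite E" "E \<subseteq> graph_pair ` ALSW_op X"
    "(m \<oplus>\<^bsub>M\<^esub> \<ominus>\<^bsub>M\<^esub> m', 0) \<in> lspan graph_alg E" by blast
  from finite_subset_image[OF E(1,2)] obtain F where "F \<subseteq> ALSW_op X" "finite F" "E = graph_pair ` F" by blast
  then have "m \<oplus>\<^bsub>M\<^esub> \<ominus>\<^bsub>M\<^esub> m' = \<zero>\<^bsub>M\<^esub>" using hom_graph_zero_aux[of F] E(3) by blast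
  moreover have "m = (m \<oplus>\<^bsub>M\<^esub> \<ominus>\<^bsub>M\<^esub> m') \<oplus>\<^bsub>M\<^esub> m'" using cl by (simp add: M.M.a_assoc M.M.l_neg)
  ultimately show ?thesis using cl by simp
qed

lemma hom_graph_exists:
  assumes "f \<in> lie_polys X" shows "\<exists>m. (m, f) \<in> hom_graph"
  using assms
proof (induction rule: lie_set_induct)
  case zero
  have "(\<zero>\<^bsub>M\<^esub>, 0) \<in> hom_graph" using lspan_zero[of graph_alg] by (simp add: hom_graph_def)
  then show ?case ..
next
  case (lyndon u)
  then have "graph_pair u \<in> hom_graph" unfolding hom_graph_def by (intro lspan_base) blast
  then show ?case ..
next
  case (add c f g)
  then show ?case using hom_graph_ops(1)[OF hom_graph_ops(2)] by blast
qed

lemma free_lie_hom: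
  obtains H where "H \<in> lie_op_hom (opoly_lie (lie_polys X)) M" "\<And>x. x \<in> X \<Longrightarrow> H (wd [Var x]) = \<phi> x"
proof -
  define H where "H f = (THE m. (m, f) \<in> hom_graph)" for f
  have H: "H f = m" if "(m, f) \<in> hom_graph" for m f
    unfolding H_def using that hom_graph_unique by blast
  have gr: "(H f, f) \<in> hom_graph" if "f \<in> lie_polys X" for f
    using hom_graph_exists[OF that] H by metis
  have "H \<in> lie_op_hom (opoly_lie (lie_polys X)) M"
    unfolding lie_op_hom_def LinearCombinations.module_hom_def
    using gr hom_graph_closed by (auto intro!: H hom_graph_ops)
  moreover have "H (wd [Var x]) = \<phi> x" if "x \<in> X" for x
  proof -
    have "graph_pair [Var x] \<in> hom_graph"
      unfolding hom_graph_def using Var_in_ALSW_op[OF that] by (intro lspan_base) blast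
    then show ?thesis using H by (simp add: bracket_Var[OF that])
  qed
  ultimately show thesis by (rule that)
qed

end

section \<open>The universal property of the quotient\<close>

lemma lie_op_homD:
  assumes "h \<in> lie_op_hom L M"
  shows "x \<in> carrier L \<Longrightarrow> h x \<in> carrier M"
    "x \<in> carrier L \<Longrightarrow> y \<in> carrier L \<Longrightarrow> h (x \<oplus>\<^bsub>L\<^esub> y) = h x \<oplus>\<^bsub>M\<^esub> h y"
    "x \<in> carrier L \<Longrightarrow> h (c \<odot>\<^bsub>L\<^esub> x) = c \<odot>\<^bsub>M\<^esub> h x"
    "x \<in> carrier L \<Longrightarrow> y \<in> carrier L \<Longrightarrow> h (lbr L x y) = lbr M (h x) (h y)"
    "x \<in> carrier L \<Longrightarrow> h (oper L x) = oper M (h x)"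
  using assms by (auto simp: lie_op_hom_def LinearCombinations.module_hom_def)

context
  fixes lam :: "'k::field" and X :: "'x::wellorder set"
begin

lemma hom_kills_rb_ideal:
  assumes M: "rota_baxter_lie_algebra lam (M :: ('k, 'l) lie_op)"
    and H: "H \<in> lie_op_hom (opoly_lie (lie_polys X)) M" and f: "f \<in> RBL_ideal lam X"
  shows "H f = \<zero>\<^bsub>M\<^esub>"
proof -
  interpret M: rota_baxter_lie_algebra lam M by (rule M)
  note hom = lie_op_homD[OF H, unfolded opoly_lie_simps]
  note cl = lie_polys_opP[of _ X] lie_polys_commutator[of _ X] opoly.subspace_add[OF lie_set_subspace[of X]]
    opoly.subspace_scale[OF lie_set_subspace[of X]] lyndon_elem_lie_polys[of _ X]
  note mcl = M.vsmult_closed M.lbr_closed M.oper_closed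
  have H0: "H 0 = \<zero>\<^bsub>M\<^esub>"
    using hom(3)[of 0 0] M.zero_smult[OF hom(1)[of 0]] opoly.subspace_0[OF lie_set_subspace[of X]] by simp
  let ?K = "{f \<in> lie_polys X. H f = \<zero>\<^bsub>M\<^esub>}"
  have "lie_op_ideal ?K (opoly_lie (lie_polys X))"
    unfolding lie_op_ideal_iff
    by (auto simp: opoly.subspace_def hom cl H0 opoly.subspace_0[OF lie_set_subspace[of X]]
        M.smult_r_null[simplified] M.lbr_zero_left M.lbr_zero_right M.oper_zero)
  moreover have "rb_relations lam X \<subseteq> ?K"
  proof
    fix s assume "s \<in> rb_relations lam X"
    then obtain u v where uv: "u \<in> ALSW_op X" "v \<in> ALSW_op X" "s = rb_poly lam u v" by (auto simp: rb_relations_def)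
    let ?U = "lyndon_elem u :: ('x, 'k) opoly" and ?V = "lyndon_elem v :: ('x, 'k) opoly"
    have UV: "?U \<in> lie_polys X" "?V \<in> lie_polys X"
      by (rule lyndon_elem_lie_polys[OF uv(1)], rule lyndon_elem_lie_polys[OF uv(2)])
    have s: "s \<in> lie_polys X" using uv rb_poly_lie_polys by blast
    have PL: "opP (rb_prod lam ?U ?V) \<in> lie_polys X"
      by (rule lie_polys_opP[OF rb_form_lie_polys(1)[OF UV]])
    \<comment> \<open>Written as a sum, so that additivity of \<open>H\<close> applies directly; the
      Rota-Baxter identity in \<open>M\<close> then lets the second summand cancel.\<close>
    have "s + opP (rb_prod lam ?U ?V) = commutator (opP ?U) (opP ?V)"
      by (simp add: uv(3) rb_poly_eq rb_form_def)
    then have "H s \<oplus>\<^bsub>M\<^esub> H (opP (rb_prod lam ?U ?V)) = H (commutator (opP ?U) (opP ?V))"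
      using hom(2)[OF s PL] by simp
    also have "\<dots> = H (opP (rb_prod lam ?U ?V))"
      using M.rota_baxter[OF hom(1)[OF UV(1)] hom(1)[OF UV(2)]] UV
      by (simp add: rb_prod_def opP_add opP_scale hom cl)
    finally show "s \<in> ?K"
      using s hom(1)[OF s] hom(1)[OF PL] by simp
  qed
  ultimately have "RBL_ideal lam X \<subseteq> ?K" by (rule rb_ideal_minimal)
  then show ?thesis using f by blast
qed

lemma RBL_universal:
  assumes M: "rota_baxter_lie_algebra lam (M :: ('k, 'l) lie_op)" and \<phi>: "\<phi> \<in> X \<rightarrow> carrier M"
  shows "\<exists>!h. h \<in> lie_op_hom (RBL lam X) M \<inter> extensional (carrier (RBL lam X)) \<and>
    (\<forall>x\<in>X. h (RBL_class lam X (wd [Var x])) = \<phi> x)"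
proof -
  interpret M: rota_baxter_lie_algebra lam M by (rule M)
  let ?cls = "RBL_class lam X" and ?C = "lie_polys X :: ('x, 'k) opoly set"
  obtain H where H: "H \<in> lie_op_hom (opoly_lie ?C) M" and Hx: "\<And>x. x \<in> X \<Longrightarrow> H (wd [Var x]) = \<phi> x"
    by (rule free_lie_hom[OF M.lie_op_algebra_axioms \<phi>]) blast
  note hom = lie_op_homD[OF H, unfolded opoly_lie_simps]
  note cl = lie_polys_opP[of _ X] lie_polys_commutator[of _ X] opoly.subspace_add[OF lie_set_subspace[of X]]
    opoly.subspace_scale[OF lie_set_subspace[of X]]
  have Heq: "H f = H g" if fg: "f \<in> ?C" "g \<in> ?C" "?cls f = ?cls g" for f g
  proof -
    have I: "f - g \<in> RBL_ideal lam X" using fg(3) by (simp add: cls_eq_iff)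
    then have "H (f - g) = \<zero>\<^bsub>M\<^esub>" by (rule hom_kills_rb_ideal[OF M H])
    then show ?thesis using hom(2)[of "f - g" g] hom(1)[OF fg(2)] fg subsetD[OF rb_ideal_subset I] by simp
  qed
  \<comment> \<open>By \<open>Heq\<close> the choice of the representative does not matter; the
    restriction makes \<open>h\<close> extensional, as the uniqueness statement requires.\<close>
  define h where "h = restrict (\<lambda>A. H (SOME f. f \<in> ?C \<and> A = ?cls f)) (carrier (RBL lam X))"
  have h: "h (?cls f) = H f" if "f \<in> ?C" for f
  proof -
    have "(SOME g. g \<in> ?C \<and> ?cls f = ?cls g) \<in> ?C \<and> ?cls f = ?cls (SOME g. g \<in> ?C \<and> ?cls f = ?cls g)"
      using that by (intro someI[of "\<lambda>g. g \<in> ?C \<and> ?cls f = ?cls g" f]) simp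
    then have "H (SOME g. g \<in> ?C \<and> ?cls f = ?cls g) = H f" using that by (intro Heq) auto
    then show ?thesis using that by (simp add: h_def RBL_simps)
  qed
  have gen: "wd [Var x] \<in> ?C" if "x \<in> X" for x
    using lie_elem_lie_polys[of "NVar x" X] that by (simp add: words_iff)
  show ?thesis
  proof (rule ex1I[of _ h], intro conjI IntI)
    show "h \<in> lie_op_hom (RBL lam X) M"
      unfolding lie_op_hom_def LinearCombinations.module_hom_def
      by (auto simp: RBL_simps h hom cl)
    show "h \<in> extensional (carrier (RBL lam X))" by (simp add: h_def)
    show "\<forall>x\<in>X. h (?cls (wd [Var x])) = \<phi> x" using gen h Hx by simp
  next
    fix k assume k: "k \<in> lie_op_hom (RBL lam X) M \<inter> extensional (carrier (RBL lam X)) \<and>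
      (\<forall>x\<in>X. k (?cls (wd [Var x])) = \<phi> x)"
    then have kh: "k \<in> lie_op_hom (RBL lam X) M" by blast
    have khom: "f \<in> ?C \<Longrightarrow> k (?cls f) \<in> carrier M"
      "f \<in> ?C \<Longrightarrow> g \<in> ?C \<Longrightarrow> k (?cls (f + g)) = k (?cls f) \<oplus>\<^bsub>M\<^esub> k (?cls g)"
      "f \<in> ?C \<Longrightarrow> k (?cls (scale c f)) = c \<odot>\<^bsub>M\<^esub> k (?cls f)"
      "f \<in> ?C \<Longrightarrow> g \<in> ?C \<Longrightarrow> k (?cls (commutator f g)) = lbr M (k (?cls f)) (k (?cls g))"
      "f \<in> ?C \<Longrightarrow> k (?cls (opP f)) = oper M (k (?cls f))" for f g c
      using lie_op_homD[OF kh, of "?cls f"] lie_op_homD(2,4)[OF kh, of "?cls f" "?cls g"]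
      by (simp_all add: RBL_simps)
    have L: "(lie_elem t :: ('x, 'k) opoly) \<in> ?C" if "foliage t \<in> words X" for t
      by (rule lie_elem_lie_polys[OF that])
    \<comment> \<open>Uniqueness is first settled on bracketed words, where the homomorphism laws
      work node by node, and then extended linearly from the Lyndon-Shirshov brackets.\<close>
    have tree: "k (?cls (lie_elem t)) = H (lie_elem t)" if "foliage t \<in> words X" for t
      using that
    proof (induction t)
      case (NVar x)
      then have "x \<in> X" by (simp add: words_iff)
      then show ?case using k Hx by simp
    next
      case (NOp t)
      then show ?case using L[of t] by (simp add: words_Op khom hom)
    next
      case (NBr s t)
      then show ?case using L[of s] L[of t]
        by (simp add: words_append_iff khom hom)
    qed
    have "k (?cls f) = H f" if "f \<in> ?C" for f
      using that
    proof (induction rule: lie_set_induct)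
      case zero
      have "0 \<in> ?C" by (rule opoly.subspace_0[OF lie_set_subspace])
      then show ?case using khom(3)[of 0 0] hom(3)[of 0 0] khom(1)[of 0] hom(1)[of 0] M.zero_smult by simp
    next
      case (lyndon u)
      then show ?case using tree[of "bracket u"] foliage_bracket[OF lyndon] ALSW_op_subset_words by auto
    next
      case (add c f g)
      then show ?case by (simp add: khom hom cl)
    qed
    then have "k A = h A" if "A \<in> carrier (RBL lam X)" for A using that h by (auto simp: RBL_simps)
    then show "k = h" using k by (intro extensionalityI[of k "carrier (RBL lam X)" h]) (auto simp: h_def)
  qed
qed

lemma is_free_RBL:
  "is_free_rota_baxter_lie TYPE('l) lam X (\<lambda>x. RBL_class lam X (wd [Var x])) (RBL lam X)"
  unfolding is_free_rota_baxter_lie_def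
proof (intro conjI allI impI)
  show "(\<lambda>x. RBL_class lam X (wd [Var x])) \<in> X \<rightarrow> carrier (RBL lam X)"
    using lie_elem_lie_polys[of "NVar _" X] by (auto simp: RBL_simps words_iff)
  show "rota_baxter_lie_algebra lam (RBL lam X)" by (rule rota_baxter_RBL)
next
  fix M :: "('k, 'l) lie_op" and \<phi>
  assume "rota_baxter_lie_algebra lam M \<and> \<phi> \<in> X \<rightarrow> carrier M"
  then show "\<exists>!h. h \<in> lie_op_hom (RBL lam X) M \<inter> extensional (carrier (RBL lam X)) \<and>
      (\<forall>x\<in>X. h (RBL_class lam X (wd [Var x])) = \<phi> x)"
    using RBL_universal by (elim conjE)
qed

section \<open>The irreducible brackets form a basis\<close>

context
  fixes ch assumes ch: "valid_choice X ch"
begin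

abbreviation irr_class :: "'x word \<Rightarrow> ('x, 'k) opoly set" where
  "irr_class u \<equiv> RBL_class lam X (lyndon_elem u)"

text \<open>A basis is a set of classes, in which coinciding classes would go unnoticed; together
  with injectivity it says that the irreducible brackets are independent as a family.\<close>

lemma irr_class_inj: "inj_on irr_class (irr_words X)"
proof (rule inj_onI)
  fix u v assume uv: "u \<in> irr_words X" "v \<in> irr_words X" "irr_class u = irr_class v"
  have "lyndon_elem u - lyndon_elem v \<in> opoly.span (lyndon_elem ` irr_words X)"
    using uv by (intro opoly.span_diff opoly.span_base) auto
  moreover have "lyndon_elem u - lyndon_elem v \<in> RBL_ideal lam X" using uv(3) by (simp add: cls_eq_iff)
  ultimately have "lyndon_elem u - lyndon_elem v = (0 :: ('x, 'k) opoly)" by (rule irr_span_rb_ideal[OF ch])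
  then have eq: "lyndon_elem u = (lyndon_elem v :: ('x, 'k) opoly)" by simp
  have ld: "leads (lyndon_elem w :: ('x, 'k) opoly) w" if "w \<in> irr_words X" for w
    using that irr_words_subset leads_bracket[of w X] by blast
  from ld[OF uv(1)] ld[OF uv(2)]
  show "u = v" unfolding eq by (rule leads_unique[symmetric])
qed

lemma lyndon_sum_zero:
  assumes "finite F" "F \<subseteq> ALSW_op X" "(\<Sum>u\<in>F. scale (c u) (lyndon_elem u)) = (0 :: ('x, 'k) opoly)" "v \<in> F"
  shows "c v = 0"
proof (rule ccontr)
  assume "c v \<noteq> 0"
  let ?W = "F - {v}"
  have "scale (c v) (lyndon_elem v) + (\<Sum>u\<in>?W. scale (c u) (lyndon_elem u)) = (0 :: ('x, 'k) opoly)"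
    using assms sum.remove[OF assms(1,4), of "\<lambda>u. scale (c u) (lyndon_elem u)"] by simp
  then have "scale (c v) (lyndon_elem v) = - (\<Sum>u\<in>?W. scale (c u) (lyndon_elem u) :: ('x, 'k) opoly)"
    by (simp add: eq_neg_iff_add_eq_0)
  then have "scale (c v) (lyndon_elem v) \<in> opoly.span ((lyndon_elem :: _ \<Rightarrow> ('x, 'k) opoly) ` ?W)"
    by (metis (no_types, lifting) imageI opoly.span_base opoly.span_neg opoly.span_scale opoly.span_sum)
  from opoly.span_scale[OF this, of "inverse (c v)"] \<open>c v \<noteq> 0\<close>
  have sp: "lyndon_elem v \<in> opoly.span ((lyndon_elem :: _ \<Rightarrow> ('x, 'k) opoly) ` ?W)" by simp
  have v: "leads (lyndon_elem v :: ('x, 'k) opoly) v" using assms leads_bracket[of v X] by blast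
  have ld: "leads (lyndon_elem w :: ('x, 'k) opoly) w" if "w \<in> ?W" for w
    using that assms(2) leads_bracket[of w X] by blast
  have "?W \<subseteq> words X" using assms(2) ALSW_op_subset_words by blast
  from span_leading_word[OF this ld sp leads_nonzero[OF v]]
  obtain w where w: "w \<in> ?W" "w \<in> keys (lyndon_elem v :: ('x, 'k) opoly)"
    "\<And>u. u \<in> keys (lyndon_elem v :: ('x, 'k) opoly) \<Longrightarrow> dl_le u w" by blast
  have "dl_le v w" "dl_le w v" using w v by (auto simp: leads_iff in_keys_iff)
  then have "w = v" using dl_less_asym[of v w] by (auto simp: dl_le_def)
  then show False using w(1) by blast
qed

lemma basis_RBL: "vectorspace.basis class_ring (RBL lam X) (irr_class ` irr_words X)"
proof -
  interpret R: lie_op_algebra "RBL lam X" by (rule lie_op_algebra_RBL)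
  let ?B = "irr_class ` irr_words X"
  have lie: "(lyndon_elem u :: ('x, 'k) opoly) \<in> lie_polys X" if "u \<in> irr_words X" for u
    using that irr_words_subset lyndon_elem_lie_polys by blast
  have sub: "?B \<subseteq> carrier (RBL lam X)" using lie by (auto simp: RBL_simps)
  have sum_lie: "(\<Sum>u\<in>F. scale (c u) (lyndon_elem u)) \<in> (lie_polys X :: ('x, 'k) opoly set)" if "F \<subseteq> irr_words X" for F c
    using that lie by (intro opoly.subspace_sum lie_set_subspace opoly.subspace_scale) auto
  \<comment> \<open>By injectivity a combination over a set of classes is a sum over words in which
    no two summands are merged.\<close>
  have comb: "R.lincomb a (irr_class ` F) = RBL_class lam X (\<Sum>u\<in>F. scale (a (irr_class u)) (lyndon_elem u))"
    if "finite F" "F \<subseteq> irr_words X" for a F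
    using that
  proof (induction F)
    case empty
    then show ?case by (simp add: R.lincomb_def RBL_simps)
  next
    case (insert u F)
    have cl: "irr_class ` F \<subseteq> carrier (RBL lam X)" "irr_class u \<in> carrier (RBL lam X)"
      using insert.prems sub by blast+
    have "irr_class u \<notin> irr_class ` F"
      using insert.hyps(2) insert.prems inj_on_eq_iff[OF irr_class_inj] by fastforce
    then have "R.lincomb a (insert (irr_class u) (irr_class ` F)) =
        a (irr_class u) \<odot>\<^bsub>RBL lam X\<^esub> irr_class u \<oplus>\<^bsub>RBL lam X\<^esub> R.lincomb a (irr_class ` F)"
      using R.lincomb_insert[of "irr_class ` F" a "irr_class u"] insert.hyps(1) cl by simp
    also have "\<dots> = RBL_class lam X (scale (a (irr_class u)) (lyndon_elem u) + (\<Sum>u\<in>F. scale (a (irr_class u)) (lyndon_elem u)))"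
      using insert lie[of u] sum_lie[of F] opoly.subspace_scale[OF lie_set_subspace lie[of u]]
      by (simp add: RBL_simps)
    finally show ?case using insert.hyps by simp
  qed
  have "R.lin_indpt ?B"
  proof
    assume "R.lin_dep ?B"
    then obtain A a v where A: "finite A" "A \<subseteq> ?B" "R.lincomb a A = \<zero>\<^bsub>RBL lam X\<^esub>" "v \<in> A" "a v \<noteq> 0"
      by (auto simp: R.lin_dep_def)
    from finite_subset_image[OF A(1,2)] obtain F where F: "F \<subseteq> irr_words X" "finite F" "A = irr_class ` F" by blast
    let ?s = "\<Sum>u\<in>F. scale (a (irr_class u)) (lyndon_elem u) :: ('x, 'k) opoly"
    have "RBL_class lam X ?s = RBL_class lam X 0" using comb[OF F(2,1)] A(3) F(3) by (simp add: RBL_simps)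
    then have "?s \<in> RBL_ideal lam X" by (simp add: cls_eq_iff)
    moreover have "?s \<in> opoly.span (lyndon_elem ` irr_words X)"
      using F(1) by (intro opoly.span_sum opoly.span_scale opoly.span_base) auto
    ultimately have "?s = 0" using irr_span_rb_ideal[OF ch] by blast
    moreover obtain u where "u \<in> F" "v = irr_class u" using A(4) F(3) by blast
    ultimately show False
      using lyndon_sum_zero[of F "\<lambda>u. a (irr_class u)" u] F(1,2) irr_words_subset A(5) by blast
  qed
  moreover have "R.span ?B = carrier (RBL lam X)"
  proof
    show "R.span ?B \<subseteq> carrier (RBL lam X)" using R.span_is_submodule[OF sub] by (simp add: submodule_def)
    show "carrier (RBL lam X) \<subseteq> R.span ?B"
    proof
      fix A assume "A \<in> carrier (RBL lam X)"
      then obtain f where f: "f \<in> lie_polys X" "A = RBL_class lam X f" by (auto simp: RBL_simps)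
      obtain g where g: "g \<in> opoly.span (lyndon_elem ` irr_words X)" "f - g \<in> RBL_ideal lam X"
        using lie_set_reduce[OF ch f(1)] by blast
      have "g \<in> lie_polys X \<and> RBL_class lam X g \<in> R.span ?B"
        using g(1)
      proof (induction rule: opoly.span_induct_alt)
        case base
        have "\<zero>\<^bsub>RBL lam X\<^esub> \<in> R.span ?B" using R.span_is_submodule[OF sub] by (rule submodule.zero_closed)
        then show ?case using opoly.subspace_0[OF lie_set_subspace] by (simp add: RBL_simps)
      next
        case (step c x y)
        then obtain u where u: "u \<in> irr_words X" "x = lyndon_elem u" by blast
        have "irr_class u \<in> R.span ?B" using u(1) R.in_own_span[OF sub] by blast
        then have "c \<odot>\<^bsub>RBL lam X\<^esub> irr_class u \<oplus>\<^bsub>RBL lam X\<^esub> RBL_class lam X y \<in> R.span ?B"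
          using step(2) submodule.m_closed[OF R.span_is_submodule[OF sub]]
            submodule.smult_closed[OF R.span_is_submodule[OF sub], of c] by simp
        moreover have "scale c x \<in> lie_polys X"
          unfolding u(2) by (rule opoly.subspace_scale[OF lie_set_subspace lie[OF u(1)]])
        moreover from this have "scale c x + y \<in> lie_polys X"
          by (rule opoly.subspace_add[OF lie_set_subspace _ conjunct1[OF step(2)]])
        ultimately show ?case using step(2) u lie[OF u(1)] by (simp add: RBL_simps)
      qed
      moreover have "A = RBL_class lam X g" using f(2) g(2) by (simp add: cls_eq_iff)
      ultimately show "A \<in> R.span ?B" by simp
    qed
  qed
  ultimately show ?thesis using sub by (simp add: R.basis_def)
qed

end

end

theorem theorem4p1:
  fixes lam :: "'k::field"
    and X :: "'x::wellorder set"
    and ch :: "'x choice"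
  assumes "valid_choice X ch"
  shows "GS_basis X ch (rb_relations lam X) \<and>
    is_free_rota_baxter_lie TYPE('l) lam X (\<lambda>x. RBL_class lam X (wd [Var x])) (RBL lam X) \<and>
    inj_on (\<lambda>t. RBL_class lam X (lie_elem t)) (Irr_RB X) \<and>
    vectorspace.basis class_ring (RBL lam X) ((\<lambda>t. RBL_class lam X (lie_elem t)) ` Irr_RB X)"
proof (intro conjI)
  show "GS_basis X ch (rb_relations lam X)" by (rule GS_basis_rb_relations[OF assms])
  show "is_free_rota_baxter_lie TYPE('l) lam X (\<lambda>x. RBL_class lam X (wd [Var x])) (RBL lam X)"
    by (rule is_free_RBL)
  show "inj_on (\<lambda>t. RBL_class lam X (lie_elem t)) (Irr_RB X)"
    using irr_class_inj[OF assms, of lam] unfolding Irr_RB_eq inj_on_def by blast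
  show "vectorspace.basis class_ring (RBL lam X) ((\<lambda>t. RBL_class lam X (lie_elem t)) ` Irr_RB X)"
    using basis_RBL[OF assms, of lam] unfolding Irr_RB_eq image_image .
qed

end
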